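(* Let $R\subseteq S$ be an integral FCP extension of commutative rings. There exists a greatest unramified subextension $R\subseteq{}^\omega_SR$ of $R\subseteq S$ (i.e. a greatest element ${}^\omega_SR$ of $[R,S]$ that is unramified over $R$). Then ${}^\omega_SR\subseteq S$ is u-closed, so that ${}^u_SR\subseteq{}^\omega_SR\subseteq{}^\square_SR$, where ${}^u_SR$ is the u-closure and ${}^\square_SR$ the $\kappa$-separable closure of $R$ in $S$.
   Context: All rings are commutative and unital. $[R,S]$ is the set of all $R$-subalgebras of $S$, ordered by inclusion; $R\subseteq S$ has FCP if each chain in $[R,S]$ is finite. A ring morphism $R\to T$ is unramified if $T$ is of finite type as an $R$-algebra and $\Omega_R(T)=I/I^2=0$, where $I=\ker(T\otimes_RT\to T)$. An extension $R\subseteq S$ is u-closed (anodal) if $b\in S$ lies in $R$ whenever $b^2-b\in R$ and $b^3-b^2\in R$. The u-closure ${}^u_SR$ is the smallest $B\in[R,S]$ such that $B\subseteq S$ is u-closed. An integral extension is $\kappa$-separable if all its residual extensions $\kappa_R(Q\cap R)\to\kappa_S(Q)$ ($Q\in\mathrm{Spec}(S)$) are separable algebraic field extensions. The $\kappa$-separable closure ${}^\square_SR$ is the greatest $V\in[R,S]$ such that $R\subseteq V$ is $\kappa$-separable (it exists for integral FCP extensions). *)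

theory Defs
  imports "HOL-Algebra.Algebra"
begin

text \<open>
  A ring extension \<open>R \<subseteq> S\<close> is given by a ring record \<open>S\<close> and a subring \<open>R\<close> of \<open>S\<close> (a subset of its
  carrier); an intermediate ring \<open>T\<close> is regarded as a ring in its own right through
  \<open>S\<lparr>carrier := T\<rparr>\<close>.
\<close>

section \<open>Intermediate rings, integrality and FCP\<close>

definition subalgebras :: "('a, 'm) ring_scheme \<Rightarrow> 'a set \<Rightarrow> 'a set set"
  where "subalgebras S R = {T. subring T S \<and> R \<subseteq> T}"

text \<open>
  Polynomials are lists of coefficients with the leading one first. The list \<open>\<one> # p\<close> is not
  required to be a normalised polynomial, so that the zero ring is integral over itself.
\<close>

definition integral_extension :: "('a, 'm) ring_scheme \<Rightarrow> 'a set \<Rightarrow> bool"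
  where "integral_extension S R \<longleftrightarrow>
    (\<forall>x \<in> carrier S. \<exists>p. set p \<subseteq> R \<and> ring.eval S (\<one>\<^bsub>S\<^esub> # p) x = \<zero>\<^bsub>S\<^esub>)"

definition FCP :: "('a, 'm) ring_scheme \<Rightarrow> 'a set \<Rightarrow> bool"
  where "FCP S R \<longleftrightarrow> (\<forall>C. subset.chain (subalgebras S R) C \<longrightarrow> finite C)"


section \<open>The tensor square and unramified extensions\<close>

text \<open>
  The ring \<open>T \<otimes>\<^sub>R T\<close> is the quotient of the monoid ring \<open>\<int>[T \<times> T]\<close> of the multiplicative monoid
  \<open>T \<times> T\<close> by the usual bilinearity relations. The additive subgroup generated by the relations is
  already an ideal, so that the underlying group is the usual tensor product.
\<close>

definition pair_ring :: "('a, 'm) ring_scheme \<Rightarrow> ('a \<times> 'a \<Rightarrow>\<^sub>0 int) ring"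
  where "pair_ring T =
    \<lparr> carrier = {f. Poly_Mapping.keys f \<subseteq> carrier T \<times> carrier T},
      monoid.mult = (\<lambda>f g. frag_extend (\<lambda>(a, b).
                frag_extend (\<lambda>(c, d). frag_of (a \<otimes>\<^bsub>T\<^esub> c, b \<otimes>\<^bsub>T\<^esub> d)) g) f),
      monoid.one = frag_of (\<one>\<^bsub>T\<^esub>, \<one>\<^bsub>T\<^esub>),
      ring.zero = 0,
      ring.add = (+) \<rparr>"

definition tensor_relations :: "('a, 'm) ring_scheme \<Rightarrow> 'a set \<Rightarrow> ('a \<times> 'a \<Rightarrow>\<^sub>0 int) set"
  where "tensor_relations T R =
    {frag_of (a \<oplus>\<^bsub>T\<^esub> a', b) - frag_of (a, b) - frag_of (a', b) | a a' b.
       a \<in> carrier T \<and> a' \<in> carrier T \<and> b \<in> carrier T} \<union>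
    {frag_of (a, b \<oplus>\<^bsub>T\<^esub> b') - frag_of (a, b) - frag_of (a, b') | a b b'.
       a \<in> carrier T \<and> b \<in> carrier T \<and> b' \<in> carrier T} \<union>
    {frag_of (r \<otimes>\<^bsub>T\<^esub> a, b) - frag_of (a, r \<otimes>\<^bsub>T\<^esub> b) | r a b.
       r \<in> R \<and> a \<in> carrier T \<and> b \<in> carrier T}"

definition tensor_square ::
    "('a, 'm) ring_scheme \<Rightarrow> 'a set \<Rightarrow> ('a \<times> 'a \<Rightarrow>\<^sub>0 int) set ring"
  where "tensor_square T R = pair_ring T Quot (Idl\<^bsub>pair_ring T\<^esub> (tensor_relations T R))"

text \<open>The multiplication map \<open>T \<otimes>\<^sub>R T \<rightarrow> T\<close>, and its lift to \<open>\<int>[T \<times> T]\<close>.\<close>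

definition pair_mult :: "('a, 'm) ring_scheme \<Rightarrow> ('a \<times> 'a \<Rightarrow>\<^sub>0 int) \<Rightarrow> 'a"
  where "pair_mult T f =
    finsum T (\<lambda>(a, b). add_pow T (Poly_Mapping.lookup f (a, b)) (a \<otimes>\<^bsub>T\<^esub> b))
      (Poly_Mapping.keys f)"

definition tensor_mult :: "('a, 'm) ring_scheme \<Rightarrow> ('a \<times> 'a \<Rightarrow>\<^sub>0 int) set \<Rightarrow> 'a"
  where "tensor_mult T Z = the_elem (pair_mult T ` Z)"

definition diagonal_ideal ::
    "('a, 'm) ring_scheme \<Rightarrow> 'a set \<Rightarrow> ('a \<times> 'a \<Rightarrow>\<^sub>0 int) set set"
  where "diagonal_ideal T R = a_kernel (tensor_square T R) T (tensor_mult T)"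

text \<open>The module of differentials \<open>I/I\<^sup>2\<close>; only its additive group matters here.\<close>

definition kaehler_differentials ::
    "('a, 'm) ring_scheme \<Rightarrow> 'a set \<Rightarrow> ('a \<times> 'a \<Rightarrow>\<^sub>0 int) set set monoid"
  where "kaehler_differentials T R =
    add_monoid ((tensor_square T R)\<lparr>carrier := diagonal_ideal T R\<rparr>)
      Mod (diagonal_ideal T R \<cdot>\<^bsub>tensor_square T R\<^esub> diagonal_ideal T R)"

definition finite_type :: "('a, 'm) ring_scheme \<Rightarrow> 'a set \<Rightarrow> bool"
  where "finite_type T R \<longleftrightarrow>
    (\<exists>A. finite A \<and> A \<subseteq> carrier T \<and> generate_ring T (R \<union> A) = carrier T)"

definition unramified :: "('a, 'm) ring_scheme \<Rightarrow> 'a set \<Rightarrow> bool"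
  where "unramified T R \<longleftrightarrow> finite_type T R \<and> trivial_group (kaehler_differentials T R)"


section \<open>The u-closure\<close>

definition u_closed :: "('a, 'm) ring_scheme \<Rightarrow> 'a set \<Rightarrow> bool"
  where "u_closed S R \<longleftrightarrow>
    (\<forall>b \<in> carrier S. b [^]\<^bsub>S\<^esub> (2::nat) \<ominus>\<^bsub>S\<^esub> b \<in> R \<and> b [^]\<^bsub>S\<^esub> (3::nat) \<ominus>\<^bsub>S\<^esub> b [^]\<^bsub>S\<^esub> (2::nat) \<in> R
       \<longrightarrow> b \<in> R)"

definition u_closure :: "('a, 'm) ring_scheme \<Rightarrow> 'a set \<Rightarrow> 'a set"
  where "u_closure S R = (LEAST B. B \<in> subalgebras S R \<and> u_closed S B)"


section \<open>Residue fields and the separable closure\<close>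

definition frac_rel :: "('a, 'm) ring_scheme \<Rightarrow> (('a \<times> 'a) \<times> ('a \<times> 'a)) set"
  where "frac_rel D = {((a, b), (c, d)).
    a \<in> carrier D \<and> b \<in> carrier D - {\<zero>\<^bsub>D\<^esub>} \<and> c \<in> carrier D \<and> d \<in> carrier D - {\<zero>\<^bsub>D\<^esub>} \<and>
    a \<otimes>\<^bsub>D\<^esub> d = c \<otimes>\<^bsub>D\<^esub> b}"

definition fraction :: "('a, 'm) ring_scheme \<Rightarrow> 'a \<Rightarrow> 'a \<Rightarrow> ('a \<times> 'a) set"
  where "fraction D a b = frac_rel D `` {(a, b)}"

definition fraction_field :: "('a, 'm) ring_scheme \<Rightarrow> ('a \<times> 'a) set ring"
  where "fraction_field D =
    \<lparr> carrier = (carrier D \<times> (carrier D - {\<zero>\<^bsub>D\<^esub>})) // frac_rel D,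
      monoid.mult = (\<lambda>Z W. \<Union>(a, b) \<in> Z. \<Union>(c, d) \<in> W. fraction D (a \<otimes>\<^bsub>D\<^esub> c) (b \<otimes>\<^bsub>D\<^esub> d)),
      monoid.one = fraction D \<one>\<^bsub>D\<^esub> \<one>\<^bsub>D\<^esub>,
      ring.zero = fraction D \<zero>\<^bsub>D\<^esub> \<one>\<^bsub>D\<^esub>,
      ring.add = (\<lambda>Z W. \<Union>(a, b) \<in> Z. \<Union>(c, d) \<in> W.
               fraction D ((a \<otimes>\<^bsub>D\<^esub> d) \<oplus>\<^bsub>D\<^esub> (c \<otimes>\<^bsub>D\<^esub> b)) (b \<otimes>\<^bsub>D\<^esub> d)) \<rparr>"

definition residue_field :: "('a, 'm) ring_scheme \<Rightarrow> 'a set \<Rightarrow> ('a set \<times> 'a set) set ring"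
  where "residue_field A P = fraction_field (A Quot P)"

text \<open>
  The canonical map \<open>\<kappa>\<^sub>R(Q \<inter> R) \<rightarrow> \<kappa>\<^sub>T(Q)\<close>, sending the fraction of the classes of \<open>a\<close> and \<open>b\<close> modulo
  \<open>Q \<inter> R\<close> to the fraction of their classes modulo \<open>Q\<close>.
\<close>

definition residual_map ::
    "('a, 'm) ring_scheme \<Rightarrow> 'a set \<Rightarrow> ('a set \<times> 'a set) set \<Rightarrow> ('a set \<times> 'a set) set"
  where "residual_map T Q Z =
    (\<Union>(A, B) \<in> Z. fraction (T Quot Q) (\<Union>a \<in> A. Q +>\<^bsub>T\<^esub> a) (\<Union>b \<in> B. Q +>\<^bsub>T\<^esub> b))"

text \<open>
  In a list of length \<open>n + 1\<close>, the entry with index \<open>i\<close> is the coefficient of the monomial of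
  exponent \<open>n - i\<close>.
\<close>

definition poly_deriv :: "('a, 'm) ring_scheme \<Rightarrow> 'a list \<Rightarrow> 'a list"
  where "poly_deriv L p =
    ring.normalize L (map (\<lambda>i. add_pow L (degree p - i) (p ! i)) [0..<degree p])"

definition separable_poly :: "('a, 'm) ring_scheme \<Rightarrow> 'a set \<Rightarrow> 'a list \<Rightarrow> bool"
  where "separable_poly L K p \<longleftrightarrow> \<one>\<^bsub>K[X]\<^bsub>L\<^esub>\<^esub> gcdof\<^bsub>K[X]\<^bsub>L\<^esub>\<^esub> p (poly_deriv L p)"

definition separable_extension :: "('a, 'm) ring_scheme \<Rightarrow> 'a set \<Rightarrow> bool"
  where "separable_extension L K \<longleftrightarrow>
    (\<forall>x \<in> carrier L. \<not> ring.transcendental L K x \<and> separable_poly L K (ring.Irr L K x))"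

definition kappa_separable :: "('a, 'm) ring_scheme \<Rightarrow> 'a set \<Rightarrow> bool"
  where "kappa_separable T R \<longleftrightarrow> integral_extension T R \<and>
    (\<forall>Q. primeideal Q T \<longrightarrow>
       separable_extension (residue_field T Q)
         (residual_map T Q ` carrier (residue_field (T\<lparr>carrier := R\<rparr>) (Q \<inter> R))))"

definition kappa_separable_closure :: "('a, 'm) ring_scheme \<Rightarrow> 'a set \<Rightarrow> 'a set"
  where "kappa_separable_closure S R =
    (GREATEST V. V \<in> subalgebras S R \<and> kappa_separable (S\<lparr>carrier := V\<rparr>) R)"

end

theory Submission
  imports Defs
begin

text \<open>
  Vanishing of the Kaehler differentials is used in the form of formal unramifiedness: \<open>\<Omega>\<^sub>R(T) = 0\<close> iff any
  two \<open>R\<close>-algebra homomorphisms from \<open>T\<close> whose difference has values in an ideal of square zero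
  coincide. Such pairs agree on a subring, so composites of unramified subalgebras are unramified and FCP
  provides a greatest one, \<open>W\<close>. If \<open>b\<^sup>2 - b\<close> and \<open>b\<^sup>3 - b\<^sup>2\<close> lie in \<open>W\<close> and the two images of \<open>b\<close> are \<open>x\<close>
  and \<open>x + e\<close>, then \<open>(2x - 1)e = 0\<close> and \<open>(x\<^sup>2 - x)e = 0\<close>, whence \<open>e = 0\<close> and \<open>b \<in> W\<close>.

  For the comparison with the \<open>\<kappa>\<close>-separable closure, a finite field extension \<open>L/K\<close> is shown to be separable
  as soon as \<open>\<Omega>\<^sub>K(L) = 0\<close>. If some element is inseparable, a dimension count gives \<open>K L\<^sup>p \<noteq> L\<close>, hence a
  subfield \<open>E \<supseteq> K L\<^sup>p\<close> with \<open>L = E[y]\<close>, \<open>y \<notin> E\<close>. In \<open>L \<otimes>\<^sub>E L\<close> the element \<open>\<eta> = 1 \<otimes> y - y \<otimes> 1\<close> generates the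
  diagonal ideal, \<open>\<eta>\<^sup>p = 0\<close> and \<open>\<eta> \<in> (\<eta>\<^sup>2)\<close>, so \<open>\<eta> = 0\<close>, contradicting \<open>y \<notin> E\<close>. Conversely, two such
  homomorphisms agree on separable elements, which yields stability of \<open>\<kappa>\<close>-separability under composites.
\<close>

section \<open>The monoid ring on pairs\<close>

text \<open>Pairs of homomorphisms are preferred to the module \<open>I/I\<^sup>2\<close> because
  they restrict to subalgebras and pull back along ring maps, whereas the differentials of two
  intermediate rings, or of a ring and a residue field, live in unrelated tensor squares. Vanishing
  differentials force equality for test rings of every type. Conversely the single test ring
  \<open>(T \<otimes> T)/I\<^sup>2\<close> with its two coordinate maps suffices, so the converse
  can be stated for a test ring of one fixed type, although a hypothesis cannot quantify over types.

  FCP enters only through maximal elements: every intermediate ring is of finite type, and a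
  nonempty family of intermediate rings stable under composites has a greatest member. Together with
  integrality, finite type makes the residual extensions finite, which the dimension count needs.
  Stability of kappa-separability under composites is required because the closure is given by
  \<open>GREATEST\<close>, which says nothing unless a greatest element exists.\<close>

definition frag_lift :: "('b, 'm) ring_scheme \<Rightarrow> ('k \<Rightarrow> 'b) \<Rightarrow> ('k \<Rightarrow>\<^sub>0 int) \<Rightarrow> 'b"
  where "frag_lift C B f =
    finsum C (\<lambda>k. add_pow C (Poly_Mapping.lookup f k) (B k)) (Poly_Mapping.keys f)"

text \<open>Summing over a set larger than the support lets two elements be compared over the union
  of their supports; the extra terms are zero multiples.\<close>

lemma (in abelian_group) frag_lift_eq:
  assumes "finite Y" "Poly_Mapping.keys f \<subseteq> Y" "B ` Y \<subseteq> carrier G"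
  shows "frag_lift G B f = (\<Oplus>k\<in>Y. [Poly_Mapping.lookup f k] \<cdot> B k)"
  unfolding frag_lift_def
  using assms
  by (intro add.finprod_mono_neutral_cong_left)
     (auto simp: in_keys_iff, simp add: add_pow_def)

lemma (in abelian_group) frag_lift_closed:
  assumes "B ` Poly_Mapping.keys f \<subseteq> carrier G"
  shows "frag_lift G B f \<in> carrier G"
  unfolding frag_lift_def using assms by (auto intro!: finsum_closed)

lemma (in abelian_group) frag_lift_add:
  assumes "B ` Poly_Mapping.keys f \<subseteq> carrier G" "B ` Poly_Mapping.keys g \<subseteq> carrier G"
  shows "frag_lift G B (f + g) = frag_lift G B f \<oplus> frag_lift G B g"
proof -
  let ?Y = "Poly_Mapping.keys f \<union> Poly_Mapping.keys g"
  have Y: "finite ?Y" "B ` ?Y \<subseteq> carrier G" "Poly_Mapping.keys (f + g) \<subseteq> ?Y"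
    using assms keys_add[of f g] by auto
  have "frag_lift G B (f + g) = (\<Oplus>k\<in>?Y. [Poly_Mapping.lookup (f + g) k] \<cdot> B k)"
    using Y by (intro frag_lift_eq)
  also have "\<dots> = (\<Oplus>k\<in>?Y. [Poly_Mapping.lookup f k] \<cdot> B k \<oplus> [Poly_Mapping.lookup g k] \<cdot> B k)"
    using Y(2) by (intro finsum_cong') (auto simp: lookup_add add.int_pow_mult image_subset_iff)
  also have "\<dots> = (\<Oplus>k\<in>?Y. [Poly_Mapping.lookup f k] \<cdot> B k) \<oplus> (\<Oplus>k\<in>?Y. [Poly_Mapping.lookup g k] \<cdot> B k)"
    using Y(2) by (intro finsum_addf) (auto simp: image_subset_iff)
  also have "\<dots> = frag_lift G B f \<oplus> frag_lift G B g"
    using Y by (simp add: frag_lift_eq[of ?Y f] frag_lift_eq[of ?Y g])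
  finally show ?thesis .
qed

lemma (in abelian_group) frag_lift_zero [simp]: "frag_lift G B 0 = \<zero>"
  by (simp add: frag_lift_def)

lemma (in abelian_group) frag_lift_of:
  assumes "B k \<in> carrier G"
  shows "frag_lift G B (frag_of k) = B k"
  using assms by (simp add: frag_lift_def add.finprod_singleton_swap add.int_pow_1)

lemma (in abelian_group) frag_lift_minus:
  assumes "B ` Poly_Mapping.keys f \<subseteq> carrier G"
  shows "frag_lift G B (- f) = \<ominus> frag_lift G B f"
proof -
  have "frag_lift G B (- f) \<oplus> frag_lift G B f = \<zero>"
    using frag_lift_add[of B "- f" f] assms by simp
  then show ?thesis
    using assms by (intro minus_equality[symmetric]) (auto intro!: frag_lift_closed)
qed

lemma (in abelian_group) frag_lift_diff:
  assumes "B ` Poly_Mapping.keys f \<subseteq> carrier G" "B ` Poly_Mapping.keys g \<subseteq> carrier G"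
  shows "frag_lift G B (f - g) = frag_lift G B f \<ominus> frag_lift G B g"
  using frag_lift_add[of B f "- g"] frag_lift_minus[of B g] assms by (simp add: a_minus_def)

section \<open>The commutative ring structure on the free abelian group over pairs\<close>

lemma pair_ring_simps:
  "carrier (pair_ring T) = {f. Poly_Mapping.keys f \<subseteq> carrier T \<times> carrier T}"
  "\<zero>\<^bsub>pair_ring T\<^esub> = 0"
  "\<one>\<^bsub>pair_ring T\<^esub> = frag_of (\<one>\<^bsub>T\<^esub>, \<one>\<^bsub>T\<^esub>)"
  "f \<oplus>\<^bsub>pair_ring T\<^esub> g = f + g"
  by (simp_all add: pair_ring_def)

lemma pair_ring_mult:
  "f \<otimes>\<^bsub>pair_ring T\<^esub> g = frag_extend (\<lambda>(a, b).
    frag_extend (\<lambda>(c, d). frag_of (a \<otimes>\<^bsub>T\<^esub> c, b \<otimes>\<^bsub>T\<^esub> d)) g) f"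
  by (simp add: pair_ring_def)

lemma pair_ring_mult_of [simp]:
  "frag_of (a, b) \<otimes>\<^bsub>pair_ring T\<^esub> frag_of (c, d) = frag_of (a \<otimes>\<^bsub>T\<^esub> c, b \<otimes>\<^bsub>T\<^esub> d)"
  by (simp add: pair_ring_mult)

lemma frag_extend_fun_diff: "frag_extend (\<lambda>x. f x - g x) c = frag_extend f c - frag_extend g c"
  using subset_UNIV by (induction c rule: frag_induction) (simp_all add: frag_extend_diff)

lemma pair_ring_mult_simps:
  "(f - f') \<otimes>\<^bsub>pair_ring T\<^esub> g = f \<otimes>\<^bsub>pair_ring T\<^esub> g - f' \<otimes>\<^bsub>pair_ring T\<^esub> g"
  "g \<otimes>\<^bsub>pair_ring T\<^esub> (f - f') = g \<otimes>\<^bsub>pair_ring T\<^esub> f - g \<otimes>\<^bsub>pair_ring T\<^esub> f'"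
  "0 \<otimes>\<^bsub>pair_ring T\<^esub> g = 0" "g \<otimes>\<^bsub>pair_ring T\<^esub> 0 = 0"
proof -
  show "g \<otimes>\<^bsub>pair_ring T\<^esub> (f - f') = g \<otimes>\<^bsub>pair_ring T\<^esub> f - g \<otimes>\<^bsub>pair_ring T\<^esub> f'"
    by (simp add: pair_ring_mult frag_extend_diff case_prod_unfold frag_extend_fun_diff)
qed (simp_all add: pair_ring_mult frag_extend_diff frag_extend_eq_0 case_prod_unfold)

lemma pair_ring_mult_plus:
  "(f + f') \<otimes>\<^bsub>pair_ring T\<^esub> g = f \<otimes>\<^bsub>pair_ring T\<^esub> g + f' \<otimes>\<^bsub>pair_ring T\<^esub> g"
  by (simp add: pair_ring_mult frag_extend_add)

context cring begin

text \<open>Closure under subtraction already covers negatives and sums, since f + g = f - (0 - g).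
  Bilinearity of the product is therefore recorded in terms of \<open>-\<close>, and ring laws are
  checked on generators.\<close>

lemma pair_ring_induct [consumes 1, case_names zero one diff]:
  assumes "f \<in> carrier (pair_ring R)"
    and "P 0" and "\<And>a b. a \<in> carrier R \<Longrightarrow> b \<in> carrier R \<Longrightarrow> P (frag_of (a, b))"
    and "\<And>f g. f \<in> carrier (pair_ring R) \<Longrightarrow> g \<in> carrier (pair_ring R) \<Longrightarrow> P f \<Longrightarrow> P g \<Longrightarrow> P (f - g)"
  shows "P f"
  using assms(1) unfolding pair_ring_simps mem_Collect_eq
  by (rule free_Abelian_group_induct) (use assms(2-) in \<open>auto simp: pair_ring_simps\<close>)

lemma pair_ring_diff_closed:
  "f \<in> carrier (pair_ring R) \<Longrightarrow> g \<in> carrier (pair_ring R) \<Longrightarrow> f - g \<in> carrier (pair_ring R)"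
  unfolding pair_ring_simps using keys_diff[of f g] by auto

lemma pair_ring_mult_closed:
  assumes "f \<in> carrier (pair_ring R)" "g \<in> carrier (pair_ring R)"
  shows "f \<otimes>\<^bsub>pair_ring R\<^esub> g \<in> carrier (pair_ring R)"
  using assms(1)
proof (induction rule: pair_ring_induct)
  case (one a b)
  show ?case using assms(2)
    by (induction rule: pair_ring_induct)
       (use one in \<open>auto simp: pair_ring_mult_simps pair_ring_diff_closed, auto simp: pair_ring_simps\<close>)
qed (auto simp: pair_ring_mult_simps pair_ring_diff_closed, auto simp: pair_ring_simps)

lemma pair_ring_mult_comm:
  assumes "f \<in> carrier (pair_ring R)" "g \<in> carrier (pair_ring R)"
  shows "f \<otimes>\<^bsub>pair_ring R\<^esub> g = g \<otimes>\<^bsub>pair_ring R\<^esub> f"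
  using assms(1)
proof (induction rule: pair_ring_induct)
  case (one a b)
  show ?case using assms(2)
    by (induction rule: pair_ring_induct)
       (use one in \<open>auto simp: pair_ring_mult_simps m_comm\<close>)
qed (auto simp: pair_ring_mult_simps)

lemma pair_ring_mult_assoc:
  assumes "f \<in> carrier (pair_ring R)" "g \<in> carrier (pair_ring R)" "h \<in> carrier (pair_ring R)"
  shows "f \<otimes>\<^bsub>pair_ring R\<^esub> g \<otimes>\<^bsub>pair_ring R\<^esub> h = f \<otimes>\<^bsub>pair_ring R\<^esub> (g \<otimes>\<^bsub>pair_ring R\<^esub> h)"
  using assms(1)
proof (induction rule: pair_ring_induct)
  case (one a b)
  note f = this
  show ?case using assms(2)
  proof (induction rule: pair_ring_induct)
    case (one c d)
    show ?case using assms(3)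
      by (induction rule: pair_ring_induct)
         (use f one in \<open>auto simp: pair_ring_mult_simps m_assoc\<close>)
  qed (auto simp: pair_ring_mult_simps)
qed (auto simp: pair_ring_mult_simps)

lemma pair_ring_one_mult:
  assumes "f \<in> carrier (pair_ring R)"
  shows "frag_of (\<one>, \<one>) \<otimes>\<^bsub>pair_ring R\<^esub> f = f"
  using assms by (induction rule: pair_ring_induct) (auto simp: pair_ring_mult_simps)

lemma pair_ring_cring: "cring (pair_ring R)"
proof (rule cringI)
  show "abelian_group (pair_ring R)"
  proof (rule abelian_groupI)
    fix f assume f: "f \<in> carrier (pair_ring R)"
    show "\<exists>g\<in>carrier (pair_ring R). g \<oplus>\<^bsub>pair_ring R\<^esub> f = \<zero>\<^bsub>pair_ring R\<^esub>"
      by (rule bexI[of _ "- f"]) (use f in \<open>auto simp: pair_ring_simps\<close>)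
    fix g assume "g \<in> carrier (pair_ring R)"
    then show "f \<oplus>\<^bsub>pair_ring R\<^esub> g \<in> carrier (pair_ring R)"
      using f keys_add[of f g] by (auto simp: pair_ring_simps)
  qed (auto simp: pair_ring_simps ac_simps)
  show "comm_monoid (pair_ring R)"
  proof (rule comm_monoidI)
    show "\<one>\<^bsub>pair_ring R\<^esub> \<in> carrier (pair_ring R)"
      by (simp add: pair_ring_simps)
  qed (auto simp: pair_ring_mult_closed pair_ring_mult_assoc pair_ring_simps(3) pair_ring_one_mult
      intro: pair_ring_mult_comm)
  fix x y z
  show "(x \<oplus>\<^bsub>pair_ring R\<^esub> y) \<otimes>\<^bsub>pair_ring R\<^esub> z = x \<otimes>\<^bsub>pair_ring R\<^esub> z \<oplus>\<^bsub>pair_ring R\<^esub> y \<otimes>\<^bsub>pair_ring R\<^esub> z"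
    by (simp add: pair_ring_simps pair_ring_mult_plus)
qed

lemma pair_ring_minus:
  assumes "f \<in> carrier (pair_ring R)"
  shows "\<ominus>\<^bsub>pair_ring R\<^esub> f = - f"
proof -
  interpret P: cring "pair_ring R" by (rule pair_ring_cring)
  show ?thesis
    by (rule P.minus_equality) (use assms in \<open>auto simp: pair_ring_simps\<close>)
qed

end


section \<open>The tensor square\<close>

text \<open>The pure tensor \<open>a \<otimes> b\<close>; these classes generate the tensor square
  additively (\<open>TS_induct\<close>).\<close>

definition tensor :: "('a, 'm) ring_scheme \<Rightarrow> 'a set \<Rightarrow> 'a \<Rightarrow> 'a \<Rightarrow> ('a \<times> 'a \<Rightarrow>\<^sub>0 int) set"
  where "tensor T R a b = (Idl\<^bsub>pair_ring T\<^esub> (tensor_relations T R)) +>\<^bsub>pair_ring T\<^esub> frag_of (a, b)"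

text \<open>\<open>the_elem\<close> is meaningful only when the lift is constant on each coset,
  which the lemma \<open>tensor_lift\<close> shows for balanced biadditive maps. The shape copies
  \<open>tensor_mult\<close>, so that the multiplication map becomes an instance.\<close>

definition tensor_lift ::
    "('c, 'n) ring_scheme \<Rightarrow> ('a \<Rightarrow> 'a \<Rightarrow> 'c) \<Rightarrow> ('a \<times> 'a \<Rightarrow>\<^sub>0 int) set \<Rightarrow> 'c"
  where "tensor_lift C B Z = the_elem (frag_lift C (case_prod B) ` Z)"

lemma tensor_mult_eq_lift: "tensor_mult T = tensor_lift T (monoid.mult T)"
proof -
  have "pair_mult T f = frag_lift T (case_prod (monoid.mult T)) f" for f
    by (simp add: pair_mult_def frag_lift_def case_prod_unfold)
  then have "pair_mult T = frag_lift T (case_prod (monoid.mult T))" ..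
  then show ?thesis
    by (simp add: tensor_mult_def tensor_lift_def fun_eq_iff)
qed

locale algebra_over = cring T for T :: "('a, 'm) ring_scheme" (structure) +
  fixes R :: "'a set"
  assumes base_subset: "R \<subseteq> carrier T"
begin

abbreviation "PR \<equiv> pair_ring T"
abbreviation "NI \<equiv> Idl\<^bsub>pair_ring T\<^esub> (tensor_relations T R)"
abbreviation "TS \<equiv> tensor_square T R"

sublocale PR: cring PR by (rule pair_ring_cring)

lemma tensor_relations_subset: "tensor_relations T R \<subseteq> carrier PR"
  using base_subset unfolding tensor_relations_def
  by (auto simp: pair_ring_simps dest!: subsetD[OF keys_diff])

sublocale NI: ideal NI PR
  by (rule PR.genideal_ideal[OF tensor_relations_subset])

lemma tensor_relations_in: "tensor_relations T R \<subseteq> NI"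
  by (rule PR.genideal_self[OF tensor_relations_subset])

lemma TS_cring: "cring TS"
  unfolding tensor_square_def by (rule NI.quotient_is_cring) (rule PR.is_cring)

sublocale TS: cring TS by (rule TS_cring)

lemma coset_hom: "ring_hom_cring PR TS ((+>\<^bsub>PR\<^esub>) NI)"
  unfolding tensor_square_def by (rule NI.rcos_ring_hom_cring) (rule PR.is_cring)

lemma frag_of_closed: "a \<in> carrier T \<Longrightarrow> b \<in> carrier T \<Longrightarrow> frag_of (a, b) \<in> carrier PR"
  by (simp add: pair_ring_simps)

lemma carrier_TS: "carrier TS = (\<lambda>f. NI +>\<^bsub>PR\<^esub> f) ` carrier PR"
  unfolding tensor_square_def FactRing_def A_RCOSETS_def' by auto

lemma coset_eq_iff:
  assumes "f \<in> carrier PR" "g \<in> carrier PR"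
  shows "NI +>\<^bsub>PR\<^esub> f = NI +>\<^bsub>PR\<^esub> g \<longleftrightarrow> f - g \<in> NI"
proof -
  have "f \<ominus>\<^bsub>PR\<^esub> g = f - g"
    using assms by (simp add: a_minus_def pair_ring_minus pair_ring_simps(4))
  then show ?thesis
    using PR.quotient_eq_iff_same_a_r_cos[OF NI.ideal_axioms assms] by simp
qed

lemma coset_diff:
  assumes "f \<in> carrier PR" "g \<in> carrier PR"
  shows "NI +>\<^bsub>PR\<^esub> (f - g) = (NI +>\<^bsub>PR\<^esub> f) \<ominus>\<^bsub>TS\<^esub> (NI +>\<^bsub>PR\<^esub> g)"
proof -
  interpret h: ring_hom_cring PR TS "(+>\<^bsub>PR\<^esub>) NI" by (rule coset_hom)
  have "f \<ominus>\<^bsub>PR\<^esub> g = f - g"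
    using assms by (simp add: a_minus_def pair_ring_minus pair_ring_simps(4))
  then show ?thesis
    using assms by (metis PR.minus_closed TS.minus_eq h.hom_a_inv h.hom_add PR.a_inv_closed PR.minus_eq)
qed

lemma tensor_closed [simp]: "a \<in> carrier T \<Longrightarrow> b \<in> carrier T \<Longrightarrow> tensor T R a b \<in> carrier TS"
  unfolding tensor_def carrier_TS by (auto intro: frag_of_closed)

lemma TS_induct [consumes 1, case_names zero tensor diff]:
  assumes "Z \<in> carrier TS"
    and "Q \<zero>\<^bsub>TS\<^esub>" and "\<And>a b. a \<in> carrier T \<Longrightarrow> b \<in> carrier T \<Longrightarrow> Q (tensor T R a b)"
    and "\<And>Z W. Z \<in> carrier TS \<Longrightarrow> W \<in> carrier TS \<Longrightarrow> Q Z \<Longrightarrow> Q W \<Longrightarrow> Q (Z \<ominus>\<^bsub>TS\<^esub> W)"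
  shows "Q Z"
proof -
  interpret h: ring_hom_cring PR TS "(+>\<^bsub>PR\<^esub>) NI" by (rule coset_hom)
  obtain f where f: "f \<in> carrier PR" "Z = NI +>\<^bsub>PR\<^esub> f"
    using assms(1) unfolding carrier_TS by auto
  have "Q (NI +>\<^bsub>PR\<^esub> f)"
    using f(1)
  proof (induction rule: pair_ring_induct)
    case zero
    then show ?case using assms(2) h.hom_zero by (simp add: pair_ring_simps)
  next
    case (one a b)
    then show ?case using assms(3) by (simp add: tensor_def)
  next
    case (diff f g)
    then show ?case using assms(4) by (simp add: coset_diff)
  qed
  with f show ?thesis by simp
qed

lemma tensor_add_left:
  assumes "a \<in> carrier T" "a' \<in> carrier T" "b \<in> carrier T"
  shows "tensor T R (a \<oplus> a') b = tensor T R a b \<oplus>\<^bsub>TS\<^esub> tensor T R a' b"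
proof -
  interpret h: ring_hom_cring PR TS "(+>\<^bsub>PR\<^esub>) NI" by (rule coset_hom)
  have "frag_of (a \<oplus> a', b) - frag_of (a, b) - frag_of (a', b) \<in> tensor_relations T R"
    unfolding tensor_relations_def using assms by blast
  then have "frag_of (a \<oplus> a', b) - (frag_of (a, b) + frag_of (a', b)) \<in> NI"
    using tensor_relations_in by (auto simp: algebra_simps)
  moreover have "frag_of (a, b) \<oplus>\<^bsub>PR\<^esub> frag_of (a', b) \<in> carrier PR"
    using assms frag_of_closed by blast
  ultimately show ?thesis
    using assms coset_eq_iff[of "frag_of (a \<oplus> a', b)" "frag_of (a, b) + frag_of (a', b)"]
      h.hom_add[of "frag_of (a, b)" "frag_of (a', b)"]
    by (simp add: tensor_def frag_of_closed pair_ring_simps(4))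
qed

lemma tensor_add_right:
  assumes "a \<in> carrier T" "b' \<in> carrier T" "b \<in> carrier T"
  shows "tensor T R a (b \<oplus> b') = tensor T R a b \<oplus>\<^bsub>TS\<^esub> tensor T R a b'"
proof -
  interpret h: ring_hom_cring PR TS "(+>\<^bsub>PR\<^esub>) NI" by (rule coset_hom)
  have "frag_of (a, b \<oplus> b') - frag_of (a, b) - frag_of (a, b') \<in> tensor_relations T R"
    unfolding tensor_relations_def using assms by blast
  then have "frag_of (a, b \<oplus> b') - (frag_of (a, b) + frag_of (a, b')) \<in> NI"
    using tensor_relations_in by (auto simp: algebra_simps)
  moreover have "frag_of (a, b) \<oplus>\<^bsub>PR\<^esub> frag_of (a, b') \<in> carrier PR"
    using assms frag_of_closed by blast
  ultimately show ?thesis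
    using assms coset_eq_iff[of "frag_of (a, b \<oplus> b')" "frag_of (a, b) + frag_of (a, b')"]
      h.hom_add[of "frag_of (a, b)" "frag_of (a, b')"]
    by (simp add: tensor_def frag_of_closed pair_ring_simps(4))
qed

lemma tensor_balanced:
  assumes "r \<in> R" "a \<in> carrier T" "b \<in> carrier T"
  shows "tensor T R (r \<otimes> a) b = tensor T R a (r \<otimes> b)"
proof -
  have "frag_of (r \<otimes> a, b) - frag_of (a, r \<otimes> b) \<in> tensor_relations T R"
    unfolding tensor_relations_def using assms by blast
  then show ?thesis
    using assms base_subset tensor_relations_in
    by (simp add: tensor_def coset_eq_iff frag_of_closed subset_iff)
qed

lemma tensor_mult_tensor [simp]:
  assumes "a \<in> carrier T" "b \<in> carrier T" "c \<in> carrier T" "d \<in> carrier T"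
  shows "tensor T R a b \<otimes>\<^bsub>TS\<^esub> tensor T R c d = tensor T R (a \<otimes> c) (b \<otimes> d)"
proof -
  interpret h: ring_hom_cring PR TS "(+>\<^bsub>PR\<^esub>) NI" by (rule coset_hom)
  show ?thesis
    using assms h.hom_mult[of "frag_of (a, b)" "frag_of (c, d)"]
    by (simp add: tensor_def frag_of_closed)
qed

lemma tensor_one: "tensor T R \<one> \<one> = \<one>\<^bsub>TS\<^esub>"
proof -
  interpret h: ring_hom_cring PR TS "(+>\<^bsub>PR\<^esub>) NI" by (rule coset_hom)
  show ?thesis
    using h.hom_one by (simp add: tensor_def pair_ring_simps)
qed

lemma tensor_left_hom: "(\<lambda>t. tensor T R t \<one>) \<in> ring_hom T TS"
  by (rule ring_hom_memI) (auto simp: tensor_add_left tensor_one)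

lemma tensor_right_hom: "(\<lambda>t. tensor T R \<one> t) \<in> ring_hom T TS"
  by (rule ring_hom_memI) (auto simp: tensor_add_right tensor_one)

lemma tensor_left_eq_right: "r \<in> R \<Longrightarrow> tensor T R r \<one> = tensor T R \<one> r"
  using tensor_balanced[of r \<one> \<one>] base_subset by auto

text \<open>
  An additive map on \<open>PR\<close> that is balanced kills the ideal \<open>NI\<close>, and not only the additive group
  generated by the relations, because the relations are stable under multiplication by pure tensors.
\<close>

lemma frag_lift_NI:
  assumes C: "abelian_group C"
    and B: "\<And>a b. a \<in> carrier T \<Longrightarrow> b \<in> carrier T \<Longrightarrow> B a b \<in> carrier C"
    and Bl: "\<And>a a' b. a \<in> carrier T \<Longrightarrow> a' \<in> carrier T \<Longrightarrow> b \<in> carrier T \<Longrightarrow>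
      B (a \<oplus> a') b = B a b \<oplus>\<^bsub>C\<^esub> B a' b"
    and Br: "\<And>a b b'. a \<in> carrier T \<Longrightarrow> b \<in> carrier T \<Longrightarrow> b' \<in> carrier T \<Longrightarrow>
      B a (b \<oplus> b') = B a b \<oplus>\<^bsub>C\<^esub> B a b'"
    and BR: "\<And>r a b. r \<in> R \<Longrightarrow> a \<in> carrier T \<Longrightarrow> b \<in> carrier T \<Longrightarrow> B (r \<otimes> a) b = B a (r \<otimes> b)"
    and f: "f \<in> NI"
  shows "frag_lift C (case_prod B) f = \<zero>\<^bsub>C\<^esub>"
proof -
  interpret C: abelian_group C by fact
  let ?L = "frag_lift C (case_prod B)"
  have img: "(case_prod B) ` Poly_Mapping.keys f \<subseteq> carrier C" if "f \<in> carrier PR" for f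
    using that B by (auto simp: pair_ring_simps image_subset_iff)
  have Ldiff: "?L (f - g) = ?L f \<ominus>\<^bsub>C\<^esub> ?L g" if "f \<in> carrier PR" "g \<in> carrier PR" for f g
    using that by (intro C.frag_lift_diff img)
  have Ladd: "?L (f \<oplus>\<^bsub>PR\<^esub> g) = ?L f \<oplus>\<^bsub>C\<^esub> ?L g" if "f \<in> carrier PR" "g \<in> carrier PR" for f g
    using that by (simp add: pair_ring_simps(4) C.frag_lift_add img)
  have Lof: "?L (frag_of (a, b)) = B a b" if "a \<in> carrier T" "b \<in> carrier T" for a b
    using that B by (simp add: C.frag_lift_of)
  have Lcl: "?L f \<in> carrier C" if "f \<in> carrier PR" for f
    using that by (intro C.frag_lift_closed img)
  have rel: "?L (f \<otimes>\<^bsub>PR\<^esub> g) = \<zero>\<^bsub>C\<^esub>" if f: "f \<in> tensor_relations T R" and g: "g \<in> carrier PR" for f g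
    using g
  proof (induction rule: pair_ring_induct)
    case zero
    then show ?case by (simp add: pair_ring_mult_simps)
  next
    case (one c d)
    from f consider
      (1) a a' b where "f = frag_of (a \<oplus> a', b) - frag_of (a, b) - frag_of (a', b)"
        "a \<in> carrier T" "a' \<in> carrier T" "b \<in> carrier T"
      | (2) a b b' where "f = frag_of (a, b \<oplus> b') - frag_of (a, b) - frag_of (a, b')"
        "a \<in> carrier T" "b \<in> carrier T" "b' \<in> carrier T"
      | (3) r a b where "f = frag_of (r \<otimes> a, b) - frag_of (a, r \<otimes> b)"
        "r \<in> R" "a \<in> carrier T" "b \<in> carrier T"
      unfolding tensor_relations_def by blast
    then show ?case
    proof cases
      case 1
      with one show ?thesis
        by (simp add: pair_ring_mult_simps Ldiff Lof frag_of_closed pair_ring_diff_closed l_distr Bl B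
            C.minus_eq C.a_assoc C.r_neg2 C.r_neg)
           (metis C.a_inv_closed C.a_ac B C.r_neg C.r_neg1 C.r_neg2 m_closed)
    next
      case 2
      with one show ?thesis
        by (simp add: pair_ring_mult_simps Ldiff Lof frag_of_closed pair_ring_diff_closed l_distr Br B
            C.minus_eq C.a_assoc C.r_neg2 C.r_neg)
           (metis C.a_inv_closed C.a_ac B C.r_neg C.r_neg1 C.r_neg2 m_closed)
    next
      case 3
      with one base_subset show ?thesis
        by (simp add: pair_ring_mult_simps Ldiff Lof frag_of_closed BR B m_assoc subset_iff C.minus_eq C.r_neg)
    qed
  next
    case (diff g h)
    moreover have "f \<in> carrier PR" using f tensor_relations_subset by auto
    ultimately show ?case by (simp add: pair_ring_mult_simps Ldiff pair_ring_mult_closed C.minus_eq)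
  qed
  \<comment> \<open>\<open>Kill\<close> is the largest ideal contained in the kernel of
    \<open>?L\<close>. The lift is merely additive, so minimality of \<open>NI\<close> among ideals
    cannot be applied to the kernel directly; multiplying by one afterwards leads from
    \<open>Kill\<close> back to the kernel.\<close>
  define Kill where "Kill = {f \<in> carrier PR. \<forall>g\<in>carrier PR. ?L (f \<otimes>\<^bsub>PR\<^esub> g) = \<zero>\<^bsub>C\<^esub>}"
  have "ideal Kill PR"
  proof (rule idealI)
    show "ring PR" by (rule PR.ring_axioms)
    show "subgroup Kill (add_monoid PR)"
    proof (rule PR.add.subgroupI)
      show "Kill \<noteq> {}"
        unfolding Kill_def by (auto intro!: exI[of _ "\<zero>\<^bsub>PR\<^esub>"], simp add: pair_ring_simps)
    next
      fix a assume a: "a \<in> Kill"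
      have "?L (\<ominus>\<^bsub>PR\<^esub> a \<otimes>\<^bsub>PR\<^esub> g) = \<zero>\<^bsub>C\<^esub>" if g: "g \<in> carrier PR" for g
      proof -
        have "\<ominus>\<^bsub>PR\<^esub> a \<otimes>\<^bsub>PR\<^esub> g = a \<otimes>\<^bsub>PR\<^esub> \<ominus>\<^bsub>PR\<^esub> g"
          using a g by (simp add: Kill_def PR.l_minus PR.r_minus)
        then show ?thesis using a g by (simp add: Kill_def)
      qed
      with a show "\<ominus>\<^bsub>PR\<^esub> a \<in> Kill" by (simp add: Kill_def)
    qed (auto simp: Kill_def PR.l_distr Ladd)
  next
    fix a x assume *: "a \<in> Kill" "x \<in> carrier PR"
    then show "x \<otimes>\<^bsub>PR\<^esub> a \<in> Kill" "a \<otimes>\<^bsub>PR\<^esub> x \<in> Kill"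
      by (auto simp: Kill_def PR.m_assoc PR.m_comm[of x a])
  qed
  moreover have "tensor_relations T R \<subseteq> Kill"
    using rel tensor_relations_subset by (auto simp: Kill_def)
  ultimately have "NI \<subseteq> Kill"
    by (rule PR.genideal_minimal)
  with f have "f \<in> Kill" by auto
  then have "?L (f \<otimes>\<^bsub>PR\<^esub> \<one>\<^bsub>PR\<^esub>) = \<zero>\<^bsub>C\<^esub>"
    unfolding Kill_def using PR.one_closed by blast
  then show ?thesis using \<open>f \<in> Kill\<close> by (simp add: Kill_def)
qed

lemma tensor_lift:
  assumes C: "abelian_group C"
    and B: "\<And>a b. a \<in> carrier T \<Longrightarrow> b \<in> carrier T \<Longrightarrow> B a b \<in> carrier C"
    and Bl: "\<And>a a' b. a \<in> carrier T \<Longrightarrow> a' \<in> carrier T \<Longrightarrow> b \<in> carrier T \<Longrightarrow>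
      B (a \<oplus> a') b = B a b \<oplus>\<^bsub>C\<^esub> B a' b"
    and Br: "\<And>a b b'. a \<in> carrier T \<Longrightarrow> b \<in> carrier T \<Longrightarrow> b' \<in> carrier T \<Longrightarrow>
      B a (b \<oplus> b') = B a b \<oplus>\<^bsub>C\<^esub> B a b'"
    and BR: "\<And>r a b. r \<in> R \<Longrightarrow> a \<in> carrier T \<Longrightarrow> b \<in> carrier T \<Longrightarrow> B (r \<otimes> a) b = B a (r \<otimes> b)"
  shows "Z \<in> carrier TS \<Longrightarrow> tensor_lift C B Z \<in> carrier C"
    and "Z \<in> carrier TS \<Longrightarrow> W \<in> carrier TS \<Longrightarrow>
      tensor_lift C B (Z \<oplus>\<^bsub>TS\<^esub> W) = tensor_lift C B Z \<oplus>\<^bsub>C\<^esub> tensor_lift C B W"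
    and "a \<in> carrier T \<Longrightarrow> b \<in> carrier T \<Longrightarrow> tensor_lift C B (tensor T R a b) = B a b"
proof -
  interpret C: abelian_group C by fact
  interpret h: ring_hom_cring PR TS "(+>\<^bsub>PR\<^esub>) NI" by (rule coset_hom)
  let ?L = "frag_lift C (case_prod B)"
  have img: "(case_prod B) ` Poly_Mapping.keys f \<subseteq> carrier C" if "f \<in> carrier PR" for f
    using that B by (auto simp: pair_ring_simps image_subset_iff)
  have Lcl: "?L f \<in> carrier C" if "f \<in> carrier PR" for f
    using that by (intro C.frag_lift_closed img)
  have Ladd: "?L (f \<oplus>\<^bsub>PR\<^esub> g) = ?L f \<oplus>\<^bsub>C\<^esub> ?L g" if "f \<in> carrier PR" "g \<in> carrier PR" for f g
    using that by (simp add: pair_ring_simps(4) C.frag_lift_add img)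
  \<comment> \<open>Two representatives differ by an element of \<open>NI\<close>, so the image of
    the coset under \<open>?L\<close> is a singleton.\<close>
  have *: "tensor_lift C B (NI +>\<^bsub>PR\<^esub> f) = ?L f" if f: "f \<in> carrier PR" for f
  proof -
    have "?L g = ?L f" if "g \<in> NI +>\<^bsub>PR\<^esub> f" for g
    proof -
      from that obtain n where n: "n \<in> NI" "g = n \<oplus>\<^bsub>PR\<^esub> f"
        unfolding a_r_coset_def' by auto
      then have "?L n = \<zero>\<^bsub>C\<^esub>"
        by (intro frag_lift_NI[OF C, of B]) (use B Bl Br BR in auto)
      then show ?thesis
        using n f NI.Icarr Lcl by (simp add: Ladd)
    qed
    moreover have "f \<in> NI +>\<^bsub>PR\<^esub> f" using f NI.a_rcos_self by simp
    ultimately have "?L ` (NI +>\<^bsub>PR\<^esub> f) = {?L f}" by blast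
    then show ?thesis by (simp add: tensor_lift_def)
  qed
  show "tensor_lift C B Z \<in> carrier C" if "Z \<in> carrier TS"
    using that Lcl unfolding carrier_TS by (auto simp: *)
  show "tensor_lift C B (Z \<oplus>\<^bsub>TS\<^esub> W) = tensor_lift C B Z \<oplus>\<^bsub>C\<^esub> tensor_lift C B W"
    if ZW: "Z \<in> carrier TS" "W \<in> carrier TS"
  proof -
    obtain f g where fg: "f \<in> carrier PR" "g \<in> carrier PR" "Z = NI +>\<^bsub>PR\<^esub> f" "W = NI +>\<^bsub>PR\<^esub> g"
      using ZW unfolding carrier_TS by auto
    then have "Z \<oplus>\<^bsub>TS\<^esub> W = NI +>\<^bsub>PR\<^esub> (f \<oplus>\<^bsub>PR\<^esub> g)" by simp
    with fg show ?thesis by (simp add: * Ladd del: h.hom_add)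
  qed
  show "tensor_lift C B (tensor T R a b) = B a b" if "a \<in> carrier T" "b \<in> carrier T"
    using that B by (simp add: tensor_def * frag_of_closed C.frag_lift_of)
qed

end


section \<open>Infinitely near homomorphisms and differentials\<close>

text \<open>
  The last condition says that the ideal generated by the differences has square zero, so that the
  two maps agree modulo an ideal of square zero.
\<close>

definition infinitely_near ::
    "('c, 'n) ring_scheme \<Rightarrow> ('a, 'm) ring_scheme \<Rightarrow> 'a set \<Rightarrow> ('a \<Rightarrow> 'c) \<Rightarrow> ('a \<Rightarrow> 'c) \<Rightarrow> bool"
  where "infinitely_near C T R \<alpha> \<beta> \<longleftrightarrow>
    cring C \<and> \<alpha> \<in> ring_hom T C \<and> \<beta> \<in> ring_hom T C \<and> (\<forall>r\<in>R. \<alpha> r = \<beta> r) \<and>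
    (\<forall>s\<in>carrier T. \<forall>t\<in>carrier T. (\<beta> s \<ominus>\<^bsub>C\<^esub> \<alpha> s) \<otimes>\<^bsub>C\<^esub> (\<beta> t \<ominus>\<^bsub>C\<^esub> \<alpha> t) = \<zero>\<^bsub>C\<^esub>)"

lemma infinitely_nearD:
  assumes "infinitely_near C T R \<alpha> \<beta>"
  shows "cring C" "\<alpha> \<in> ring_hom T C" "\<beta> \<in> ring_hom T C" "\<And>r. r \<in> R \<Longrightarrow> \<alpha> r = \<beta> r"
    "\<And>s t. s \<in> carrier T \<Longrightarrow> t \<in> carrier T \<Longrightarrow>
      (\<beta> s \<ominus>\<^bsub>C\<^esub> \<alpha> s) \<otimes>\<^bsub>C\<^esub> (\<beta> t \<ominus>\<^bsub>C\<^esub> \<alpha> t) = \<zero>\<^bsub>C\<^esub>"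
  using assms unfolding infinitely_near_def by auto

section \<open>The diagonal ideal, its generators and the universal infinitely near pair\<close>

context algebra_over begin

abbreviation "DI \<equiv> diagonal_ideal T R"


text \<open>Existence half of the coproduct property of the tensor square: agreement on R makes the
  product \<open>\<alpha> a \<otimes> \<beta> b\<close> balanced, and commutativity of C makes the
  lift multiplicative.\<close>

lemma tensor_lift_ring_hom:
  fixes C (structure)
  assumes C: "cring C" and \<alpha>: "\<alpha> \<in> ring_hom T C" and \<beta>: "\<beta> \<in> ring_hom T C"
    and R: "\<And>r. r \<in> R \<Longrightarrow> \<alpha> r = \<beta> r"
  defines "\<Phi> \<equiv> tensor_lift C (\<lambda>a b. \<alpha> a \<otimes>\<^bsub>C\<^esub> \<beta> b)"
  shows "ring_hom_cring TS C \<Phi>"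
    and "a \<in> carrier T \<Longrightarrow> b \<in> carrier T \<Longrightarrow> \<Phi> (tensor T R a b) = \<alpha> a \<otimes>\<^bsub>C\<^esub> \<beta> b"
proof -
  interpret C: cring C by fact
  interpret \<alpha>: ring_hom_cring T C \<alpha>
    by (intro ring_hom_cringI ring_hom_ringI2 C.ring_axioms ring_axioms C is_cring \<alpha>)
  interpret \<beta>: ring_hom_cring T C \<beta>
    by (intro ring_hom_cringI ring_hom_ringI2 C.ring_axioms ring_axioms C is_cring \<beta>)
  note lift = tensor_lift[of C "\<lambda>a b. \<alpha> a \<otimes>\<^bsub>C\<^esub> \<beta> b", OF C.abelian_group_axioms, folded \<Phi>_def]
  have bal: "\<alpha> (r \<otimes>\<^bsub>T\<^esub> a) \<otimes>\<^bsub>C\<^esub> \<beta> b = \<alpha> a \<otimes>\<^bsub>C\<^esub> \<beta> (r \<otimes>\<^bsub>T\<^esub> b)"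
    if "r \<in> R" "a \<in> carrier T" "b \<in> carrier T" for r a b
    using that R[of r] base_subset by (auto simp: subset_iff C.m_ac)
  have cl: "\<Phi> Z \<in> carrier C" if "Z \<in> carrier TS" for Z
    by (rule lift(1)) (use that bal in \<open>auto simp: C.l_distr C.r_distr\<close>)
  have add: "\<Phi> (Z \<oplus>\<^bsub>TS\<^esub> W) = \<Phi> Z \<oplus>\<^bsub>C\<^esub> \<Phi> W" if "Z \<in> carrier TS" "W \<in> carrier TS" for Z W
    by (rule lift(2)) (use that bal in \<open>auto simp: C.l_distr C.r_distr\<close>)
  show of: "\<Phi> (tensor T R a b) = \<alpha> a \<otimes>\<^bsub>C\<^esub> \<beta> b" if "a \<in> carrier T" "b \<in> carrier T" for a b
    by (rule lift(3)) (use that bal in \<open>auto simp: C.l_distr C.r_distr\<close>)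
  have "\<Phi> \<in> hom (add_monoid TS) (add_monoid C)"
    using cl add by (auto simp: hom_def)
  then interpret g: abelian_group_hom TS C \<Phi>
    by (intro abelian_group_homI TS.abelian_group_axioms C.abelian_group_axioms group_hom.intro
        group_hom_axioms.intro TS.a_group C.a_group)
  \<comment> \<open>Multiplicativity needs both factors expanded; here the left factor is a pure
    tensor and the induction runs over the right one.\<close>
  have mult1: "\<Phi> (tensor T R a b \<otimes>\<^bsub>TS\<^esub> W) = \<alpha> a \<otimes>\<^bsub>C\<^esub> \<beta> b \<otimes>\<^bsub>C\<^esub> \<Phi> W"
    if ab: "a \<in> carrier T" "b \<in> carrier T" and W: "W \<in> carrier TS" for a b W
    using W
  proof (induction rule: TS_induct)
    case (tensor c d)
    with ab show ?case by (simp add: of C.m_ac)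
  next
    case (diff Z W)
    with ab cl show ?case
      by (simp add: TS.r_minus TS.r_distr TS.minus_eq C.r_distr C.r_minus C.minus_eq)
  qed (use ab in simp)
  have mult: "\<Phi> (Z \<otimes>\<^bsub>TS\<^esub> W) = \<Phi> Z \<otimes>\<^bsub>C\<^esub> \<Phi> W" if "Z \<in> carrier TS" and W: "W \<in> carrier TS" for Z W
    using that(1)
  proof (induction rule: TS_induct)
    case (diff Z Y)
    with W cl show ?case
      by (simp add: TS.l_minus TS.l_distr TS.minus_eq C.l_distr C.l_minus C.minus_eq)
  qed (use W cl mult1 of in auto)
  have "\<Phi> \<in> ring_hom TS C"
    by (rule ring_hom_memI) (use cl add mult of[of "\<one>\<^bsub>T\<^esub>" "\<one>\<^bsub>T\<^esub>"] in \<open>auto simp: tensor_one\<close>)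
  then show "ring_hom_cring TS C \<Phi>"
    by (intro ring_hom_cringI ring_hom_ringI2 TS.ring_axioms C.ring_axioms TS_cring C)
qed

lemma tensor_mult_hom: "ring_hom_cring TS T (tensor_mult T)"
  and tensor_mult_of: "a \<in> carrier T \<Longrightarrow> b \<in> carrier T \<Longrightarrow> tensor_mult T (tensor T R a b) = a \<otimes> b"
  using tensor_lift_ring_hom[OF is_cring, of "\<lambda>x. x" "\<lambda>x. x"]
  by (auto simp: tensor_mult_eq_lift ring_hom_def)

sublocale mu: ring_hom_cring TS T "tensor_mult T"
  by (rule tensor_mult_hom)

lemma DI_ideal: "ideal DI TS"
  unfolding diagonal_ideal_def by (rule mu.ring.kernel_is_ideal)

lemma DI_iff: "Z \<in> DI \<longleftrightarrow> Z \<in> carrier TS \<and> tensor_mult T Z = \<zero>"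
  unfolding diagonal_ideal_def a_kernel_def' by simp

lemma DI_prod_ideal: "ideal (DI \<cdot>\<^bsub>TS\<^esub> DI) TS"
  by (intro TS.ideal_prod_is_ideal DI_ideal)

text \<open>The class of \<open>delta t\<close> in \<open>I/I\<^sup>2\<close> is the differential
  dt.\<close>

definition delta :: "'a \<Rightarrow> ('a \<times> 'a \<Rightarrow>\<^sub>0 int) set"
  where "delta t = tensor T R \<one> t \<ominus>\<^bsub>TS\<^esub> tensor T R t \<one>"

lemma delta_closed [simp]: "t \<in> carrier T \<Longrightarrow> delta t \<in> carrier TS"
  by (simp add: delta_def)

lemma delta_in_DI: "t \<in> carrier T \<Longrightarrow> delta t \<in> DI"
  by (simp add: delta_def DI_iff TS.minus_eq tensor_mult_of r_neg)

text \<open>Since \<open>I\<^sup>2\<close> always lies in I, the quotient is trivial as soon as the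
  reverse inclusion holds. As \<open>trivial_group\<close> includes being a group, normality of the
  subgroup divided out has to be checked as well.\<close>

lemma trivial_kaehler_iff:
  "trivial_group (kaehler_differentials T R) \<longleftrightarrow> DI \<subseteq> DI \<cdot>\<^bsub>TS\<^esub> DI"
proof -
  let ?H = "DI \<cdot>\<^bsub>TS\<^esub> DI" and ?G = "add_monoid (TS\<lparr>carrier := DI\<rparr>)"
  interpret DI: ideal DI TS by (rule DI_ideal)
  interpret H: ideal ?H TS by (rule DI_prod_ideal)
  have HD: "?H \<subseteq> DI" using TS.ideal_prod_inter[OF DI_ideal DI_ideal] by blast
  have "(add_monoid TS)\<lparr>carrier := DI\<rparr> = ?G" by simp
  with TS.add.subgroup_imp_group[OF DI.a_subgroup] have grp: "group ?G" by simp
  then have G: "comm_group ?G"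
    by (rule group.group_comm_groupI) (simp add: DI.Icarr TS.a_comm)
  have carr: "carrier (?G Mod ?H) = (\<lambda>x. ?H +>\<^bsub>TS\<^esub> x) ` DI"
    by (simp add: FactGroup_def RCOSETS_def r_coset_def a_r_coset_def UNION_singleton_eq_range)
  have one: "\<one>\<^bsub>?G Mod ?H\<^esub> = ?H" by (simp add: FactGroup_def)
  show ?thesis
  proof
    assume "trivial_group (kaehler_differentials T R)"
    then have "(\<lambda>x. ?H +>\<^bsub>TS\<^esub> x) ` DI = {?H}"
      unfolding kaehler_differentials_def trivial_group_def carr one by simp
    then have "?H +>\<^bsub>TS\<^esub> x = ?H" if "x \<in> DI" for x
      using that by blast
    moreover have "x \<in> ?H +>\<^bsub>TS\<^esub> x" if "x \<in> DI" for x
      using that by (intro H.a_rcos_self DI.Icarr)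
    ultimately show "DI \<subseteq> ?H"
      by blast
  next
    assume "DI \<subseteq> ?H"
    with HD have eq: "?H = DI" by blast
    have "?H \<lhd> ?G"
      unfolding eq using comm_group.subgroup_imp_normal[OF G group.subgroup_self[OF grp]] by simp
    then have "group (?G Mod ?H)" by (rule normal.factorgroup_is_group)
    moreover have "?H +>\<^bsub>TS\<^esub> x = ?H" if "x \<in> DI" for x
      using that DI.a_rcos_const unfolding eq by blast
    then have "(\<lambda>x. ?H +>\<^bsub>TS\<^esub> x) ` DI = {?H}"
      using DI.zero_closed by blast
    ultimately show "trivial_group (kaehler_differentials T R)"
      unfolding kaehler_differentials_def trivial_group_def carr one by simp
  qed
qed

text \<open>On a pure tensor the difference is \<open>tensor T R a \<one>\<close> times
  \<open>delta b\<close>. Both terms of the difference are additive in Z, which extends this to the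
  whole tensor square.\<close>

lemma tensor_minus_in_ideal:
  assumes "ideal I TS" and I: "\<And>t. t \<in> carrier T \<Longrightarrow> delta t \<in> I"
    and Z: "Z \<in> carrier TS"
  shows "Z \<ominus>\<^bsub>TS\<^esub> tensor T R (tensor_mult T Z) \<one> \<in> I"
proof -
  interpret I: ideal I TS by fact
  show ?thesis using Z
  proof (induction rule: TS_induct)
    case (tensor a b)
    have "tensor T R a \<one> \<otimes>\<^bsub>TS\<^esub> delta b \<in> I"
      using tensor by (intro I.I_l_closed I) auto
    then show ?case
      using tensor by (simp add: delta_def tensor_mult_of TS.minus_eq TS.r_distr TS.r_minus)
  next
    case (diff Z W)
    interpret l: ring_hom_cring T TS "\<lambda>t. tensor T R t \<one>"
      by (intro ring_hom_cringI ring_hom_ringI2 TS.ring_axioms ring_axioms TS_cring is_cring tensor_left_hom)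
    let ?z = "tensor T R (tensor_mult T Z) \<one>" and ?w = "tensor T R (tensor_mult T W) \<one>"
    have cl: "?z \<in> carrier TS" "?w \<in> carrier TS" using diff by auto
    have "tensor T R (tensor_mult T (Z \<ominus>\<^bsub>TS\<^esub> W)) \<one> = ?z \<ominus>\<^bsub>TS\<^esub> ?w"
      using diff by (simp add: TS.minus_eq minus_eq)
    moreover have "Z \<ominus>\<^bsub>TS\<^esub> W \<ominus>\<^bsub>TS\<^esub> (?z \<ominus>\<^bsub>TS\<^esub> ?w) = (Z \<ominus>\<^bsub>TS\<^esub> ?z) \<ominus>\<^bsub>TS\<^esub> (W \<ominus>\<^bsub>TS\<^esub> ?w)"
      using diff cl by algebra
    moreover have "(Z \<ominus>\<^bsub>TS\<^esub> ?z) \<ominus>\<^bsub>TS\<^esub> (W \<ominus>\<^bsub>TS\<^esub> ?w) \<in> I"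
      unfolding TS.minus_eq[of "Z \<ominus>\<^bsub>TS\<^esub> ?z"] using diff by (intro I.a_closed I.a_inv_closed)
    ultimately show ?case by simp
  qed (auto simp: TS.minus_eq ring_hom_zero[OF tensor_left_hom ring_axioms TS.ring_axioms])
qed

text \<open>On the diagonal ideal the correction term \<open>tensor_mult T Z\<close> vanishes, so
  the elements \<open>delta t\<close> generate the kernel of multiplication.\<close>

lemma DI_subset_ideal:
  assumes "ideal I TS" and "\<And>t. t \<in> carrier T \<Longrightarrow> delta t \<in> I"
  shows "DI \<subseteq> I"
proof
  fix Z assume "Z \<in> DI"
  then show "Z \<in> I"
    using tensor_minus_in_ideal[OF assms, of Z] ring_hom_zero[OF tensor_left_hom ring_axioms TS.ring_axioms]
    by (auto simp: DI_iff TS.minus_eq)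
qed

text \<open>The pair \<alpha>, \<beta> induces one map \<open>\<Phi>\<close> on the tensor square,
  under which \<open>delta s\<close> goes to the difference of the two images of s. Since products
  of such differences vanish, \<open>\<Phi>\<close> kills \<open>I\<^sup>2\<close>, and triviality
  puts \<open>delta t\<close> there.\<close>

lemma trivial_kaehler_imp_eq:
  assumes triv: "trivial_group (kaehler_differentials T R)"
    and near: "infinitely_near C T R \<alpha> \<beta>" and t: "t \<in> carrier T"
  shows "\<alpha> t = \<beta> t"
proof -
  note C = infinitely_nearD(1)[OF near] and \<alpha> = infinitely_nearD(2)[OF near]
    and \<beta> = infinitely_nearD(3)[OF near] and R = infinitely_nearD(4)[OF near]
    and sq = infinitely_nearD(5)[OF near]
  interpret C: cring C by fact
  define \<Phi> where "\<Phi> = tensor_lift C (\<lambda>a b. \<alpha> a \<otimes>\<^bsub>C\<^esub> \<beta> b)"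
  note lift = tensor_lift_ring_hom[OF C \<alpha> \<beta> R, folded \<Phi>_def]
  interpret \<Phi>: ring_hom_cring TS C \<Phi> by (rule lift(1)) auto
  note [simp] = ring_hom_closed[OF \<alpha>] ring_hom_closed[OF \<beta>] ring_hom_one[OF \<alpha>] ring_hom_one[OF \<beta>]
  have \<Phi>\<delta>: "\<Phi> (delta s) = \<beta> s \<ominus>\<^bsub>C\<^esub> \<alpha> s" if "s \<in> carrier T" for s
    using that by (simp add: delta_def TS.minus_eq C.minus_eq lift(2) R)
  \<comment> \<open>Elements whose image annihilates a fixed set form an ideal, so membership need
    only be tested on the generators \<open>delta t\<close>.\<close>
  have ann: "ideal {Z \<in> carrier TS. \<forall>c\<in>S. \<Phi> Z \<otimes>\<^bsub>C\<^esub> c = \<zero>\<^bsub>C\<^esub>} TS" (is "ideal ?A TS")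
    if S: "S \<subseteq> carrier C" for S
  proof (rule idealI)
    show "ring TS" by (rule TS.ring_axioms)
    show "subgroup ?A (add_monoid TS)"
      by (rule TS.add.subgroupI)
         (use S in \<open>auto intro!: exI[of _ "\<zero>\<^bsub>TS\<^esub>"] simp: C.l_distr C.l_minus subset_iff\<close>)
    fix a x assume "a \<in> ?A" "x \<in> carrier TS"
    then show "x \<otimes>\<^bsub>TS\<^esub> a \<in> ?A" "a \<otimes>\<^bsub>TS\<^esub> x \<in> ?A"
      using S by (auto simp: C.m_assoc C.m_comm[of "\<Phi> a" "\<Phi> x"] subset_iff)
  qed
  \<comment> \<open>The product of two images is handled one factor at a time: here the second
    factor is a single difference, later the image of an arbitrary element of
    \<open>DI\<close>.\<close>
  have "DI \<subseteq> {Z \<in> carrier TS. \<forall>c\<in>(\<lambda>s. \<beta> s \<ominus>\<^bsub>C\<^esub> \<alpha> s) ` carrier T. \<Phi> Z \<otimes>\<^bsub>C\<^esub> c = \<zero>\<^bsub>C\<^esub>}"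
    by (intro DI_subset_ideal ann) (auto simp: \<Phi>\<delta> sq)
  then have 1: "\<Phi> Z \<otimes>\<^bsub>C\<^esub> (\<beta> s \<ominus>\<^bsub>C\<^esub> \<alpha> s) = \<zero>\<^bsub>C\<^esub>" if "Z \<in> DI" "s \<in> carrier T" for Z s
    using that by blast
  have DIc: "DI \<subseteq> carrier TS" by (auto simp: DI_iff)
  have "DI \<subseteq> {Z \<in> carrier TS. \<forall>c\<in>\<Phi> ` DI. \<Phi> Z \<otimes>\<^bsub>C\<^esub> c = \<zero>\<^bsub>C\<^esub>}"
  proof (intro DI_subset_ideal ann)
    show "\<Phi> ` DI \<subseteq> carrier C" using DIc by auto
    fix s assume s: "s \<in> carrier T"
    have "(\<beta> s \<ominus>\<^bsub>C\<^esub> \<alpha> s) \<otimes>\<^bsub>C\<^esub> \<Phi> Z = \<zero>\<^bsub>C\<^esub>" if "Z \<in> DI" for Z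
    proof -
      have "Z \<in> carrier TS" using that DIc by auto
      then show ?thesis using 1[OF that s] s C.m_comm[of "\<Phi> Z"] by simp
    qed
    then show "delta s \<in>
        {Z \<in> carrier TS. \<forall>c\<in>\<Phi> ` DI. \<Phi> Z \<otimes>\<^bsub>C\<^esub> c = \<zero>\<^bsub>C\<^esub>}"
      using s by (auto simp: \<Phi>\<delta>)
  qed
  then have 2: "\<Phi> Z \<otimes>\<^bsub>C\<^esub> \<Phi> W = \<zero>\<^bsub>C\<^esub>" if "Z \<in> DI" "W \<in> DI" for Z W
    using that by blast
  have 3: "Z \<in> carrier TS \<and> \<Phi> Z = \<zero>\<^bsub>C\<^esub>" if "Z \<in> DI \<cdot>\<^bsub>TS\<^esub> DI" for Z
    using that by (induction rule: ideal_prod.induct) (use DIc 2 in \<open>auto simp: subset_iff\<close>)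
  have "\<beta> t \<ominus>\<^bsub>C\<^esub> \<alpha> t = \<zero>\<^bsub>C\<^esub>"
    using 3[of "delta t"] triv delta_in_DI[OF t] \<Phi>\<delta>[OF t]
    unfolding trivial_kaehler_iff by auto
  then show ?thesis using t by simp
qed

text \<open>Used twice: modulo \<open>I\<^sup>2\<close> it gives the universal infinitely near pair,
  and modulo the ideal generated by \<open>\<eta>\<^sup>2\<close> it gives the relation on which the
  field case rests.\<close>

lemma infinitely_near_quotient:
  assumes I: "ideal I TS"
    and sq: "\<And>s t. s \<in> carrier T \<Longrightarrow> t \<in> carrier T \<Longrightarrow> delta s \<otimes>\<^bsub>TS\<^esub> delta t \<in> I"
  shows "infinitely_near (TS Quot I) T R (\<lambda>t. I +>\<^bsub>TS\<^esub> tensor T R t \<one>) (\<lambda>t. I +>\<^bsub>TS\<^esub> tensor T R \<one> t)"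
    (is "infinitely_near ?C T R ?\<alpha> ?\<beta>")
proof -
  have zero: "\<zero>\<^bsub>?C\<^esub> = I" by (simp add: FactRing_def)
  interpret I: ideal I TS by fact
  interpret q: ring_hom_cring TS ?C "(+>\<^bsub>TS\<^esub>) I"
    by (rule I.rcos_ring_hom_cring) (rule TS_cring)
  have diff: "?\<beta> t \<ominus>\<^bsub>?C\<^esub> ?\<alpha> t = I +>\<^bsub>TS\<^esub> (delta t)" if "t \<in> carrier T" for t
    using that by (simp add: delta_def TS.minus_eq q.S.minus_eq)
  show ?thesis
    unfolding infinitely_near_def
  proof (intro conjI ballI)
    show "cring ?C" by (rule q.S.is_cring)
    show "?\<alpha> \<in> ring_hom T ?C"
      using ring_hom_trans[OF tensor_left_hom q.homh] by (simp add: comp_def)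
    show "?\<beta> \<in> ring_hom T ?C"
      using ring_hom_trans[OF tensor_right_hom q.homh] by (simp add: comp_def)
    show "?\<alpha> r = ?\<beta> r" if "r \<in> R" for r
      using that by (simp add: tensor_left_eq_right)
    fix s t assume st: "s \<in> carrier T" "t \<in> carrier T"
    have "I +>\<^bsub>TS\<^esub> (delta s \<otimes>\<^bsub>TS\<^esub> delta t) = \<zero>\<^bsub>?C\<^esub>"
      unfolding zero by (rule I.a_rcos_const) (rule sq[OF st])
    then show "(?\<beta> s \<ominus>\<^bsub>?C\<^esub> ?\<alpha> s) \<otimes>\<^bsub>?C\<^esub> (?\<beta> t \<ominus>\<^bsub>?C\<^esub> ?\<alpha> t) = \<zero>\<^bsub>?C\<^esub>"
      unfolding diff[OF st(1)] diff[OF st(2)] using st by simp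
  qed
qed

lemma delta_in_ideal_iff:
  assumes "ideal I TS" "t \<in> carrier T"
  shows "delta t \<in> I \<longleftrightarrow> I +>\<^bsub>TS\<^esub> tensor T R t \<one> = I +>\<^bsub>TS\<^esub> tensor T R \<one> t"
  using TS.quotient_eq_iff_same_a_r_cos[OF assms(1), of "tensor T R \<one> t" "tensor T R t \<one>"] assms(2)
  by (auto simp: delta_def)

text \<open>Only the universal pair is tested: if its two maps coincide, every
  \<open>delta t\<close> lies in \<open>I\<^sup>2\<close>, and these elements generate I.\<close>

lemma trivial_kaehlerI:
  assumes "\<And>(C :: ('a \<times> 'a \<Rightarrow>\<^sub>0 int) set set ring) \<alpha> \<beta> t.
    infinitely_near C T R \<alpha> \<beta> \<Longrightarrow> t \<in> carrier T \<Longrightarrow> \<alpha> t = \<beta> t"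
  shows "trivial_group (kaehler_differentials T R)"
proof -
  let ?H = "DI \<cdot>\<^bsub>TS\<^esub> DI"
  have "infinitely_near (TS Quot ?H) T R
      (\<lambda>t. ?H +>\<^bsub>TS\<^esub> tensor T R t \<one>) (\<lambda>t. ?H +>\<^bsub>TS\<^esub> tensor T R \<one> t)"
    by (intro infinitely_near_quotient DI_prod_ideal ideal_prod.prod delta_in_DI)
  then have "delta t \<in> ?H" if "t \<in> carrier T" for t
    using assms that delta_in_ideal_iff[OF DI_prod_ideal that] by blast
  then show ?thesis
    unfolding trivial_kaehler_iff by (intro DI_subset_ideal DI_prod_ideal)
qed

end

lemma infinitely_near_mono:
  "infinitely_near C T R \<alpha> \<beta> \<Longrightarrow> R' \<subseteq> R \<Longrightarrow> infinitely_near C T R' \<alpha> \<beta>"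
  unfolding infinitely_near_def by blast

text \<open>Pullback is used along inclusions of intermediate rings, along the reduction from a ring
  to a residue field, and along residual maps.\<close>

lemma infinitely_near_comp:
  assumes "infinitely_near C T R \<alpha> \<beta>" "h \<in> ring_hom T' T" "h ` R' \<subseteq> R"
  shows "infinitely_near C T' R' (\<alpha> \<circ> h) (\<beta> \<circ> h)"
  using assms ring_hom_closed[OF assms(2)] ring_hom_trans[OF assms(2)]
  unfolding infinitely_near_def by (auto simp: image_subset_iff)

lemma equalizer_is_subring:
  assumes "ring A" "ring B" "\<alpha> \<in> ring_hom A B" "\<beta> \<in> ring_hom A B"
  shows "subring {t \<in> carrier A. \<alpha> t = \<beta> t} A"
proof -
  interpret A: ring A by fact
  interpret \<alpha>: ring_hom_ring A B \<alpha> by (rule ring_hom_ringI2) (use assms in auto)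
  interpret \<beta>: ring_hom_ring A B \<beta> by (rule ring_hom_ringI2) (use assms in auto)
  show ?thesis
    by (rule A.subringI) auto
qed


section \<open>Unramified subextensions of an FCP extension\<close>

text \<open>The annihilators 2x - 1 and x^2 - x of e = y - x generate the unit ideal, because (2x -
  1)^2 - 4(x^2 - x) = 1. The proof unwinds this identity additively: for f = xe and g = xf it
  obtains \<open>e = f \<oplus> f\<close>, \<open>f = g \<oplus> g\<close> and
  \<open>g = f\<close>.\<close>

lemma (in cring) anodal_infinitesimal_zero:
  assumes x: "x \<in> carrier R" and y: "y \<in> carrier R"
    and sq: "(y \<ominus> x) \<otimes> (y \<ominus> x) = \<zero>"
    and 1: "y \<otimes> y \<ominus> y = x \<otimes> x \<ominus> x"
    and 2: "y \<otimes> y \<otimes> y \<ominus> y \<otimes> y = x \<otimes> x \<otimes> x \<ominus> x \<otimes> x"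
  shows "x = y"
proof -
  define e where "e = y \<ominus> x"
  define f where "f = x \<otimes> e"
  define g where "g = x \<otimes> f"
  have e: "e \<in> carrier R" and f: "f \<in> carrier R" and g: "g \<in> carrier R"
    using x y by (simp_all add: e_def f_def g_def)
  have y_eq: "y = x \<oplus> e" unfolding e_def using x y by algebra
  have ee: "e \<otimes> e = \<zero>" using sq by (simp add: e_def)
  have "f \<oplus> f \<ominus> e = (y \<otimes> y \<ominus> y) \<ominus> (x \<otimes> x \<ominus> x) \<ominus> e \<otimes> e"
    unfolding y_eq f_def using x e by algebra
  also have "\<dots> = \<zero>"
    unfolding 1 ee using x by algebra
  finally have e_eq: "e = f \<oplus> f" using e f by simp
  then have f_eq: "f = g \<oplus> g"
    using x f by (metis f_def g_def r_distr)
  \<comment> \<open>The cubic expression is x times the quadratic one, and the latter has the same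
    value w at x and at y; comparing the two cubics gives
    \<open>y \<otimes> w = x \<otimes> w\<close>.\<close>
  define w where "w = x \<otimes> x \<ominus> x"
  have w: "w \<in> carrier R" using x by (simp add: w_def)
  have "y \<otimes> w = y \<otimes> y \<otimes> y \<ominus> y \<otimes> y"
    unfolding w_def 1[symmetric] using y by algebra
  also have "\<dots> = x \<otimes> w"
    unfolding w_def 2 using x by algebra
  finally have "y \<otimes> w = x \<otimes> w" .
  moreover have "e \<otimes> w = y \<otimes> w \<ominus> x \<otimes> w"
    unfolding e_def using x y w by algebra
  ultimately have "e \<otimes> w = \<zero>" using x w by simp
  moreover have "e \<otimes> w = g \<ominus> f"
    unfolding w_def g_def f_def using x e by algebra
  ultimately have "g = f" using f g by simp
  with f_eq f have "f = \<zero>" by (metis add.l_cancel_one')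
  then have "e = \<zero>" using e_eq by simp
  then show ?thesis using x y by (simp add: e_def)
qed

text \<open>A finite nonempty chain contains its own union, which is thus an upper bound inside F,
  and Zorn's lemma applies. Finiteness is assumed for chains of the larger family A so that FCP
  serves every subfamily of the intermediate rings.\<close>

lemma subset_chain_finite_maximal:
  assumes fin: "\<And>C. subset.chain A C \<Longrightarrow> finite C" and F: "F \<subseteq> A" "F \<noteq> {}"
  shows "\<exists>M\<in>F. \<forall>Y\<in>F. M \<subseteq> Y \<longrightarrow> Y = M"
proof (rule subset_Zorn_nonempty[OF F(2)])
  fix C assume C: "C \<noteq> {}" "subset.chain F C"
  then have "subset.chain A C" using F(1) unfolding subset_chain_def by blast
  then have "finite C" by (rule fin)
  then have "\<Union>C \<in> C" using C by (metis Union_in_chain)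
  then show "\<Union>C \<in> F" using C unfolding subset_chain_def by blast
qed

section \<open>Consequences of the finite chain condition\<close>

locale FCP_extension = cring S for S :: "('a, 'm) ring_scheme" (structure) +
  fixes R :: "'a set"
  assumes base: "subring R S" and fcp: "FCP S R"
begin

lemma subalgebraD:
  assumes "T \<in> subalgebras S R"
  shows "subring T S" "R \<subseteq> T" "T \<subseteq> carrier S"
  using assms subringE(1) unfolding subalgebras_def by auto

lemma subalgebra_cring: "T \<in> subalgebras S R \<Longrightarrow> cring (S\<lparr>carrier := T\<rparr>)"
  using subcringI'[OF subalgebraD(1)] subcring_iff[OF subalgebraD(3)] by simp

lemma generate_ring_subalgebra:
  assumes "R \<subseteq> Y" "Y \<subseteq> carrier S"
  shows "generate_ring S Y \<in> subalgebras S R"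
proof -
  have "R \<subseteq> generate_ring S Y" using assms(1) by (auto intro: generate_ring.incl)
  then show ?thesis
    using generate_ring_is_subring[OF assms(2)] by (simp add: subalgebras_def)
qed

lemma generate_ring_absorb: "subring T S \<Longrightarrow> Y \<subseteq> T \<Longrightarrow> generate_ring S Y \<subseteq> T"
  using generate_ring_min_subring1[of Y T] subringE(1)[of T S] by simp

lemma exists_maximal:
  assumes "F \<subseteq> subalgebras S R" "F \<noteq> {}"
  shows "\<exists>M\<in>F. \<forall>Y\<in>F. M \<subseteq> Y \<longrightarrow> Y = M"
  by (rule subset_chain_finite_maximal[OF _ assms]) (use fcp in \<open>auto simp: FCP_def\<close>)

text \<open>A maximal M absorbs every other member Y, because the composite of M and Y is again a
  member and contains M. Serves both the unramified and the kappa-separable subalgebras.\<close>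

lemma exists_greatest:
  assumes F: "F \<subseteq> subalgebras S R" "F \<noteq> {}"
    and closed: "\<And>A B. A \<in> F \<Longrightarrow> B \<in> F \<Longrightarrow> generate_ring S (A \<union> B) \<in> F"
  shows "\<exists>M\<in>F. \<forall>Y\<in>F. Y \<subseteq> M"
proof -
  obtain M where M: "M \<in> F" "\<And>Y. Y \<in> F \<Longrightarrow> M \<subseteq> Y \<Longrightarrow> Y = M"
    using exists_maximal[OF F] by blast
  have "Y \<subseteq> M" if Y: "Y \<in> F" for Y
  proof -
    have sub: "M \<subseteq> generate_ring S (M \<union> Y)" "Y \<subseteq> generate_ring S (M \<union> Y)"
      by (auto intro: generate_ring.incl)
    show ?thesis
      using M(2)[OF closed[OF M(1) Y] sub(1)] sub(2) by simp
  qed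
  with M(1) show ?thesis by blast
qed

text \<open>A maximal member among the finitely generated subalgebras of T is all of T, since
  otherwise one more generator could be adjoined. Being unramified thus reduces to the vanishing of
  the differentials.\<close>

lemma finite_type_subalgebra:
  assumes T: "T \<in> subalgebras S R"
  shows "finite_type (S\<lparr>carrier := T\<rparr>) R"
proof -
  note T' = subalgebraD[OF T]
  define F where "F = {generate_ring S (R \<union> A) | A. finite A \<and> A \<subseteq> T}"
  have "F \<subseteq> subalgebras S R"
    unfolding F_def using T' by (auto intro!: generate_ring_subalgebra)
  moreover have "F \<noteq> {}" unfolding F_def by blast
  ultimately have "\<exists>M\<in>F. \<forall>Y\<in>F. M \<subseteq> Y \<longrightarrow> Y = M" by (rule exists_maximal)
  then obtain M where M: "M \<in> F" "\<And>Y. Y \<in> F \<Longrightarrow> M \<subseteq> Y \<Longrightarrow> Y = M"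
    by blast
  from M(1) obtain A where A: "M = generate_ring S (R \<union> A)" "finite A" "A \<subseteq> T" unfolding F_def by blast
  have "M \<subseteq> T" unfolding A(1) using A(3) T' by (intro generate_ring_absorb) auto
  moreover have "T \<subseteq> M"
  proof
    fix t assume t: "t \<in> T"
    let ?Y = "generate_ring S (R \<union> insert t A)"
    have "M \<subseteq> ?Y"
      unfolding A(1) using A(3) t T' by (intro mono_generate_ring) auto
    moreover have "?Y \<in> F" unfolding F_def using A t by blast
    ultimately have "?Y = M" by (intro M(2))
    moreover have "t \<in> ?Y" by (auto intro: generate_ring.incl)
    ultimately show "t \<in> M" by simp
  qed
  ultimately have "generate_ring S (R \<union> A) = T" using A(1) by simp
  then have "generate_ring (S\<lparr>carrier := T\<rparr>) (R \<union> A) = T"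
    using subring_gen_equality[OF T'(1), of "R \<union> A"] A(3) T' by simp
  then show ?thesis
    unfolding finite_type_def using A(2,3) by auto
qed

lemma subalgebra_algebra_over: "T \<in> subalgebras S R \<Longrightarrow> algebra_over (S\<lparr>carrier := T\<rparr>) R"
  using subalgebra_cring subalgebraD by (auto simp: algebra_over_def algebra_over_axioms_def)

lemma unramified_subalgebra_iff:
  "T \<in> subalgebras S R \<Longrightarrow>
    unramified (S\<lparr>carrier := T\<rparr>) R \<longleftrightarrow> trivial_group (kaehler_differentials (S\<lparr>carrier := T\<rparr>) R)"
  using finite_type_subalgebra by (simp add: unramified_def)

lemma equalizer_subring:
  assumes T: "T \<in> subalgebras S R" and "infinitely_near C (S\<lparr>carrier := T\<rparr>) R \<alpha> \<beta>"
  shows "subring {t \<in> T. \<alpha> t = \<beta> t} S"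
proof -
  let ?E = "{t \<in> T. \<alpha> t = \<beta> t}"
  interpret T: cring "S\<lparr>carrier := T\<rparr>" using T by (rule subalgebra_cring)
  have "subring ?E (S\<lparr>carrier := T\<rparr>)"
    using equalizer_is_subring[OF T.ring_axioms cring.axioms(1) infinitely_nearD(2,3)[OF assms(2)]]
      infinitely_nearD(1)[OF assms(2)] by simp
  then have "ring (S\<lparr>carrier := ?E\<rparr>)"
    using T.subring_is_ring by fastforce
  moreover have "?E \<subseteq> carrier S" using subalgebraD(3)[OF T] by auto
  ultimately show ?thesis using ring_incl_imp_subring by blast
qed

lemma equal_on_generators:
  assumes "T \<in> subalgebras S R" "infinitely_near C (S\<lparr>carrier := T\<rparr>) R \<alpha> \<beta>"
    and "Y \<subseteq> T" "T = generate_ring S Y" and "\<And>x. x \<in> Y \<Longrightarrow> \<alpha> x = \<beta> x" and "t \<in> T"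
  shows "\<alpha> t = \<beta> t"
proof -
  have "generate_ring S Y \<subseteq> {t \<in> T. \<alpha> t = \<beta> t}"
    using assms(3,5) by (intro generate_ring_absorb equalizer_subring[OF assms(1,2)]) auto
  with assms(4,6) show ?thesis by auto
qed

lemma infinitely_near_subalgebra:
  assumes "infinitely_near C (S\<lparr>carrier := T\<rparr>) R \<alpha> \<beta>" "T' \<subseteq> T"
  shows "infinitely_near C (S\<lparr>carrier := T'\<rparr>) R \<alpha> \<beta>"
proof -
  have "id \<in> ring_hom (S\<lparr>carrier := T'\<rparr>) (S\<lparr>carrier := T\<rparr>)"
    using assms(2) by (auto simp: ring_hom_def)
  from infinitely_near_comp[OF assms(1) this, of R] show ?thesis by simp
qed

lemma unramified_imp_eq:
  assumes "T \<in> subalgebras S R" "unramified (S\<lparr>carrier := T\<rparr>) R"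
    and "infinitely_near C (S\<lparr>carrier := T\<rparr>) R \<alpha> \<beta>" "t \<in> T"
  shows "\<alpha> t = \<beta> t"
proof (rule algebra_over.trivial_kaehler_imp_eq[OF subalgebra_algebra_over[OF assms(1)] _ assms(3)])
  show "trivial_group (kaehler_differentials (S\<lparr>carrier := T\<rparr>) R)"
    using assms(1,2) unramified_subalgebra_iff by blast
next
  show "t \<in> carrier (S\<lparr>carrier := T\<rparr>)" using assms(4) by simp
qed

lemma unramifiedI:
  assumes "T \<in> subalgebras S R"
    and "\<And>(C :: ('a \<times> 'a \<Rightarrow>\<^sub>0 int) set set ring) \<alpha> \<beta> t.
      infinitely_near C (S\<lparr>carrier := T\<rparr>) R \<alpha> \<beta> \<Longrightarrow> t \<in> T \<Longrightarrow> \<alpha> t = \<beta> t"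
  shows "unramified (S\<lparr>carrier := T\<rparr>) R"
proof -
  have "trivial_group (kaehler_differentials (S\<lparr>carrier := T\<rparr>) R)"
  proof (rule algebra_over.trivial_kaehlerI[OF subalgebra_algebra_over[OF assms(1)]])
    fix C :: "('a \<times> 'a \<Rightarrow>\<^sub>0 int) set set ring" and \<alpha> \<beta> t
    assume near: "infinitely_near C (S\<lparr>carrier := T\<rparr>) R \<alpha> \<beta>"
      and t: "t \<in> carrier (S\<lparr>carrier := T\<rparr>)"
    from t have "t \<in> T" by simp
    with near show "\<alpha> t = \<beta> t" by (rule assms(2)[of C \<alpha> \<beta> t])
  qed
  then show ?thesis
    using unramified_subalgebra_iff[OF assms(1)] by blast
qed

section \<open>Composites of unramified subalgebras and adjunction of anodal elements\<close>

lemma base_subalgebra: "R \<in> subalgebras S R"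
  using base by (simp add: subalgebras_def)

lemma unramified_base: "unramified (S\<lparr>carrier := R\<rparr>) R"
  by (rule unramifiedI[OF base_subalgebra]) (unfold infinitely_near_def, blast)

lemma unramified_generate:
  assumes A: "A \<in> subalgebras S R" "unramified (S\<lparr>carrier := A\<rparr>) R"
    and B: "B \<in> subalgebras S R" "unramified (S\<lparr>carrier := B\<rparr>) R"
  shows "generate_ring S (A \<union> B) \<in> subalgebras S R"
    and "unramified (S\<lparr>carrier := generate_ring S (A \<union> B)\<rparr>) R"
proof -
  let ?T = "generate_ring S (A \<union> B)"
  show T: "?T \<in> subalgebras S R"
    using subalgebraD[OF A(1)] subalgebraD[OF B(1)] by (intro generate_ring_subalgebra) auto
  have sub: "A \<subseteq> ?T" "B \<subseteq> ?T" by (auto intro: generate_ring.incl)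
  show "unramified (S\<lparr>carrier := ?T\<rparr>) R"
  proof (rule unramifiedI[OF T])
    fix C :: "('a \<times> 'a \<Rightarrow>\<^sub>0 int) set set ring" and \<alpha> \<beta> t
    assume near: "infinitely_near C (S\<lparr>carrier := ?T\<rparr>) R \<alpha> \<beta>" and t: "t \<in> ?T"
    have eq: "\<alpha> x = \<beta> x" if "x \<in> A \<union> B" for x
      using that unramified_imp_eq[OF A infinitely_near_subalgebra[OF near sub(1)]]
        unramified_imp_eq[OF B infinitely_near_subalgebra[OF near sub(2)]] by blast
    have "A \<union> B \<subseteq> ?T" using sub by blast
    from equal_on_generators[OF T near this refl eq t] show "\<alpha> t = \<beta> t" .
  qed
qed

lemma unramified_adjoin:
  assumes W: "W \<in> subalgebras S R" "unramified (S\<lparr>carrier := W\<rparr>) R"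
    and b: "b \<in> carrier S" "b \<otimes> b \<ominus> b \<in> W" "b \<otimes> b \<otimes> b \<ominus> b \<otimes> b \<in> W"
  shows "generate_ring S (insert b W) \<in> subalgebras S R"
    and "unramified (S\<lparr>carrier := generate_ring S (insert b W)\<rparr>) R"
proof -
  let ?T = "generate_ring S (insert b W)"
  show T: "?T \<in> subalgebras S R"
    using subalgebraD[OF W(1)] b(1) by (intro generate_ring_subalgebra) auto
  have sub: "W \<subseteq> ?T" "b \<in> ?T" by (auto intro: generate_ring.incl)
  show "unramified (S\<lparr>carrier := ?T\<rparr>) R"
  proof (rule unramifiedI[OF T])
    fix C :: "('a \<times> 'a \<Rightarrow>\<^sub>0 int) set set ring" and \<alpha> \<beta> t
    assume near: "infinitely_near C (S\<lparr>carrier := ?T\<rparr>) R \<alpha> \<beta>" and t: "t \<in> ?T"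
    have \<alpha>: "\<alpha> \<in> ring_hom (S\<lparr>carrier := ?T\<rparr>) C" and \<beta>: "\<beta> \<in> ring_hom (S\<lparr>carrier := ?T\<rparr>) C"
      and C: "cring C"
      using near by (auto simp: infinitely_near_def)
    interpret T: cring "S\<lparr>carrier := ?T\<rparr>" using T by (rule subalgebra_cring)
    interpret C: cring C by (rule C)
    interpret \<alpha>: ring_hom_ring "S\<lparr>carrier := ?T\<rparr>" C \<alpha>
      by (rule ring_hom_ringI2) (auto simp: T.ring_axioms C.ring_axioms \<alpha>)
    interpret \<beta>: ring_hom_ring "S\<lparr>carrier := ?T\<rparr>" C \<beta>
      by (rule ring_hom_ringI2) (auto simp: T.ring_axioms C.ring_axioms \<beta>)
    have \<alpha>\<beta>: "\<alpha> x = \<beta> x" if "x \<in> W" for x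
      using that unramified_imp_eq[OF W infinitely_near_subalgebra[OF near sub(1)]] by blast
    \<comment> \<open>The additive inverse in \<open>S\<lparr>carrier := ?T\<rparr>\<close> is
      chosen inside the smaller carrier, so its agreement with the inverse in S must be proved
      before the hypotheses on b can be transported.\<close>
    have minus: "x \<ominus>\<^bsub>S\<lparr>carrier := ?T\<rparr>\<^esub> y = x \<ominus> y" if "x \<in> ?T" "y \<in> ?T" for x y
    proof -
      have "\<ominus>\<^bsub>S\<lparr>carrier := ?T\<rparr>\<^esub> y = \<ominus> y"
      proof (rule T.minus_equality)
        show "\<ominus> y \<in> carrier (S\<lparr>carrier := ?T\<rparr>)"
          using subringE(5)[OF subalgebraD(1)[OF T] that(2)] by simp
        have "y \<in> carrier S" using that subalgebraD(3)[OF T] by auto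
        then show "\<ominus> y \<oplus>\<^bsub>S\<lparr>carrier := ?T\<rparr>\<^esub> y = \<zero>\<^bsub>S\<lparr>carrier := ?T\<rparr>\<^esub>" by (simp add: l_neg)
      qed (use that in simp)
      then show ?thesis by (simp add: a_minus_def)
    qed
    have bb: "b \<otimes> b \<in> ?T" "b \<otimes> b \<otimes> b \<in> ?T"
      using sub by (auto intro: generate_ring.eng_mult)
    note h = \<alpha>.hom_mult[simplified] \<beta>.hom_mult[simplified]
    have \<alpha>m: "\<alpha> (x \<ominus> y) = \<alpha> x \<ominus>\<^bsub>C\<^esub> \<alpha> y" and \<beta>m: "\<beta> (x \<ominus> y) = \<beta> x \<ominus>\<^bsub>C\<^esub> \<beta> y"
      if "x \<in> ?T" "y \<in> ?T" for x y
      using that \<alpha>.hom_add[of x "\<ominus>\<^bsub>S\<lparr>carrier := ?T\<rparr>\<^esub> y"] \<beta>.hom_add[of x "\<ominus>\<^bsub>S\<lparr>carrier := ?T\<rparr>\<^esub> y"]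
        \<alpha>.hom_a_inv[of y] \<beta>.hom_a_inv[of y] T.a_inv_closed[of y]
      by (simp_all add: minus[symmetric]) (simp_all add: a_minus_def)
    have "\<alpha> b = \<beta> b"
    proof (rule C.anodal_infinitesimal_zero)
      show "\<alpha> b \<in> carrier C" "\<beta> b \<in> carrier C" using sub(2) by auto
      show "(\<beta> b \<ominus>\<^bsub>C\<^esub> \<alpha> b) \<otimes>\<^bsub>C\<^esub> (\<beta> b \<ominus>\<^bsub>C\<^esub> \<alpha> b) = \<zero>\<^bsub>C\<^esub>"
        using near sub(2) by (simp add: infinitely_near_def)
      show "\<beta> b \<otimes>\<^bsub>C\<^esub> \<beta> b \<ominus>\<^bsub>C\<^esub> \<beta> b = \<alpha> b \<otimes>\<^bsub>C\<^esub> \<alpha> b \<ominus>\<^bsub>C\<^esub> \<alpha> b"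
        using \<alpha>\<beta>[OF b(2)] sub(2) bb by (simp add: \<alpha>m \<beta>m h)
      show "\<beta> b \<otimes>\<^bsub>C\<^esub> \<beta> b \<otimes>\<^bsub>C\<^esub> \<beta> b \<ominus>\<^bsub>C\<^esub> \<beta> b \<otimes>\<^bsub>C\<^esub> \<beta> b =
          \<alpha> b \<otimes>\<^bsub>C\<^esub> \<alpha> b \<otimes>\<^bsub>C\<^esub> \<alpha> b \<ominus>\<^bsub>C\<^esub> \<alpha> b \<otimes>\<^bsub>C\<^esub> \<alpha> b"
        using \<alpha>\<beta>[OF b(3)] sub(2) bb by (simp add: \<alpha>m \<beta>m h)
    qed
    then have eq: "\<alpha> x = \<beta> x" if "x \<in> insert b W" for x
      using that \<alpha>\<beta> by blast
    have "insert b W \<subseteq> ?T" using sub by blast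
    from equal_on_generators[OF T near this refl eq t] show "\<alpha> t = \<beta> t" .
  qed
qed

lemma greatest_unramified:
  "\<exists>W. W \<in> subalgebras S R \<and> unramified (S\<lparr>carrier := W\<rparr>) R \<and>
    (\<forall>T \<in> subalgebras S R. unramified (S\<lparr>carrier := T\<rparr>) R \<longrightarrow> T \<subseteq> W) \<and> u_closed S W"
proof -
  let ?F = "{T \<in> subalgebras S R. unramified (S\<lparr>carrier := T\<rparr>) R}"
  have "\<exists>M\<in>?F. \<forall>Y\<in>?F. Y \<subseteq> M"
    by (rule exists_greatest) (use base_subalgebra unramified_base unramified_generate in auto)
  then obtain W where W: "W \<in> subalgebras S R" "unramified (S\<lparr>carrier := W\<rparr>) R"
    and max: "\<And>T. T \<in> subalgebras S R \<Longrightarrow> unramified (S\<lparr>carrier := T\<rparr>) R \<Longrightarrow> T \<subseteq> W"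
    by blast
  have "b \<in> W" if b: "b \<in> carrier S" "b [^] (2::nat) \<ominus> b \<in> W" "b [^] (3::nat) \<ominus> b [^] (2::nat) \<in> W" for b
  proof -
    have "b \<otimes> b \<ominus> b \<in> W" "b \<otimes> b \<otimes> b \<ominus> b \<otimes> b \<in> W"
      using b by (simp_all add: numeral_eq_Suc)
    \<comment> \<open>Adjoining b keeps W unramified, so the greatest unramified subalgebra already
      contains the result.\<close>
    then have "generate_ring S (insert b W) \<subseteq> W"
      by (intro max unramified_adjoin W b(1))
    then show ?thesis using generate_ring.incl[of b "insert b W" S] by blast
  qed
  then have "u_closed S W" unfolding u_closed_def by blast
  then show ?thesis by (intro exI[of _ W] conjI ballI impI W max)
qed

text \<open>Being u-closed is stable under intersection, so the intersection of all u-closed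
  subalgebras is the least one and \<open>LEAST\<close> denotes it; the subalgebra W makes the
  family nonempty.\<close>

lemma u_closure_subset:
  assumes W: "W \<in> subalgebras S R" "u_closed S W"
  shows "u_closure S R \<subseteq> W"
proof -
  let ?F = "{B. B \<in> subalgebras S R \<and> u_closed S B}"
  have sub: "subring (\<Inter>?F) S"
  proof (rule subring_Inter)
    show "subring B S" if "B \<in> ?F" for B using that subalgebraD(1) by simp
    show "?F \<noteq> {}" using W by blast
  qed
  have "R \<subseteq> \<Inter>?F"
    using subalgebraD(2) by (simp add: le_Inf_iff)
  with sub have "\<Inter>?F \<in> subalgebras S R"
    by (simp add: subalgebras_def)
  moreover have "u_closed S (\<Inter>?F)"
    unfolding u_closed_def by blast
  ultimately have "u_closure S R = \<Inter>?F"
    unfolding u_closure_def by (intro Least_equality) blast+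
  with W show ?thesis by blast
qed

end


section \<open>The Frobenius endomorphism\<close>

lemma (in cring) binomial_ring:
  assumes x: "x \<in> carrier R" and y: "y \<in> carrier R"
  shows "(x \<oplus> y) [^] n = (\<Oplus>k\<in>{..n::nat}. [(n choose k)] \<cdot> (x [^] k \<otimes> y [^] (n - k)))"
proof (induction n)
  case 0
  then show ?case by simp
next
  case (Suc n)
  define t where "t n k = [(n choose k)] \<cdot> (x [^] k \<otimes> y [^] (n - k))" for n k :: nat
  \<comment> \<open>\<open>s k\<close> equals \<open>y \<otimes> t n k\<close> for k up to n. With
    the exponent \<open>Suc n - k\<close> Pascal's rule \<open>tS\<close> holds for every k, and
    \<open>s (Suc n)\<close> vanishes by its binomial coefficient, so the shifted sum can be
    completed.\<close>
  define s where "s k = [(n choose k)] \<cdot> (x [^] k \<otimes> y [^] (Suc n - k))" for k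
  have tc: "t n k \<in> carrier R" and sc: "s k \<in> carrier R" for n k
    using x y by (simp_all add: t_def s_def)
  have tS: "t (Suc n) (Suc k) = x \<otimes> t n k \<oplus> s (Suc k)" for k
  proof -
    have "x \<otimes> t n k = [(n choose k)] \<cdot> (x [^] Suc k \<otimes> y [^] (n - k))"
      using x y by (simp add: t_def add_pow_rdistr m_ac)
    then show ?thesis
      using x y by (simp add: t_def s_def add.nat_pow_mult del: nat_pow_Suc)
  qed
  have sy: "s k = y \<otimes> t n k" if "k \<le> n" for k
  proof -
    have "y \<otimes> (x [^] k \<otimes> y [^] (n - k)) = x [^] k \<otimes> (y \<otimes> y [^] (n - k))"
      using x y by (simp add: m_lcomm)
    moreover have "y \<otimes> y [^] (n - k) = y [^] (Suc n - k)"
      using y that by (simp add: Suc_diff_le m_comm)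
    ultimately show ?thesis
      using x y by (simp add: t_def s_def add_pow_rdistr)
  qed
  have "(\<Oplus>k\<in>{..Suc n}. t (Suc n) k) = (\<Oplus>k\<in>{..n}. t (Suc n) (Suc k)) \<oplus> t (Suc n) 0"
    using tc by (intro finsum_Suc2) auto
  also have "t (Suc n) 0 = s 0"
    by (simp add: t_def s_def)
  also have "(\<Oplus>k\<in>{..n}. t (Suc n) (Suc k)) = (\<Oplus>k\<in>{..n}. x \<otimes> t n k) \<oplus> (\<Oplus>k\<in>{..n}. s (Suc k))"
    unfolding tS using tc sc x by (intro finsum_addf) auto
  also have "\<dots> \<oplus> s 0 = (\<Oplus>k\<in>{..n}. x \<otimes> t n k) \<oplus> ((\<Oplus>k\<in>{..n}. s (Suc k)) \<oplus> s 0)"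
    using tc sc x by (intro a_assoc) auto
  also have "(\<Oplus>k\<in>{..n}. s (Suc k)) \<oplus> s 0 = (\<Oplus>k\<in>{..Suc n}. s k)"
    using sc by (intro finsum_Suc2[symmetric]) auto
  also have "\<dots> = s (Suc n) \<oplus> (\<Oplus>k\<in>{..n}. s k)"
    using sc by (intro finsum_Suc) auto
  also have "s (Suc n) = \<zero>"
    by (simp add: s_def add_pow_def binomial_eq_0)
  also have "(\<Oplus>k\<in>{..n}. s k) = (\<Oplus>k\<in>{..n}. y \<otimes> t n k)"
    using sy tc y by (intro finsum_cong') auto
  also have "(\<Oplus>k\<in>{..n}. x \<otimes> t n k) = x \<otimes> (\<Oplus>k\<in>{..n}. t n k)"
    using tc x by (intro finsum_rdistr[symmetric]) auto
  also have "(\<Oplus>k\<in>{..n}. y \<otimes> t n k) = y \<otimes> (\<Oplus>k\<in>{..n}. t n k)"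
    using tc y by (intro finsum_rdistr[symmetric]) auto
  also have "(\<Oplus>k\<in>{..n}. t n k) = (x \<oplus> y) [^] n"
    using Suc.IH by (simp add: t_def)
  also have "x \<otimes> (x \<oplus> y) [^] n \<oplus> (\<zero> \<oplus> y \<otimes> (x \<oplus> y) [^] n) = (x \<oplus> y) [^] Suc n"
    using x y by (simp add: l_distr m_comm)
  finally show ?case by (simp add: t_def)
qed

lemma (in cring) add_pow_eq_zero:
  assumes "[(l::nat)] \<cdot> \<one> = \<zero>" "l dvd m" "a \<in> carrier R"
  shows "[m] \<cdot> a = \<zero>"
proof -
  from assms(2) obtain k where m: "m = l * k" by blast
  have "[l] \<cdot> a = ([l] \<cdot> \<one>) \<otimes> a"
    using assms(3) by (simp add: add_pow_ldistr)
  then have "[l] \<cdot> a = \<zero>" using assms by simp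
  then show ?thesis
    using assms(3) add.nat_pow_pow[of a k l] add.nat_pow_one[of k] by (simp add: m)
qed

text \<open>Needed in a tensor square of fields, which may have nilpotents, and not only in a field.
  All binomial coefficients except the two extreme ones are divisible by l.\<close>

lemma (in cring) frobenius_add:
  assumes l: "Factorial_Ring.prime (l::nat)" "[l] \<cdot> \<one> = \<zero>" and x: "x \<in> carrier R" and y: "y \<in> carrier R"
  shows "(x \<oplus> y) [^] l = x [^] l \<oplus> y [^] l"
proof -
  define t where "t k = [(l choose k)] \<cdot> (x [^] k \<otimes> y [^] (l - k))" for k :: nat
  have tc: "t k \<in> carrier R" for k using x y by (simp add: t_def)
  obtain m where m: "l = Suc m" using l(1) by (metis not0_implies_Suc not_prime_0)
  have "(\<Oplus>k\<in>{..m}. t k) = (\<Oplus>k\<in>{0::nat}. t k)"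
  proof (rule add.finprod_mono_neutral_cong_right)
    show "t i = \<zero>" if "i \<in> {..m} - {0}" for i
      unfolding t_def using that x y m l(1)
      by (intro add_pow_eq_zero[OF l(2)] dvd_choose_prime) auto
  qed (use tc in auto)
  also have "\<dots> = y [^] l"
    using tc x y by (simp add: t_def add.nat_pow_eone)
  finally have lower: "(\<Oplus>k\<in>{..m}. t k) = y [^] l" .
  have "(x \<oplus> y) [^] l = (\<Oplus>k\<in>{..l}. t k)"
    using binomial_ring[OF x y, of l] by (simp add: t_def)
  also have "\<dots> = t l \<oplus> (\<Oplus>k\<in>{..m}. t k)"
    unfolding m using tc by (intro finsum_Suc) auto
  also note lower
  also have "t l = x [^] l"
    using x y by (simp add: t_def add.nat_pow_eone)
  finally show ?thesis .
qed

text \<open>The least positive annihilator of \<open>\<one>\<close> divides all others by division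
  with remainder; it is prime because a factorisation of it yields two multiples of
  \<open>\<one>\<close> with product zero.\<close>

lemma (in domain) exists_prime_characteristic:
  assumes "n > (0::nat)" "[n] \<cdot> \<one> = \<zero>"
  obtains l where "Factorial_Ring.prime (l::nat)" "[l] \<cdot> \<one> = \<zero>" "\<And>m. [m] \<cdot> \<one> = \<zero> \<longleftrightarrow> l dvd m"
proof -
  define l where "l = (LEAST l. l > (0::nat) \<and> [l] \<cdot> \<one> = \<zero>)"
  have l: "l > 0" "[l] \<cdot> \<one> = \<zero>"
    using LeastI[of "\<lambda>l. l > 0 \<and> [l] \<cdot> \<one> = \<zero>" n] assms by (auto simp: l_def)
  have least: "m = 0 \<or> l \<le> m" if "[m] \<cdot> \<one> = \<zero>" for m :: nat
    using that Least_le[of "\<lambda>l. l > 0 \<and> [l] \<cdot> \<one> = \<zero>" m] by (auto simp: l_def)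
  have dvd: "l dvd m" if m: "[m] \<cdot> \<one> = \<zero>" for m
  proof -
    have "[m] \<cdot> \<one> = [(l * (m div l))] \<cdot> \<one> \<oplus> [(m mod l)] \<cdot> \<one>"
      by (simp add: add.nat_pow_mult)
    then have "[(m mod l)] \<cdot> \<one> = \<zero>"
      using m add_pow_eq_zero[OF l(2), of "l * (m div l)" \<one>] by simp
    then show ?thesis
      using least[of "m mod l"] mod_less_divisor[OF l(1), of m] by auto
  qed
  have "Factorial_Ring.prime l"
    unfolding prime_nat_iff
  proof (intro conjI allI impI)
    show "1 < l"
      using l least[of 1] one_not_zero by (cases "l = 1") (auto simp: add.nat_pow_eone)
    fix a assume "a dvd l"
    then obtain b where ab: "l = a * b" by blast
    have "[a] \<cdot> \<one> \<otimes> [b] \<cdot> \<one> = [l] \<cdot> \<one>"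
      by (simp add: add_pow_ldistr add.nat_pow_pow ab mult.commute)
    then have "[a] \<cdot> \<one> = \<zero> \<or> [b] \<cdot> \<one> = \<zero>"
      using l(2) integral by simp
    then have "l dvd a \<or> l dvd b" using dvd by blast
    then show "a = 1 \<or> a = l"
      using ab l(1) by (auto simp: dvd_def)
  qed
  moreover have "[m] \<cdot> \<one> = \<zero> \<longleftrightarrow> l dvd m" for m
    using dvd add_pow_eq_zero[OF l(2), of m \<one>] by auto
  ultimately show ?thesis using l(2) that by blast
qed


section \<open>Separable extensions and derivations\<close>

text \<open>The derivative before normalisation. Its length depends only on that of p, which permits
  recursion on the list through \<open>deriv_coeffs_Cons\<close>.\<close>

definition deriv_coeffs :: "('a, 'm) ring_scheme \<Rightarrow> 'a list \<Rightarrow> 'a list"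
  where "deriv_coeffs L p = map (\<lambda>i. add_pow L (degree p - i) (p ! i)) [0..<degree p]"

lemma poly_deriv_eq: "poly_deriv L p = ring.normalize L (deriv_coeffs L p)"
  by (simp add: poly_deriv_def deriv_coeffs_def)

lemma deriv_coeffs_Cons:
  assumes "q \<noteq> []"
  shows "deriv_coeffs L (a # q) = add_pow L (length q) a # deriv_coeffs L q"
proof -
  have "[0..<length q] = 0 # map Suc [0..<length q - 1]"
    using assms by (cases "length q") (auto simp: upt_conv_Cons map_Suc_upt simp del: upt_Suc)
  then show ?thesis
    by (simp add: deriv_coeffs_def)
qed

lemma deriv_coeffs_small [simp]: "deriv_coeffs L [] = []" "deriv_coeffs L [a] = []"
  by (simp_all add: deriv_coeffs_def)

lemma length_deriv_coeffs [simp]: "length (deriv_coeffs L p) = length p - 1"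
  by (simp add: deriv_coeffs_def)

lemma (in ring) subring_add_pow_closed:
  assumes "subring K R" "a \<in> K"
  shows "[(n::nat)] \<cdot> a \<in> K"
proof (induction n)
  case 0
  then show ?case using subringE(2)[OF assms(1)] by simp
next
  case (Suc n)
  then show ?case using subringE(7)[OF assms(1)] assms(2) by simp
qed

lemma (in ring) deriv_coeffs_closed:
  assumes "subring K R" "set p \<subseteq> K"
  shows "set (deriv_coeffs R p) \<subseteq> K"
  using subring_add_pow_closed[OF assms(1)] assms(2) by (auto simp: deriv_coeffs_def subset_iff)

text \<open>The difference of two infinitely near homomorphisms is a derivation.\<close>

lemma infinitely_near_eval:
  fixes C (structure)
  assumes T: "cring T" and near: "infinitely_near C T R \<alpha> \<beta>" and R: "R \<subseteq> carrier T"
    and x: "x \<in> carrier T" and p: "set p \<subseteq> R"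
  shows "\<beta> (ring.eval T p x) \<ominus> \<alpha> (ring.eval T p x) =
    \<alpha> (ring.eval T (deriv_coeffs T p) x) \<otimes> (\<beta> x \<ominus> \<alpha> x)"
proof -
  interpret T: cring T by fact
  note near' = infinitely_nearD[OF near]
  interpret C: cring C by (rule near')
  interpret \<alpha>: ring_hom_cring T C \<alpha>
    by (intro ring_hom_cringI ring_hom_ringI2 T.ring_axioms C.ring_axioms near' T)
  interpret \<beta>: ring_hom_cring T C \<beta>
    by (intro ring_hom_cringI ring_hom_ringI2 T.ring_axioms C.ring_axioms near' T)
  define d where "d z = \<beta> z \<ominus> \<alpha> z" for z
  have d_closed [simp]: "d z \<in> carrier C" if "z \<in> carrier T" for z
    using that by (simp add: d_def)
  have \<beta>_eq: "\<beta> z = \<alpha> z \<oplus> d z" if "z \<in> carrier T" for z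
  proof -
    have "\<alpha> z \<in> carrier C" "\<beta> z \<in> carrier C" using that by auto
    then show ?thesis unfolding d_def by algebra
  qed
  have d_add: "d (z \<oplus>\<^bsub>T\<^esub> w) = d z \<oplus> d w" if "z \<in> carrier T" "w \<in> carrier T" for z w
  proof -
    have "\<alpha> z \<in> carrier C" "\<beta> z \<in> carrier C" "\<alpha> w \<in> carrier C" "\<beta> w \<in> carrier C" using that by auto
    then show ?thesis unfolding d_def \<alpha>.hom_add[OF that] \<beta>.hom_add[OF that] by algebra
  qed
  \<comment> \<open>Leibniz rule: expanding the product leaves the extra term
    \<open>d z \<otimes> d w\<close>, which vanishes because the pair is infinitely near.\<close>
  have d_mult: "d (z \<otimes>\<^bsub>T\<^esub> w) = \<alpha> z \<otimes> d w \<oplus> \<alpha> w \<otimes> d z" if "z \<in> carrier T" "w \<in> carrier T" for z w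
  proof -
    have c: "\<alpha> z \<in> carrier C" "\<alpha> w \<in> carrier C" "d z \<in> carrier C" "d w \<in> carrier C" using that by auto
    have "d (z \<otimes>\<^bsub>T\<^esub> w) = \<beta> z \<otimes> \<beta> w \<ominus> \<alpha> z \<otimes> \<alpha> w"
      using that by (simp add: d_def)
    also have "\<dots> = (\<alpha> z \<oplus> d z) \<otimes> (\<alpha> w \<oplus> d w) \<ominus> \<alpha> z \<otimes> \<alpha> w"
      unfolding \<beta>_eq[OF that(1)] \<beta>_eq[OF that(2)] ..
    also have "\<dots> = \<alpha> z \<otimes> d w \<oplus> \<alpha> w \<otimes> d z \<oplus> d z \<otimes> d w"
      using c by algebra
    also have "d z \<otimes> d w = \<zero>"
      using near'(5) that by (simp add: d_def)
    finally show ?thesis using c by simp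
  qed
  have d_R: "d r = \<zero>" if "r \<in> R" for r
  proof -
    have "\<beta> r \<in> carrier C" using that R by auto
    then show ?thesis using near'(4)[OF that] by (simp add: d_def)
  qed
  \<comment> \<open>For \<open>n = 0\<close> the truncated exponent \<open>n - 1\<close> does no
    harm, since the coefficient \<open>[n]\<close> kills the term.\<close>
  have d_pow: "d (x [^]\<^bsub>T\<^esub> n) = \<alpha> ([n] \<cdot>\<^bsub>T\<^esub> (x [^]\<^bsub>T\<^esub> (n - 1))) \<otimes> d x" for n :: nat
  proof (induction n)
    case 0
    then show ?case using x by (simp add: d_def)
  next
    case (Suc n)
    have "d (x [^]\<^bsub>T\<^esub> Suc n) = \<alpha> (x [^]\<^bsub>T\<^esub> n) \<otimes> d x \<oplus> \<alpha> x \<otimes> d (x [^]\<^bsub>T\<^esub> n)"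
      using x by (simp add: d_mult)
    also have "\<dots> = \<alpha> (x [^]\<^bsub>T\<^esub> n \<oplus>\<^bsub>T\<^esub> x \<otimes>\<^bsub>T\<^esub> ([n] \<cdot>\<^bsub>T\<^esub> (x [^]\<^bsub>T\<^esub> (n - 1)))) \<otimes> d x"
      using x by (simp add: Suc.IH C.l_distr C.m_assoc)
    also have "x \<otimes>\<^bsub>T\<^esub> ([n] \<cdot>\<^bsub>T\<^esub> (x [^]\<^bsub>T\<^esub> (n - 1))) = [n] \<cdot>\<^bsub>T\<^esub> (x [^]\<^bsub>T\<^esub> n)"
    proof (cases n)
      case (Suc m)
      then show ?thesis using x by (simp add: T.add_pow_rdistr T.m_comm del: T.add.nat_pow_Suc)
    qed (use x in simp)
    also have "x [^]\<^bsub>T\<^esub> n \<oplus>\<^bsub>T\<^esub> [n] \<cdot>\<^bsub>T\<^esub> (x [^]\<^bsub>T\<^esub> n) = [(Suc n)] \<cdot>\<^bsub>T\<^esub> (x [^]\<^bsub>T\<^esub> (Suc n - 1))"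
      using x by (simp add: T.a_comm)
    finally show ?case .
  qed
  have "d (T.eval p x) = \<alpha> (T.eval (deriv_coeffs T p) x) \<otimes> d x"
    using p
  proof (induction p)
    case Nil
    then show ?case using x by (simp add: d_def)
  next
    case (Cons a q)
    have aR: "a \<in> R" and a: "a \<in> carrier T" and q: "set q \<subseteq> R" "set q \<subseteq> carrier T"
      using Cons.prems R by auto
    have ev: "T.eval q x \<in> carrier T" using q x by (intro T.eval_in_carrier)
    have da: "d (a \<otimes>\<^bsub>T\<^esub> x [^]\<^bsub>T\<^esub> n) = \<alpha> (([n] \<cdot>\<^bsub>T\<^esub> a) \<otimes>\<^bsub>T\<^esub> x [^]\<^bsub>T\<^esub> (n - 1)) \<otimes> d x" for n :: nat
    proof -
      have "d (a \<otimes>\<^bsub>T\<^esub> x [^]\<^bsub>T\<^esub> n) = \<alpha> a \<otimes> (\<alpha> ([n] \<cdot>\<^bsub>T\<^esub> (x [^]\<^bsub>T\<^esub> (n - 1))) \<otimes> d x)"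
        using a x by (simp add: d_mult d_R[OF aR] d_pow)
      also have "\<dots> = \<alpha> (a \<otimes>\<^bsub>T\<^esub> ([n] \<cdot>\<^bsub>T\<^esub> (x [^]\<^bsub>T\<^esub> (n - 1)))) \<otimes> d x"
        using a x by (simp add: C.m_assoc)
      also have "a \<otimes>\<^bsub>T\<^esub> ([n] \<cdot>\<^bsub>T\<^esub> (x [^]\<^bsub>T\<^esub> (n - 1))) = ([n] \<cdot>\<^bsub>T\<^esub> a) \<otimes>\<^bsub>T\<^esub> x [^]\<^bsub>T\<^esub> (n - 1)"
        using a x by (simp add: T.add_pow_rdistr T.add_pow_ldistr)
      finally show ?thesis .
    qed
    show ?case
    proof (cases "q = []")
      case True
      then show ?thesis using a x d_R[OF aR] by simp
    next
      case False
      have dev: "T.eval (deriv_coeffs T q) x \<in> carrier T"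
        using T.deriv_coeffs_closed[OF T.carrier_is_subring q(2)] x by (intro T.eval_in_carrier)
      have "d (T.eval (a # q) x) = d (a \<otimes>\<^bsub>T\<^esub> x [^]\<^bsub>T\<^esub> length q) \<oplus> d (T.eval q x)"
        using a x ev by (simp add: d_add)
      also have "\<dots> = \<alpha> (([length q] \<cdot>\<^bsub>T\<^esub> a) \<otimes>\<^bsub>T\<^esub> x [^]\<^bsub>T\<^esub> (length q - 1) \<oplus>\<^bsub>T\<^esub> T.eval (deriv_coeffs T q) x) \<otimes> d x"
        unfolding da Cons.IH[OF q(1)] using a x dev by (simp add: C.l_distr)
      also have "([length q] \<cdot>\<^bsub>T\<^esub> a) \<otimes>\<^bsub>T\<^esub> x [^]\<^bsub>T\<^esub> (length q - 1) \<oplus>\<^bsub>T\<^esub> T.eval (deriv_coeffs T q) x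
          = T.eval (deriv_coeffs T (a # q)) x"
        using False by (simp add: deriv_coeffs_Cons)
      finally show ?thesis .
    qed
  qed
  then show ?thesis by (simp add: d_def)
qed

section \<open>Separability of an element read off from the derivative of its minimal
  polynomial\<close>

context field begin

lemma poly_deriv_closed:
  assumes "subring K R" "p \<in> carrier (K[X])" "x \<in> carrier R"
  shows "poly_deriv R p \<in> carrier (K[X])" "eval (poly_deriv R p) x = eval (deriv_coeffs R p) x"
proof -
  have "set p \<subseteq> K" using assms(2) by (simp add: univ_poly_carrier[symmetric] polynomial_incl)
  then have *: "set (deriv_coeffs R p) \<subseteq> K" by (rule deriv_coeffs_closed[OF assms(1)])
  then show "poly_deriv R p \<in> carrier (K[X])"
    unfolding poly_deriv_eq univ_poly_carrier[symmetric] by (rule normalize_gives_polynomial)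
  show "eval (poly_deriv R p) x = eval (deriv_coeffs R p) x"
    unfolding poly_deriv_eq using * subringE(1)[OF assms(1)] assms(3) by (intro eval_normalize) auto
qed

text \<open>If the derivative vanished at x, the minimal polynomial would divide it, hence divide
  the greatest common divisor one; but an irreducible polynomial is not a unit.\<close>

lemma separable_poly_Irr_imp:
  assumes K: "subfield K R" and x: "x \<in> carrier R" "(algebraic over K) x"
    and sep: "separable_poly R K (Irr K x)"
  shows "eval (deriv_coeffs R (Irr K x)) x \<noteq> \<zero>"
proof
  assume 0: "eval (deriv_coeffs R (Irr K x)) x = \<zero>"
  note Irr = IrrE[OF K x] and Ks = subfieldE(1)[OF K]
  interpret UP: domain "K[X]" by (rule univ_poly_is_domain[OF Ks])
  note deriv = poly_deriv_closed[OF Ks Irr(1) x(1)]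
  have "Irr K x pdivides poly_deriv R (Irr K x)"
    using Irr_minimal[OF K x deriv(1)] deriv(2) 0 by simp
  then have "Irr K x divides\<^bsub>K[X]\<^esub> poly_deriv R (Irr K x)"
    using pdivides_iff_shell[OF K Irr(1) deriv(1)] by simp
  then have "Irr K x divides\<^bsub>K[X]\<^esub> \<one>\<^bsub>K[X]\<^esub>"
    using sep Irr(1) unfolding separable_poly_def isgcd_def by auto
  then have "Irr K x \<in> Units (K[X])"
    using UP.Unit_eq_dividesone[OF Irr(1)] by simp
  then show False
    using pirreducibleE(2)[OF Ks Irr(1,2)] by simp
qed

text \<open>A divisor of the irreducible polynomial is a unit or associated to it. In the second
  case the polynomial divides its own derivative, which has smaller degree and so must be
  zero.\<close>

lemma not_separable_poly_Irr_imp: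
  assumes K: "subfield K R" and x: "x \<in> carrier R" "(algebraic over K) x"
    and insep: "\<not> separable_poly R K (Irr K x)"
  shows "poly_deriv R (Irr K x) = []"
proof (rule ccontr)
  let ?f = "Irr K x" and ?f' = "poly_deriv R (Irr K x)"
  assume ne: "?f' \<noteq> []"
  note Irr = IrrE[OF K x] and Ks = subfieldE(1)[OF K]
  interpret UP: domain "K[X]" by (rule univ_poly_is_domain[OF Ks])
  note deriv = poly_deriv_closed[OF Ks Irr(1) x(1)]
  have "length ?f' \<le> length ?f - 1"
    unfolding poly_deriv_eq using normalize_length_le[of "deriv_coeffs R ?f"] by simp
  then have deg: "degree ?f' < degree ?f"
    using ne by (cases ?f') auto
  have "d divides\<^bsub>K[X]\<^esub> \<one>\<^bsub>K[X]\<^esub>"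
    if d: "d \<in> carrier (K[X])" "d divides\<^bsub>K[X]\<^esub> ?f" "d divides\<^bsub>K[X]\<^esub> ?f'" for d
  proof -
    have "\<not> d \<sim>\<^bsub>K[X]\<^esub> ?f"
    proof
      assume "d \<sim>\<^bsub>K[X]\<^esub> ?f"
      then have "?f divides\<^bsub>K[X]\<^esub> d" by (simp add: associated_def)
      then have "?f divides\<^bsub>K[X]\<^esub> ?f'"
        using d(3) Irr(1) by (rule UP.divides_trans)
      then have "?f pdivides ?f'"
        using pdivides_iff_shell[OF K Irr(1) deriv(1)] by simp
      then have "degree ?f \<le> degree ?f'"
        by (rule pdivides_imp_degree_le[OF Ks Irr(1) deriv(1) ne])
      with deg show False by simp
    qed
    then have "d \<in> Units (K[X])"
      using divides_pirreducible_condition[OF Irr(2) d(1,2)] by simp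
    then show ?thesis
      using UP.Unit_eq_dividesone[OF d(1)] by simp
  qed
  then have "separable_poly R K ?f"
    unfolding separable_poly_def isgcd_def using UP.one_divides Irr(1) deriv(1) by blast
  with insep show False by simp
qed

end

text \<open>Let f be the minimal polynomial of x. The derivation rule applied to f(x) = 0 shows that
  the image of f'(x) kills the difference of the two images of x, and f'(x) is invertible by
  separability.\<close>

lemma separable_imp_eq:
  assumes L: "field L" and K: "subfield K L" and sep: "separable_extension L K"
    and near: "infinitely_near C L K \<alpha> \<beta>" and x: "x \<in> carrier L"
  shows "\<alpha> x = \<beta> x"
proof -
  interpret L: field L by fact
  note near' = infinitely_nearD[OF near]
  interpret C: cring C by (rule near')
  interpret \<alpha>: ring_hom_cring L C \<alpha>
    by (intro ring_hom_cringI ring_hom_ringI2 L.ring_axioms C.ring_axioms near' L.is_cring)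
  interpret \<beta>: ring_hom_cring L C \<beta>
    by (intro ring_hom_cringI ring_hom_ringI2 L.ring_axioms C.ring_axioms near' L.is_cring)
  have alg: "(L.algebraic over K) x" and s: "separable_poly L K (L.Irr K x)"
    using sep x unfolding separable_extension_def over_def by auto
  note Irr = L.IrrE[OF K x alg]
  define u where "u = L.eval (deriv_coeffs L (L.Irr K x)) x"
  have p: "set (L.Irr K x) \<subseteq> K"
    using Irr(1) by (simp add: univ_poly_carrier[symmetric] L.polynomial_incl)
  have "set (deriv_coeffs L (L.Irr K x)) \<subseteq> carrier L"
    using L.deriv_coeffs_closed[OF subfieldE(1)[OF K] p] subfieldE(3)[OF K] by blast
  then have u: "u \<in> carrier L" unfolding u_def using x by (rule L.eval_in_carrier)
  have "u \<noteq> \<zero>\<^bsub>L\<^esub>"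
    unfolding u_def by (rule L.separable_poly_Irr_imp[OF K x alg s])
  then have u': "inv\<^bsub>L\<^esub> u \<in> carrier L" "inv\<^bsub>L\<^esub> u \<otimes>\<^bsub>L\<^esub> u = \<one>\<^bsub>L\<^esub>"
    using u L.field_Units by auto
  define e where "e = \<beta> x \<ominus>\<^bsub>C\<^esub> \<alpha> x"
  have e: "e \<in> carrier C" using x by (simp add: e_def)
  have "\<alpha> u \<otimes>\<^bsub>C\<^esub> e = \<beta> \<zero>\<^bsub>L\<^esub> \<ominus>\<^bsub>C\<^esub> \<alpha> \<zero>\<^bsub>L\<^esub>"
    using infinitely_near_eval[OF L.is_cring near subfieldE(3)[OF K] x p]
    unfolding Irr(4) u_def e_def by (rule sym)
  then have "\<alpha> u \<otimes>\<^bsub>C\<^esub> e = \<zero>\<^bsub>C\<^esub>"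
    by (simp add: C.minus_eq)
  then have "\<alpha> (inv\<^bsub>L\<^esub> u) \<otimes>\<^bsub>C\<^esub> (\<alpha> u \<otimes>\<^bsub>C\<^esub> e) = \<zero>\<^bsub>C\<^esub>"
    using u' by simp
  then have "\<alpha> (inv\<^bsub>L\<^esub> u \<otimes>\<^bsub>L\<^esub> u) \<otimes>\<^bsub>C\<^esub> e = \<zero>\<^bsub>C\<^esub>"
    unfolding \<alpha>.hom_mult[OF u'(1) u] using u u' e by (simp add: C.m_assoc)
  then have "e = \<zero>\<^bsub>C\<^esub>" using u'(2) e by simp
  then show ?thesis using x by (simp add: e_def)
qed


section \<open>Field extensions without differentials are separable\<close>

context ring begin

lemma normalize_eq_Nil_imp: "normalize p = [] \<Longrightarrow> set p \<subseteq> {\<zero>}"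
  by (induction p) (auto split: if_splits)

text \<open>Each further vector either lies in the span already or raises the dimension by one, so
  only a list without redundant vectors reaches a dimension equal to its length.\<close>

lemma dimension_Span:
  assumes K: "subfield K R" and "set Us \<subseteq> carrier R"
  shows "\<exists>m \<le> length Us. dimension m K (Span K Us) \<and> (m = length Us \<longrightarrow> independent K Us)"
  using assms(2)
proof (induction Us)
  case Nil
  then show ?case by auto
next
  case (Cons u Us)
  then have u: "u \<in> carrier R" and Us: "set Us \<subseteq> carrier R" by auto
  obtain m where m: "m \<le> length Us" "dimension m K (Span K Us)" "m = length Us \<longrightarrow> independent K Us"
    using Cons.IH[OF Us] by blast
  show ?case
  proof (cases "u \<in> Span K Us")
    case True
    then have "set (u # Us) \<subseteq> Span K Us" using Span_base_incl[OF K Us] by auto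
    then have "Span K (u # Us) \<subseteq> Span K Us" by (rule mono_Span_subset[OF K _ Us])
    with mono_Span[OF K Us u] have "Span K (u # Us) = Span K Us" by blast
    with m show ?thesis by (intro exI[of _ m]) (auto simp del: Span.simps)
  next
    case False
    then have "dimension (Suc m) K (Span K (u # Us))"
      using Suc_dim[OF u False m(2)] by simp
    moreover have "Suc m = length (u # Us) \<longrightarrow> independent K (u # Us)"
      using m(3) li_Cons[OF u False] by auto
    ultimately show ?thesis using m(1) by (intro exI[of _ "Suc m"]) (auto simp del: Span.simps)
  qed
qed

lemma spanning_imp_independent:
  assumes K: "subfield K R" and "set Us \<subseteq> carrier R" "dimension (length Us) K (Span K Us)"
  shows "independent K Us"
proof -
  obtain m where "dimension m K (Span K Us)" "m = length Us \<longrightarrow> independent K Us"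
    using dimension_Span[OF K assms(2)] by blast
  then show ?thesis using dimension_is_inj[OF K assms(3)] by blast
qed

end

section \<open>Polynomials in l-th powers\<close>

context cring begin

text \<open>Dropping the coefficients at exponents not divisible by l rewrites p(x) as a polynomial
  in x^l. The stated length of g counts the multiples of l among the exponents of p, and the leading
  coefficient survives when the top exponent is one of them.\<close>

lemma sparse_eval:
  assumes x: "x \<in> carrier R" and l: "l > (0::nat)" and "set p \<subseteq> carrier R"
    and "\<And>i. i < length p \<Longrightarrow> \<not> l dvd (length p - 1 - i) \<Longrightarrow> p ! i = \<zero>"
  shows "\<exists>g. set g \<subseteq> set p \<and> length g = (length p + l - 1) div l \<and> eval p x = eval g (x [^] l) \<and>
    (p \<noteq> [] \<and> l dvd (length p - 1) \<longrightarrow> g \<noteq> [] \<and> hd g = hd p)"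
  using assms(3,4)
proof (induction p)
  case Nil
  then show ?case using l by (intro exI[of _ "[]"]) auto
next
  case (Cons a q)
  have a: "a \<in> carrier R" and q: "set q \<subseteq> carrier R" using Cons.prems by auto
  have "q ! i = \<zero>" if "i < length q" "\<not> l dvd (length q - 1 - i)" for i
    using Cons.prems(2)[of "Suc i"] that by simp
  then obtain g where g: "set g \<subseteq> set q" "length g = (length q + l - 1) div l"
      "eval q x = eval g (x [^] l)"
    using Cons.IH[OF q] by blast
  have gc: "set g \<subseteq> carrier R" using g(1) q by blast
  then have ev: "eval g (x [^] l) \<in> carrier R" using x by (intro eval_in_carrier) auto
  show ?case
  \<comment> \<open>The exponent of the head a is \<open>length q\<close>: if l divides it, a is
    kept as the head of the new list, and otherwise a is zero.\<close>
  proof (cases "l dvd length q")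
    case True
    then obtain m where m: "length q = l * m" by blast
    have len: "length g = m"
      unfolding g(2) m using l by (simp add: div_nat_eqI)
    show ?thesis
    proof (intro exI[of _ "a # g"] conjI impI)
      show "length (a # g) = (length (a # q) + l - 1) div l"
        using len m l by simp
      show "eval (a # q) x = eval (a # g) (x [^] l)"
        using len m g(3) x by (simp add: nat_pow_pow)
    qed (use g in auto)
  next
    case False
    then have "a = \<zero>" using Cons.prems(2)[of 0] by simp
    then have "eval (a # q) x = eval g (x [^] l)"
      using g(3) ev x by simp
    moreover have "length g = (length (a # q) + l - 1) div l"
    proof -
      define m r where "m = length q div l" and "r = length q mod l"
      have q: "length q = l * m + r" "r < l" "r > 0"
        using False l by (auto simp: m_def r_def dvd_eq_mod_eq_0)
      have "(length q + l - 1) div l = m + 1" "(length q + l) div l = m + 1"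
        using q l by (auto intro!: div_nat_eqI simp: algebra_simps)
      then show ?thesis using g(2) by simp
    qed
    ultimately show ?thesis
      using g False by (intro exI[of _ g]) auto
  qed
qed

lemma frobenius_hom:
  assumes "Factorial_Ring.prime (l::nat)" "[l] \<cdot> \<one> = \<zero>"
  shows "ring_hom_cring R R (\<lambda>u. u [^] l)"
proof -
  have "(\<lambda>u. u [^] l) \<in> ring_hom R R"
    by (rule ring_hom_memI) (auto simp: frobenius_add[OF assms] nat_pow_distrib)
  then show ?thesis
    by (intro ring_hom_cringI ring_hom_ringI2 ring_axioms is_cring)
qed

end

section \<open>Finite field extensions in prime characteristic\<close>

context field begin

lemma subfield_nat_pow_closed: "subfield K R \<Longrightarrow> k \<in> K \<Longrightarrow> k [^] (n::nat) \<in> K"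
proof (induction n)
  case (Suc n)
  then show ?case using subringE(6)[OF subfieldE(1)] by simp
qed (use subringE(3)[OF subfieldE(1)] in simp)

text \<open>F is the ring \<open>K L\<^sup>l\<close>: Frobenius turns an expression of z in the
  spanning list into one of its l-th power in the l-th powers of that list. Closure under products
  follows by expanding one factor at a time.\<close>

lemma frobenius_span:
  assumes l: "Factorial_Ring.prime (l::nat)" "[l] \<cdot> \<one> = \<zero>" and K: "subfield K R"
    and Us: "set Us \<subseteq> carrier R" "Span K Us = carrier R"
  defines "F \<equiv> Span K (map (\<lambda>u. u [^] l) Us)"
  shows "\<And>z. z \<in> carrier R \<Longrightarrow> z [^] l \<in> F" "subring F R" "K \<subseteq> F"
proof -
  interpret \<phi>: ring_hom_cring R R "\<lambda>u. u [^] l" by (rule frobenius_hom[OF l])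
  have map: "set (map (\<lambda>u. u [^] l) Us) \<subseteq> carrier R" using Us by auto
  note Ks = subfieldE(1)[OF K] and Kc = subfieldE(3)[OF K]
  note Fp = Span_subgroup_props[OF K map, folded F_def]
  have Fsm: "k \<otimes> v \<in> F" if "k \<in> K" "v \<in> F" for k v
    using Span_smult_closed[OF K map] that unfolding F_def by blast
  show pow: "z [^] l \<in> F" if z: "z \<in> carrier R" for z
  proof -
    from z obtain Ks where Ks: "set Ks \<subseteq> K" "z = combine Ks Us"
      using Span_eq_combine_set[OF K Us(1)] unfolding Us(2) by blast
    have "z [^] l = combine (map (\<lambda>u. u [^] l) Ks) (map (\<lambda>u. u [^] l) Us)"
      unfolding Ks(2) using Ks(1) Kc Us(1) by (intro \<phi>.ring.combine_hom[symmetric]) auto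
    moreover have "set (map (\<lambda>u. u [^] l) Ks) \<subseteq> K"
      using Ks(1) subfield_nat_pow_closed[OF K] by auto
    ultimately show ?thesis
      unfolding F_def Span_eq_combine_set[OF K map] by blast
  qed
  have mult1: "u \<otimes> w [^] l \<in> F" if u: "u \<in> F" and w: "w \<in> carrier R" for u w
  proof -
    let ?E = "{u \<in> carrier R. u \<otimes> w [^] l \<in> F}"
    have E: "subgroup ?E (add_monoid R)"
      by (rule add.subgroupI) (use w Fp in \<open>auto simp: l_distr l_minus intro!: exI[of _ \<zero>]\<close>)
    have "K <#> set (map (\<lambda>u. u [^] l) Us) \<subseteq> ?E"
    proof
      fix a assume "a \<in> K <#> set (map (\<lambda>u. u [^] l) Us)"
      then obtain k v where kv: "k \<in> K" "v \<in> set Us" "a = k \<otimes> v [^] l"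
        unfolding set_mult_def by auto
      then have c: "k \<in> carrier R" "v \<in> carrier R" using Kc Us by auto
      have "a \<otimes> w [^] l = k \<otimes> (v \<otimes> w) [^] l"
        using c w kv by (simp add: m_assoc nat_pow_distrib)
      also have "\<dots> \<in> F" using c w kv by (intro Fsm pow) auto
      finally show "a \<in> ?E" using c kv by simp
    qed
    from Span_min[OF K map E this] u show ?thesis unfolding F_def by blast
  qed
  have mult: "u \<otimes> v \<in> F" if u: "u \<in> F" and v: "v \<in> F" for u v
  proof -
    have uc: "u \<in> carrier R" using u Fp(1) by blast
    let ?E = "{v \<in> carrier R. u \<otimes> v \<in> F}"
    have E: "subgroup ?E (add_monoid R)"
      by (rule add.subgroupI) (use uc Fp in \<open>auto simp: r_distr r_minus intro!: exI[of _ \<zero>]\<close>)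
    have "K <#> set (map (\<lambda>u. u [^] l) Us) \<subseteq> ?E"
    proof
      fix a assume "a \<in> K <#> set (map (\<lambda>u. u [^] l) Us)"
      then obtain k v where kv: "k \<in> K" "v \<in> set Us" "a = k \<otimes> v [^] l"
        unfolding set_mult_def by auto
      then have c: "k \<in> carrier R" "v \<in> carrier R" using Kc Us by auto
      have "u \<otimes> a = k \<otimes> (u \<otimes> v [^] l)"
        using c uc kv by (simp add: m_lcomm)
      also have "\<dots> \<in> F" using c u kv by (intro Fsm mult1) auto
      finally show "a \<in> ?E" using c kv by simp
    qed
    from Span_min[OF K map E this] v show ?thesis unfolding F_def by blast
  qed
  have one: "\<one> \<in> F" using pow[of \<one>] by simp
  show "subring F R"
    by (rule subringI) (use Fp one mult in auto)
  show "K \<subseteq> F"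
    using Fsm[OF _ one] Kc by force
qed

text \<open>As the derivative of f = Irr K x vanishes, f(X) = g(X^l), and g is a relation among 1,
  ..., z^(n-1) for z = x^l and n the degree of f. Extend 1, ..., x^(n-1) to a K-basis. If its l-th
  powers spanned the field, they would be independent by counting, and so would the powers of
  z.\<close>

lemma inseparable_imp_proper:
  assumes K: "subfield K R" and fin: "finite_dimension K (carrier R)"
    and x: "x \<in> carrier R" and insep: "\<not> separable_poly R K (Irr K x)"
  obtains l F where "Factorial_Ring.prime (l::nat)" "[l] \<cdot> \<one> = \<zero>" "subring F R" "K \<subseteq> F"
    "\<And>z. z \<in> carrier R \<Longrightarrow> z [^] l \<in> F" "F \<noteq> carrier R"
proof -
  have alg: "(algebraic over K) x"
    by (rule finite_dimension_imp_algebraic[OF K carrier_is_subring fin x])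
  note Irr = IrrE[OF K x alg] and Ks = subfieldE(1)[OF K] and Kc = subfieldE(3)[OF K]
  let ?f = "Irr K x"
  define n where "n = degree ?f"
  have fK: "set ?f \<subseteq> K" using Irr(1) by (simp add: univ_poly_carrier[symmetric] polynomial_incl)
  have fne: "?f \<noteq> []" using pirreducibleE(1)[OF Ks Irr(1,2)] .
  have len: "length ?f = Suc n" using fne by (simp add: n_def)
  \<comment> \<open>A monic constant polynomial is one and has no root.\<close>
  have n: "n > 0"
  proof (rule ccontr)
    assume "\<not> n > 0"
    then obtain a where a: "?f = [a]" using len by (metis length_0_conv length_Suc_conv neq0_conv)
    then show False using Irr(3,4) x by simp
  qed
  have "normalize (deriv_coeffs R ?f) = []"
    using not_separable_poly_Irr_imp[OF K x alg insep] by (simp add: poly_deriv_eq)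
  then have "set (deriv_coeffs R ?f) \<subseteq> {\<zero>}" by (rule normalize_eq_Nil_imp)
  then have der: "[(n - i)] \<cdot> (?f ! i) = \<zero>" if "i < n" for i
    using that unfolding deriv_coeffs_def n_def[symmetric] by (simp add: image_subset_iff)
  \<comment> \<open>The coefficient of degree n - 1 in the derivative is n times one, so its
    vanishing forces positive characteristic.\<close>
  have "?f ! 0 = \<one>" using Irr(3) fne by (simp add: hd_conv_nth)
  then have "[n] \<cdot> \<one> = \<zero>" using der[of 0] n by simp
  then obtain l where l: "Factorial_Ring.prime (l::nat)" "[l] \<cdot> \<one> = \<zero>"
    and char: "\<And>m. [m] \<cdot> \<one> = \<zero> \<longleftrightarrow> l dvd m"
    using exists_prime_characteristic[OF n] by blast
  have ldn: "l dvd n" using char \<open>[n] \<cdot> \<one> = \<zero>\<close> by blast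
  have l2: "l \<ge> 2" using l(1) by (rule prime_ge_2_nat)
  have sparse: "?f ! i = \<zero>" if i: "i < length ?f" "\<not> l dvd (length ?f - 1 - i)" for i
  proof -
    have "i < n" using i len by (cases "i = n") auto
    have c: "?f ! i \<in> carrier R" using fK Kc i(1) by (meson nth_mem subset_iff)
    have "([(n - i)] \<cdot> \<one>) \<otimes> (?f ! i) = \<zero>"
      using der[OF \<open>i < n\<close>] c by (simp add: add_pow_ldistr)
    moreover have "[(n - i)] \<cdot> \<one> \<noteq> \<zero>" using char i(2) len by simp
    ultimately show ?thesis using c integral by auto
  qed
  obtain g where g: "set g \<subseteq> set ?f" "length g = (length ?f + l - 1) div l"
    "eval ?f x = eval g (x [^] l)" "g \<noteq> []" "hd g = hd ?f"
    using sparse_eval[OF x _ _ sparse, of l] fK Kc fne ldn l2 len by auto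
  define m where "m = n div l"
  have nm: "n = l * m" using ldn by (simp add: m_def)
  have "m > 0" using n nm by (cases m) auto
  have lg: "length g = Suc m"
    unfolding g(2) len using nm l2 by simp
  \<comment> \<open>With n = l m, l at least 2 and m positive, g has m + 1 coefficients and m + 1
    does not exceed n; hence its relation involves only powers listed in
    \<open>exp_base z n\<close>.\<close>
  have le: "length g \<le> n"
  proof -
    have "Suc m \<le> 2 * m" using \<open>m > 0\<close> by simp
    also have "\<dots> \<le> n" unfolding nm using l2 by simp
    finally show ?thesis using lg by simp
  qed
  define z where "z = x [^] l"
  have zc: "z \<in> carrier R" using x by (simp add: z_def)
  have dep: "\<not> independent K (exp_base z n)"
  proof
    assume ind: "independent K (exp_base z n)"
    have "[0..<n] = [0..<length g] @ [length g..<n]" using le by (metis le0 upt_add_eq_append le_add_diff_inverse)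
    then have "exp_base z n = map (\<lambda>i. z [^] i) (rev [length g..<n]) @ exp_base z (length g)"
      by (simp add: exp_base_def)
    with ind have ind': "independent K (exp_base z (length g))"
      using independent_split(1)[OF K] by simp
    have "combine g (exp_base z (length g)) = \<zero>"
      using combine_eq_eval g(3) Irr(4) by (simp add: z_def)
    then have "set (take (length (exp_base z (length g))) g) \<subseteq> {\<zero>}"
      using g(1) fK by (intro independent_imp_trivial_combine[OF K ind']) auto
    then have "hd g = \<zero>" using g(4) by (cases g) (auto simp: exp_base_def)
    then show False using g(5) Irr(3) by simp
  qed
  obtain N where N: "dimension N K (carrier R)" using fin by auto
  have indx: "independent K (exp_base x n)"
    unfolding n_def by (rule exp_base_independent[OF K x alg])
  \<comment> \<open>The powers of x stand at the end of the basis, so that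
    \<open>independent_split\<close> can isolate their l-th powers, which are the powers of
    z.\<close>
  obtain Ws where Ws: "length (Ws @ exp_base x n) = N" "independent K (Ws @ exp_base x n)"
      "Span K (Ws @ exp_base x n) = carrier R"
    using complete_base[OF K N indx] exp_base_closed[OF x] by blast
  define Us where "Us = Ws @ exp_base x n"
  have Us: "set Us \<subseteq> carrier R" "Span K Us = carrier R"
    using independent_in_carrier[OF Ws(2)] Ws(3) by (simp_all add: Us_def)
  define F where "F = Span K (map (\<lambda>u. u [^] l) Us)"
  have "F \<noteq> carrier R"
  proof
    assume eq: "F = carrier R"
    have "independent K (map (\<lambda>u. u [^] l) Us)"
      using N Ws(1) Us(1) eq unfolding F_def by (intro spanning_imp_independent[OF K]) (auto simp: Us_def)
    then have "independent K (map (\<lambda>u. u [^] l) (exp_base x n))"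
      using independent_split(1)[OF K] by (simp add: Us_def)
    moreover have "map (\<lambda>u. u [^] l) (exp_base x n) = exp_base z n"
      using x by (simp add: exp_base_def z_def nat_pow_pow mult.commute)
    ultimately show False using dep by simp
  qed
  with l frobenius_span[OF l K Us, folded F_def] show ?thesis
    using that[of l F] by blast
qed

text \<open>Among the finite sets generating the field over F one of least size is chosen; y is one
  of its elements and E is generated by the others. Leastness keeps E proper, which excludes y from
  E.\<close>

lemma maximal_subfield_tower:
  assumes l: "Factorial_Ring.prime (l::nat)" and K: "subfield K R" and fin: "finite_dimension K (carrier R)"
    and F: "subring F R" "K \<subseteq> F" "\<And>z. z \<in> carrier R \<Longrightarrow> z [^] l \<in> F" "F \<noteq> carrier R"
  obtains E y where "subfield E R" "F \<subseteq> E" "y \<in> carrier R" "y \<notin> E"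
    "generate_ring R (insert y E) = carrier R"
proof -
  note Fc = subringE(1)[OF F(1)]
  define gen where "gen A \<longleftrightarrow> finite A \<and> A \<subseteq> carrier R \<and> generate_ring R (F \<union> A) = carrier R" for A
  obtain N Us where Us: "set Us \<subseteq> carrier R" "Span K Us = carrier R"
    using fin exists_base[OF K] by blast
  have G: "subring (generate_ring R (F \<union> A)) R" "F \<union> A \<subseteq> generate_ring R (F \<union> A)"
    if "A \<subseteq> carrier R" for A
    using that Fc generate_ring_is_subring[of "F \<union> A"] by (auto intro: generate_ring.incl)
  have "carrier R \<subseteq> generate_ring R (F \<union> set Us)"
  proof -
    note G' = G[OF Us(1)]
    have "subgroup (generate_ring R (F \<union> set Us)) (add_monoid R)"
      using G'(1) by (rule subring.axioms)
    moreover have "K <#> set Us \<subseteq> generate_ring R (F \<union> set Us)"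
      using G' F(2) subringE(6)[OF G'(1)] unfolding set_mult_def by blast
    ultimately have "Span K Us \<subseteq> generate_ring R (F \<union> set Us)"
      by (rule Span_min[OF K Us(1)])
    then show ?thesis using Us(2) by simp
  qed
  then have "gen (set Us)"
    unfolding gen_def using Us(1) subringE(1)[OF G(1)[OF Us(1)]] by auto
  then obtain A where A: "gen A" and min: "\<And>B. gen B \<Longrightarrow> card A \<le> card B"
    using ex_has_least_nat[of gen "set Us" card] by blast
  have "A \<noteq> {}"
  proof
    assume "A = {}"
    then have "generate_ring R F = carrier R" using A by (simp add: gen_def)
    then show False using generate_ring_min_subring1[OF Fc F(1)] F(4) Fc by blast
  qed
  then obtain y where y: "y \<in> A" by blast
  have Ac: "A \<subseteq> carrier R" "finite A" using A by (auto simp: gen_def)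
  define E where "E = generate_ring R (F \<union> (A - {y}))"
  have E: "subring E R" "F \<union> (A - {y}) \<subseteq> E"
    unfolding E_def using G[of "A - {y}"] Ac by auto
  have "E \<noteq> carrier R"
  proof
    assume "E = carrier R"
    then have "gen (A - {y})" using Ac by (auto simp: gen_def E_def)
    then show False using min[of "A - {y}"] card_Diff1_less[OF Ac(2) y] by simp
  qed
  have yc: "y \<in> carrier R" using y Ac by blast
  have genE: "generate_ring R (insert y E) = carrier R"
  proof
    have c: "insert y E \<subseteq> carrier R" using yc subringE(1)[OF E(1)] by blast
    show "generate_ring R (insert y E) \<subseteq> carrier R" by (rule generate_ring_incl[OF c])
    have "F \<union> A \<subseteq> insert y E" using E(2) y by blast
    from mono_generate_ring[OF this c] show "carrier R \<subseteq> generate_ring R (insert y E)"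
      using A by (simp add: gen_def)
  qed
  have "y \<notin> E"
  proof
    assume "y \<in> E"
    then have "insert y E = E" by blast
    then have "generate_ring R E = carrier R" using genE by simp
    then show False
      using generate_ring_min_subring1[OF subringE(1)[OF E(1)] E(1)] \<open>E \<noteq> carrier R\<close> subringE(1)[OF E(1)] by blast
  qed
  moreover have "subfield E R"
  proof (rule subfieldI'[OF E(1)])
    fix k assume k: "k \<in> E - {\<zero>}"
    then have kc: "k \<in> carrier R" "k \<noteq> \<zero>" using subringE(1)[OF E(1)] by auto
    then have ik: "inv k \<in> carrier R" "k \<otimes> inv k = \<one>" using field_Units by auto
    have kpow: "k [^] (m::nat) \<in> E" for m
      using k subringE(3,6)[OF E(1)] by (induction m) auto
    \<comment> \<open>The inverse of k is the product of \<open>k [^] m\<close> and the l-th power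
      of \<open>inv k\<close>; both lie in E because E is a ring containing all l-th powers.\<close>
    obtain m where m: "l = Suc m" using l by (metis not0_implies_Suc not_prime_0)
    have "k [^] m \<otimes> inv k [^] m = \<one>"
      using nat_pow_distrib[OF kc(1) ik(1), of m] ik(2) by simp
    then have "k [^] m \<otimes> inv k [^] l = inv k"
      unfolding m using kc ik by (simp add: m_assoc[symmetric])
    moreover have "inv k [^] l \<in> E" using F(3)[OF ik(1)] E(2) by blast
    ultimately show "inv k \<in> E" using subringE(6)[OF E(1) kpow] by metis
  qed
  ultimately show ?thesis using that[of E y] E(2) yc genE by blast
qed

text \<open>The coordinate along y in an E-basis containing y and \<open>\<one>\<close>, which are
  independent as y is outside E. It will separate \<open>y \<otimes> \<one>\<close> from
  \<open>\<one> \<otimes> y\<close> in the tensor square over E.\<close>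

lemma exists_linear_functional:
  assumes E: "subfield E R" and fin: "finite_dimension E (carrier R)" and y: "y \<in> carrier R" "y \<notin> E"
  obtains \<psi> where "\<And>z. z \<in> carrier R \<Longrightarrow> \<psi> z \<in> carrier R"
    "\<And>z w. z \<in> carrier R \<Longrightarrow> w \<in> carrier R \<Longrightarrow> \<psi> (z \<oplus> w) = \<psi> z \<oplus> \<psi> w"
    "\<And>e z. e \<in> E \<Longrightarrow> z \<in> carrier R \<Longrightarrow> \<psi> (e \<otimes> z) = e \<otimes> \<psi> z"
    "\<psi> \<one> = \<zero>" "\<psi> y = \<one>"
proof -
  note Es = subfieldE(1)[OF E] and Ec = subfieldE(3)[OF E]
  have "Span E [\<one>] = E"
    using line_extension_mem_iff[of _ E \<one> "{\<zero>}"] Ec by (auto simp add: rev_subsetD)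
  then have "independent E [y, \<one>]"
    using y by (intro li_Cons) (auto simp del: Span.simps, auto)
  moreover obtain N where N: "dimension N E (carrier R)" using fin by auto
  ultimately obtain Vs where Vs: "independent E (Vs @ [y, \<one>])" "Span E (Vs @ [y, \<one>]) = carrier R"
    using complete_base[OF E N, of "[y, \<one>]"] y by auto
  define Us where "Us = Vs @ [y, \<one>]"
  have Us: "set Us \<subseteq> carrier R" "independent E Us"
    using independent_in_carrier[OF Vs(1)] Vs(1) by (simp_all add: Us_def)
  define co where "co z = (THE Ks. set Ks \<subseteq> E \<and> length Ks = length Us \<and> z = combine Ks Us)" for z
  have ex1: "\<exists>!Ks. set Ks \<subseteq> E \<and> length Ks = length Us \<and> z = combine Ks Us" if "z \<in> carrier R" for z
    using unique_decomposition[OF E Us(2)] that Vs(2) unfolding Us_def by blast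
  have co: "set (co z) \<subseteq> E" "length (co z) = length Us" "z = combine (co z) Us" if "z \<in> carrier R" for z
    using theI'[OF ex1[OF that]] unfolding co_def by auto
  have coI: "co (combine Ks Us) = Ks" if "set Ks \<subseteq> E" "length Ks = length Us" for Ks
  proof -
    have "combine Ks Us \<in> carrier R" using that Ec Us by (intro combine_in_carrier) auto
    from ex1[OF this] that show ?thesis unfolding co_def by (intro the1_equality) auto
  qed
  \<comment> \<open>The basis list is \<open>Vs @ [y, \<one>]\<close>, so the coordinate of y has
    index \<open>length Vs\<close>.\<close>
  define \<psi> where "\<psi> z = co z ! length Vs" for z
  have lenU: "length Vs < length Us" by (simp add: Us_def)
  show ?thesis
  proof (rule that[of \<psi>])
    show "\<psi> z \<in> carrier R" if "z \<in> carrier R" for z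
      using co[OF that] Ec lenU unfolding \<psi>_def by (metis nth_mem subsetD)
    show "\<psi> (z \<oplus> w) = \<psi> z \<oplus> \<psi> w" if zw: "z \<in> carrier R" "w \<in> carrier R" for z w
    proof -
      note z = co[OF zw(1)] and w = co[OF zw(2)]
      have "z \<oplus> w = combine (map2 (\<oplus>) (co z) (co w)) Us"
        using z w Ec Us(1) combine_add[of "co z" Us "co w"] by auto
      moreover have "set (map2 (\<oplus>) (co z) (co w)) \<subseteq> E"
      proof
        fix v assume "v \<in> set (map2 (\<oplus>) (co z) (co w))"
        then obtain a b where ab: "(a, b) \<in> set (zip (co z) (co w))" "v = a \<oplus> b" by auto
        have "a \<in> E" "b \<in> E"
          using z(1) w(1) set_zip_leftD[OF ab(1)] set_zip_rightD[OF ab(1)] by auto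
        then show "v \<in> E" using subringE(7)[OF Es] ab(2) by simp
      qed
      ultimately have "co (z \<oplus> w) = map2 (\<oplus>) (co z) (co w)"
        using coI[of "map2 (\<oplus>) (co z) (co w)"] z(2) w(2) by simp
      then show ?thesis using z(2) w(2) lenU by (simp add: \<psi>_def)
    qed
    show "\<psi> (e \<otimes> z) = e \<otimes> \<psi> z" if ez: "e \<in> E" "z \<in> carrier R" for e z
    proof -
      note z = co[OF ez(2)]
      have "e \<otimes> z = combine (map ((\<otimes>) e) (co z)) Us"
        using combine_r_distr[of "co z" Us e] z Ec Us(1) ez(1) by auto
      moreover have "set (map ((\<otimes>) e) (co z)) \<subseteq> E"
        using z(1) ez(1) subringE(6)[OF Es] by auto
      ultimately have "co (e \<otimes> z) = map ((\<otimes>) e) (co z)"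
        using coI[of "map ((\<otimes>) e) (co z)"] z(2) by simp
      then show ?thesis using z(2) lenU by (simp add: \<psi>_def)
    qed
    have rep: "combine (replicate (length Vs) \<zero> @ Ks) Us = combine Ks [y, \<one>]"
      if "set Ks \<subseteq> carrier R" for Ks
      using combine_prepend_replicate[of Ks Us "length Vs"] that Us(1) by (simp add: Us_def)
    have E01: "\<zero> \<in> E" "\<one> \<in> E" using subringE(2,3)[OF Es] by auto
    then have rep0: "set (replicate (length Vs) \<zero>) \<subseteq> E" by (simp add: set_replicate_conv_if)
    have "combine (replicate (length Vs) \<zero> @ [\<zero>, \<one>]) Us = \<one>"
      using rep[of "[\<zero>, \<one>]"] y by simp
    then have "co \<one> = replicate (length Vs) \<zero> @ [\<zero>, \<one>]"
      using coI[of "replicate (length Vs) \<zero> @ [\<zero>, \<one>]"] E01 rep0 by (auto simp: Us_def)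
    then show "\<psi> \<one> = \<zero>" by (simp add: \<psi>_def nth_append)
    have "combine (replicate (length Vs) \<zero> @ [\<one>, \<zero>]) Us = y"
      using rep[of "[\<one>, \<zero>]"] y by simp
    then have "co y = replicate (length Vs) \<zero> @ [\<one>, \<zero>]"
      using coI[of "replicate (length Vs) \<zero> @ [\<one>, \<zero>]"] E01 rep0 by (auto simp: Us_def)
    then show "\<psi> y = \<one>" by (simp add: \<psi>_def nth_append)
  qed
qed

end

lemma ring_hom_add_pow:
  assumes "ring A" "ring B" "h \<in> ring_hom A B" "a \<in> carrier A"
  shows "h ([(n::nat)] \<cdot>\<^bsub>A\<^esub> a) = [n] \<cdot>\<^bsub>B\<^esub> h a"
proof -
  interpret A: ring A by fact
  interpret h: ring_hom_ring A B h by (rule ring_hom_ringI2) (use assms in auto)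
  show ?thesis using assms(4) by (induction n) auto
qed

text \<open>Iterating the equation gives a = c^m a^(m+1) for every m, and the right side vanishes at
  m = n.\<close>

lemma (in cring) eq_mult_square_imp_zero:
  assumes "a \<in> carrier R" "c \<in> carrier R" "a = c \<otimes> (a \<otimes> a)" "a [^] (n::nat) = \<zero>"
  shows "a = \<zero>"
proof -
  have "a = c [^] m \<otimes> (a [^] m \<otimes> a)" for m :: nat
  proof (induction m)
    case (Suc m)
    have "c [^] Suc m \<otimes> (a [^] Suc m \<otimes> a) = c [^] m \<otimes> (a [^] m \<otimes> (c \<otimes> (a \<otimes> a)))"
      using assms(1,2) by (simp add: m_ac)
    also have "\<dots> = a" using assms(3) Suc.IH by simp
    finally show ?case by simp
  qed (use assms in simp)
  from this[of n] assms show ?thesis by simp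
qed

theorem trivial_kaehler_imp_separable:
  assumes L: "field L" and K: "subfield K L" and fin: "ring.finite_dimension L K (carrier L)"
    and triv: "trivial_group (kaehler_differentials L K)"
  shows "separable_extension L K"
proof -
  interpret L: field L by fact
  note Ks = subfieldE(1)[OF K] and Kc = subfieldE(3)[OF K]
  interpret LK: algebra_over L K
    by (intro algebra_over.intro algebra_over_axioms.intro L.is_cring Kc)
  have "separable_poly L K (L.Irr K x)" if x: "x \<in> carrier L" for x
  proof (rule ccontr)
    assume "\<not> separable_poly L K (L.Irr K x)"
    then obtain l F where l: "Factorial_Ring.prime (l::nat)" "[l] \<cdot>\<^bsub>L\<^esub> \<one>\<^bsub>L\<^esub> = \<zero>\<^bsub>L\<^esub>"
      and F: "subring F L" "K \<subseteq> F" "\<And>z. z \<in> carrier L \<Longrightarrow> z [^]\<^bsub>L\<^esub> l \<in> F" "F \<noteq> carrier L"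
      using L.inseparable_imp_proper[OF K fin x] by blast
    obtain E y where E: "subfield E L" "F \<subseteq> E" and y: "y \<in> carrier L" "y \<notin> E"
      and gen: "generate_ring L (insert y E) = carrier L"
      using L.maximal_subfield_tower[OF l(1) K fin F] by blast
    have KE: "K \<subseteq> E" and Ec: "E \<subseteq> carrier L" using F E subfieldE(3) by auto
    have "L.finite_dimension E (carrier L)"
    proof -
      obtain Us where Us: "set Us \<subseteq> carrier L" "L.Span K Us = carrier L"
        using fin L.exists_base[OF K] by blast
      have "L.Span K Us \<subseteq> L.Span E Us"
      proof (rule L.Span_min[OF K Us(1) L.Span_is_add_subgroup[OF E(1) Us(1)]])
        have "K <#>\<^bsub>L\<^esub> set Us \<subseteq> E <#>\<^bsub>L\<^esub> set Us" using KE by (auto simp: set_mult_def)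
        then show "K <#>\<^bsub>L\<^esub> set Us \<subseteq> L.Span E Us" using L.Span_incl[OF E(1) Us(1)] by blast
      qed
      then have "L.Span E Us = carrier L"
        using Us(2) L.Span_in_carrier[OF Ec Us(1)] by blast
      then show ?thesis using L.Span_finite_dimension[OF E(1) Us(1)] by simp
    qed
    then obtain \<psi> where \<psi>: "\<And>z. z \<in> carrier L \<Longrightarrow> \<psi> z \<in> carrier L"
      "\<And>z w. z \<in> carrier L \<Longrightarrow> w \<in> carrier L \<Longrightarrow> \<psi> (z \<oplus>\<^bsub>L\<^esub> w) = \<psi> z \<oplus>\<^bsub>L\<^esub> \<psi> w"
      "\<And>e z. e \<in> E \<Longrightarrow> z \<in> carrier L \<Longrightarrow> \<psi> (e \<otimes>\<^bsub>L\<^esub> z) = e \<otimes>\<^bsub>L\<^esub> \<psi> z"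
      "\<psi> \<one>\<^bsub>L\<^esub> = \<zero>\<^bsub>L\<^esub>" "\<psi> y = \<one>\<^bsub>L\<^esub>"
      using L.exists_linear_functional[OF E(1) _ y] by metis
    interpret LE: algebra_over L E
      by (intro algebra_over.intro algebra_over_axioms.intro L.is_cring Ec)
    let ?TS = "tensor_square L E" and ?\<eta> = "LE.delta y"
    let ?I = "PIdl\<^bsub>?TS\<^esub> ?\<eta>" and ?J = "PIdl\<^bsub>?TS\<^esub> (?\<eta> \<otimes>\<^bsub>?TS\<^esub> ?\<eta>)"
    have \<eta>: "?\<eta> \<in> carrier ?TS" using y by simp
    have I: "ideal ?I ?TS" by (rule LE.TS.cgenideal_ideal[OF \<eta>])
    have J: "ideal ?J ?TS" using \<eta> by (intro LE.TS.cgenideal_ideal) auto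
    \<comment> \<open>Modulo \<open>\<eta>\<close> the two coordinate maps agree on E and at y,
      hence on L = E[y]; so every difference is a multiple of \<open>\<eta>\<close>.\<close>
    have delta_I: "LE.delta z \<in> ?I" if z: "z \<in> carrier L" for z
    proof -
      let ?\<alpha> = "\<lambda>t. ?I +>\<^bsub>?TS\<^esub> tensor L E t \<one>\<^bsub>L\<^esub>" and ?\<beta> = "\<lambda>t. ?I +>\<^bsub>?TS\<^esub> tensor L E \<one>\<^bsub>L\<^esub> t"
      let ?S = "{t \<in> carrier L. ?\<alpha> t = ?\<beta> t}"
      have hom: "?\<alpha> \<in> ring_hom L (?TS Quot ?I)" "?\<beta> \<in> ring_hom L (?TS Quot ?I)"
        using ring_hom_trans[OF LE.tensor_left_hom ideal.rcos_ring_hom[OF I]]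
          ring_hom_trans[OF LE.tensor_right_hom ideal.rcos_ring_hom[OF I]] by (simp_all add: comp_def)
      have S: "subring ?S L"
        by (rule equalizer_is_subring[OF L.ring_axioms ideal.quotient_is_ring[OF I] hom])
      have "y \<in> ?S"
        using y(1) LE.delta_in_ideal_iff[OF I y(1)] LE.TS.cgenideal_self[OF \<eta>] by simp
      moreover have "E \<subseteq> ?S"
        using Ec LE.tensor_left_eq_right by auto
      ultimately have "insert y E \<subseteq> ?S" by blast
      then have "carrier L \<subseteq> ?S"
        using L.generate_ring_min_subring1[OF _ S] y(1) Ec unfolding gen[symmetric] by blast
      then show ?thesis using z LE.delta_in_ideal_iff[OF I z] by blast
    qed
    have prod_J: "LE.delta s \<otimes>\<^bsub>?TS\<^esub> LE.delta t \<in> ?J" if st: "s \<in> carrier L" "t \<in> carrier L" for s t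
    proof -
      obtain a b where ab: "a \<in> carrier ?TS" "b \<in> carrier ?TS"
        "LE.delta s = a \<otimes>\<^bsub>?TS\<^esub> ?\<eta>" "LE.delta t = b \<otimes>\<^bsub>?TS\<^esub> ?\<eta>"
        using delta_I[OF st(1)] delta_I[OF st(2)] unfolding cgenideal_def by blast
      have "LE.delta s \<otimes>\<^bsub>?TS\<^esub> LE.delta t = (a \<otimes>\<^bsub>?TS\<^esub> b) \<otimes>\<^bsub>?TS\<^esub> (?\<eta> \<otimes>\<^bsub>?TS\<^esub> ?\<eta>)"
        unfolding ab(3,4) using ab(1,2) \<eta> by (simp add: LE.TS.m_ac)
      then show ?thesis
        unfolding cgenideal_def using ab(1,2) by blast
    qed
    \<comment> \<open>All products of differences lie in \<open>?J\<close>, so modulo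
      \<open>?J\<close> the coordinate maps are infinitely near over E and a fortiori over K. The
      vanishing of the differentials over K makes them coincide.\<close>
    have "LE.delta y \<in> ?J"
    proof -
      note near = infinitely_near_mono[OF LE.infinitely_near_quotient[OF J prod_J] KE]
      show ?thesis
        unfolding LE.delta_in_ideal_iff[OF J y(1)]
        by (rule LK.trivial_kaehler_imp_eq[OF triv near y(1)])
    qed
    then obtain c where c: "c \<in> carrier ?TS" "?\<eta> = c \<otimes>\<^bsub>?TS\<^esub> (?\<eta> \<otimes>\<^bsub>?TS\<^esub> ?\<eta>)"
      unfolding cgenideal_def by blast
    \<comment> \<open>Frobenius turns the l-th power into the difference formed with y^l in place of
      y, which is zero because y^l lies in E.\<close>
    have "?\<eta> [^]\<^bsub>?TS\<^esub> l = \<zero>\<^bsub>?TS\<^esub>"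
    proof -
      let ?a = "tensor L E y \<one>\<^bsub>L\<^esub>" and ?b = "tensor L E \<one>\<^bsub>L\<^esub> y"
      have ab: "?a \<in> carrier ?TS" "?b \<in> carrier ?TS" using y by auto
      have "[l] \<cdot>\<^bsub>?TS\<^esub> \<one>\<^bsub>?TS\<^esub> = tensor L E ([l] \<cdot>\<^bsub>L\<^esub> \<one>\<^bsub>L\<^esub>) \<one>\<^bsub>L\<^esub>"
        using ring_hom_add_pow[OF L.ring_axioms LE.TS.ring_axioms LE.tensor_left_hom, of "\<one>\<^bsub>L\<^esub>" l]
        by (simp add: LE.tensor_one)
      then have lTS: "[l] \<cdot>\<^bsub>?TS\<^esub> \<one>\<^bsub>?TS\<^esub> = \<zero>\<^bsub>?TS\<^esub>"
        using l(2) ring_hom_zero[OF LE.tensor_left_hom L.ring_axioms LE.TS.ring_axioms] by simp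
      have "?b = ?\<eta> \<oplus>\<^bsub>?TS\<^esub> ?a"
        unfolding LE.delta_def using ab by algebra
      then have "?b [^]\<^bsub>?TS\<^esub> l = ?\<eta> [^]\<^bsub>?TS\<^esub> l \<oplus>\<^bsub>?TS\<^esub> ?a [^]\<^bsub>?TS\<^esub> l"
        using LE.TS.frobenius_add[OF l(1) lTS \<eta> ab(1)] by simp
      moreover have "?b [^]\<^bsub>?TS\<^esub> l = tensor L E \<one>\<^bsub>L\<^esub> (y [^]\<^bsub>L\<^esub> l)"
        using ring_hom_ring.hom_nat_pow[OF ring_hom_ringI2[OF L.ring_axioms LE.TS.ring_axioms LE.tensor_right_hom] y(1), of l] by simp
      moreover have "?a [^]\<^bsub>?TS\<^esub> l = tensor L E (y [^]\<^bsub>L\<^esub> l) \<one>\<^bsub>L\<^esub>"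
        using ring_hom_ring.hom_nat_pow[OF ring_hom_ringI2[OF L.ring_axioms LE.TS.ring_axioms LE.tensor_left_hom] y(1), of l] by simp
      moreover have "y [^]\<^bsub>L\<^esub> l \<in> E" using F(3)[OF y(1)] E(2) by blast
      ultimately have "?a [^]\<^bsub>?TS\<^esub> l = ?\<eta> [^]\<^bsub>?TS\<^esub> l \<oplus>\<^bsub>?TS\<^esub> ?a [^]\<^bsub>?TS\<^esub> l"
        using LE.tensor_left_eq_right by simp
      then show ?thesis
        using LE.TS.add.r_cancel_one'[of "?a [^]\<^bsub>?TS\<^esub> l" "?\<eta> [^]\<^bsub>?TS\<^esub> l"] \<eta> ab by simp
    qed
    then have "?\<eta> = \<zero>\<^bsub>?TS\<^esub>"
      by (rule LE.TS.eq_mult_square_imp_zero[OF \<eta> c])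
    then have eq: "tensor L E \<one>\<^bsub>L\<^esub> y = tensor L E y \<one>\<^bsub>L\<^esub>"
      using y(1) by (simp add: LE.delta_def)
    \<comment> \<open>By E-linearity \<open>\<psi>\<close> extends to the tensor square; the
      extension sends \<open>\<one> \<otimes> y\<close> to zero and
      \<open>y \<otimes> \<one>\<close> to one, although the two tensors have just been shown
      equal.\<close>
    have lift: "tensor_lift L (\<lambda>a b. \<psi> a \<otimes>\<^bsub>L\<^esub> b) (tensor L E a b) = \<psi> a \<otimes>\<^bsub>L\<^esub> b"
      if "a \<in> carrier L" "b \<in> carrier L" for a b
    proof (rule LE.tensor_lift(3)[OF L.abelian_group_axioms _ _ _ _ that])
      fix r a b assume r: "r \<in> E" and ab: "a \<in> carrier L" "b \<in> carrier L"
      then have "r \<in> carrier L" "\<psi> a \<in> carrier L" using Ec \<psi>(1) by auto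
      then show "\<psi> (r \<otimes>\<^bsub>L\<^esub> a) \<otimes>\<^bsub>L\<^esub> b = \<psi> a \<otimes>\<^bsub>L\<^esub> (r \<otimes>\<^bsub>L\<^esub> b)"
        unfolding \<psi>(3)[OF r ab(1)] using ab(2) by (simp add: L.m_ac)
    qed (use \<psi>(1,2) in \<open>auto simp: L.l_distr L.r_distr\<close>)
    from lift[of "\<one>\<^bsub>L\<^esub>" y] lift[of y "\<one>\<^bsub>L\<^esub>"] have "\<one>\<^bsub>L\<^esub> = \<zero>\<^bsub>L\<^esub>"
      using y(1) \<psi>(4,5) unfolding eq by simp
    then show False using L.one_not_zero by simp
  qed
  moreover have "\<not> L.transcendental K x" if "x \<in> carrier L" for x
    using L.finite_dimension_imp_algebraic[OF K L.carrier_is_subring fin that] by (simp add: over_def)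
  ultimately show ?thesis
    unfolding separable_extension_def by blast
qed


section \<open>Fraction fields\<close>

text \<open>Operations on classes are written as unions over representatives; such a union is the
  common value once independence of the representatives is known.\<close>

lemma UN_eq_const: "Z \<noteq> {} \<Longrightarrow> (\<And>z. z \<in> Z \<Longrightarrow> f z = c) \<Longrightarrow> (\<Union>z\<in>Z. f z) = c"
  by auto

context domain begin

abbreviation "nonzero \<equiv> carrier R - {\<zero>}"

lemma frac_rel_iff:
  "((a, b), (c, d)) \<in> frac_rel R \<longleftrightarrow>
    a \<in> carrier R \<and> b \<in> nonzero \<and> c \<in> carrier R \<and> d \<in> nonzero \<and> a \<otimes> d = c \<otimes> b"
  by (simp add: frac_rel_def)

lemma frac_rel_trans:
  assumes "((a, b), (c, d)) \<in> frac_rel R" "((c, d), (e, f)) \<in> frac_rel R"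
  shows "((a, b), (e, f)) \<in> frac_rel R"
proof -
  have c: "a \<in> carrier R" "b \<in> carrier R" "c \<in> carrier R" "d \<in> carrier R" "d \<noteq> \<zero>" "e \<in> carrier R"
    "f \<in> carrier R" and 1: "a \<otimes> d = c \<otimes> b" and 2: "c \<otimes> f = e \<otimes> d"
    using assms by (auto simp: frac_rel_iff)
  have "(a \<otimes> f) \<otimes> d = (a \<otimes> d) \<otimes> f" using c by (simp add: m_ac)
  also have "\<dots> = (c \<otimes> f) \<otimes> b" unfolding 1 using c by (simp add: m_ac)
  also have "\<dots> = (e \<otimes> b) \<otimes> d" unfolding 2 using c by (simp add: m_ac)
  finally have "a \<otimes> f = e \<otimes> b" using c m_rcancel[of d "a \<otimes> f" "e \<otimes> b"] by simp
  then show ?thesis using assms by (auto simp: frac_rel_iff)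
qed

lemma equiv_frac_rel: "equiv (carrier R \<times> nonzero) (frac_rel R)"
proof (rule equivI)
  show "frac_rel R \<subseteq> (carrier R \<times> nonzero) \<times> (carrier R \<times> nonzero)"
    by (auto simp: frac_rel_def)
  show "refl_on (carrier R \<times> nonzero) (frac_rel R)"
    by (auto simp: refl_on_def frac_rel_def)
  show "sym (frac_rel R)" by (auto simp: sym_def frac_rel_def)
  show "trans (frac_rel R)"
    unfolding trans_def using frac_rel_trans by fast
qed

lemma fraction_eq_iff:
  assumes "a \<in> carrier R" "b \<in> nonzero" "c \<in> carrier R" "d \<in> nonzero"
  shows "fraction R a b = fraction R c d \<longleftrightarrow> a \<otimes> d = c \<otimes> b"
  unfolding fraction_def
  using eq_equiv_class_iff[OF equiv_frac_rel, of "(a, b)" "(c, d)"] assms by (simp add: frac_rel_iff)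

lemma mem_fraction_iff:
  assumes "a \<in> carrier R" "b \<in> nonzero"
  shows "(c, d) \<in> fraction R a b \<longleftrightarrow> c \<in> carrier R \<and> d \<in> nonzero \<and> a \<otimes> d = c \<otimes> b"
  using assms by (simp add: fraction_def frac_rel_iff)

lemma fraction_nonempty: "a \<in> carrier R \<Longrightarrow> b \<in> nonzero \<Longrightarrow> fraction R a b \<noteq> {}"
  using mem_fraction_iff by blast

abbreviation "FF \<equiv> fraction_field R"

lemma fraction_field_simps:
  "carrier FF = (carrier R \<times> nonzero) // frac_rel R"
  "\<one>\<^bsub>FF\<^esub> = fraction R \<one> \<one>" "\<zero>\<^bsub>FF\<^esub> = fraction R \<zero> \<one>"
  by (simp_all add: fraction_field_def)

lemma fraction_closed: "a \<in> carrier R \<Longrightarrow> b \<in> nonzero \<Longrightarrow> fraction R a b \<in> carrier FF"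
  unfolding fraction_field_simps fraction_def by (intro quotientI) simp

lemma fraction_cases:
  assumes "z \<in> carrier FF"
  obtains a b where "a \<in> carrier R" "b \<in> nonzero" "z = fraction R a b"
  using assms unfolding fraction_field_simps fraction_def by (elim quotientE) auto

lemma nonzero_mult: "b \<in> nonzero \<Longrightarrow> d \<in> nonzero \<Longrightarrow> b \<otimes> d \<in> nonzero"
  using integral by auto

lemma fraction_mult:
  assumes a: "a \<in> carrier R" "b \<in> nonzero" and c: "c \<in> carrier R" "d \<in> nonzero"
  shows "fraction R a b \<otimes>\<^bsub>FF\<^esub> fraction R c d = fraction R (a \<otimes> c) (b \<otimes> d)"
proof -
  have "fraction R (a' \<otimes> c') (b' \<otimes> d') = fraction R (a \<otimes> c) (b \<otimes> d)"
    if "(a', b') \<in> fraction R a b" "(c', d') \<in> fraction R c d" for a' b' c' d'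
  proof -
    have 1: "a' \<in> carrier R" "b' \<in> nonzero" "a \<otimes> b' = a' \<otimes> b"
      and 2: "c' \<in> carrier R" "d' \<in> nonzero" "c \<otimes> d' = c' \<otimes> d"
      using that assms by (auto simp: mem_fraction_iff)
    have "(a' \<otimes> c') \<otimes> (b \<otimes> d) = (a' \<otimes> b) \<otimes> (c' \<otimes> d)"
      using 1(1) 2(1) a c by (simp add: m_ac)
    also have "\<dots> = (a \<otimes> c) \<otimes> (b' \<otimes> d')"
      unfolding 1(3)[symmetric] 2(3)[symmetric] using 1(2) 2(2) a c by (simp add: m_ac)
    finally show ?thesis
      using 1 2 a c nonzero_mult by (subst fraction_eq_iff) auto
  qed
  then show ?thesis
    unfolding fraction_field_def using fraction_nonempty[OF a] fraction_nonempty[OF c]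
    by (auto intro!: UN_eq_const simp: case_prod_unfold)
qed

lemma fraction_add:
  assumes a: "a \<in> carrier R" "b \<in> nonzero" and c: "c \<in> carrier R" "d \<in> nonzero"
  shows "fraction R a b \<oplus>\<^bsub>FF\<^esub> fraction R c d = fraction R (a \<otimes> d \<oplus> c \<otimes> b) (b \<otimes> d)"
proof -
  have "fraction R (a' \<otimes> d' \<oplus> c' \<otimes> b') (b' \<otimes> d') = fraction R (a \<otimes> d \<oplus> c \<otimes> b) (b \<otimes> d)"
    if "(a', b') \<in> fraction R a b" "(c', d') \<in> fraction R c d" for a' b' c' d'
  proof -
    have 1: "a' \<in> carrier R" "b' \<in> nonzero" "a \<otimes> b' = a' \<otimes> b"
      and 2: "c' \<in> carrier R" "d' \<in> nonzero" "c \<otimes> d' = c' \<otimes> d"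
      using that assms by (auto simp: mem_fraction_iff)
    have "(a' \<otimes> d' \<oplus> c' \<otimes> b') \<otimes> (b \<otimes> d) = (a' \<otimes> b) \<otimes> (d \<otimes> d') \<oplus> (c' \<otimes> d) \<otimes> (b \<otimes> b')"
      using 1(1,2) 2(1,2) a c by (simp add: l_distr r_distr m_ac)
    also have "\<dots> = (a \<otimes> d \<oplus> c \<otimes> b) \<otimes> (b' \<otimes> d')"
      unfolding 1(3)[symmetric] 2(3)[symmetric] using 1(2) 2(2) a c by (simp add: l_distr r_distr m_ac)
    finally show ?thesis
      using 1 2 a c nonzero_mult by (subst fraction_eq_iff) auto
  qed
  then show ?thesis
    unfolding fraction_field_def using fraction_nonempty[OF a] fraction_nonempty[OF c]
    by (auto intro!: UN_eq_const simp: case_prod_unfold)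
qed

lemma fraction_field_is_field: "field FF"
proof -
  have one: "\<one> \<in> nonzero" by simp
  note simps = fraction_mult fraction_add fraction_eq_iff nonzero_mult fraction_field_simps(2,3)
  have "cring FF"
  proof (rule cringI)
    show "abelian_group FF"
    proof (rule abelian_groupI)
      fix x assume "x \<in> carrier FF"
      then obtain a b where x: "a \<in> carrier R" "b \<in> nonzero" "x = fraction R a b" by (rule fraction_cases)
      then have bc: "b \<in> carrier R" by simp
      show "\<zero>\<^bsub>FF\<^esub> \<oplus>\<^bsub>FF\<^esub> x = x"
        using x bc one by (simp add: simps)
      show "\<exists>y\<in>carrier FF. y \<oplus>\<^bsub>FF\<^esub> x = \<zero>\<^bsub>FF\<^esub>"
      proof (rule bexI)
        show "fraction R (\<ominus> a) b \<in> carrier FF" using x by (intro fraction_closed) auto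
        have "\<ominus> a \<otimes> b \<oplus> a \<otimes> b = \<zero>" using x bc by (simp add: l_minus l_neg)
        then show "fraction R (\<ominus> a) b \<oplus>\<^bsub>FF\<^esub> x = \<zero>\<^bsub>FF\<^esub>"
          unfolding x(3) using x(1,2) bc nonzero_mult[OF x(2) x(2)] by (simp add: simps)
      qed
      fix y assume "y \<in> carrier FF"
      then obtain c d where y: "c \<in> carrier R" "d \<in> nonzero" "y = fraction R c d" by (rule fraction_cases)
      then have dc: "d \<in> carrier R" by simp
      show "x \<oplus>\<^bsub>FF\<^esub> y \<in> carrier FF"
        unfolding x y fraction_add[OF x(1,2) y(1,2)]
        using x y bc dc nonzero_mult[OF x(2) y(2)] by (intro fraction_closed) auto
      show "x \<oplus>\<^bsub>FF\<^esub> y = y \<oplus>\<^bsub>FF\<^esub> x"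
        unfolding x y fraction_add[OF x(1,2) y(1,2)] fraction_add[OF y(1,2) x(1,2)]
        using x y by (simp add: a_comm m_comm)
      fix z assume "z \<in> carrier FF"
      then obtain e f where z: "e \<in> carrier R" "f \<in> nonzero" "z = fraction R e f" by (rule fraction_cases)
      then have fc: "f \<in> carrier R" by simp
      show "x \<oplus>\<^bsub>FF\<^esub> y \<oplus>\<^bsub>FF\<^esub> z = x \<oplus>\<^bsub>FF\<^esub> (y \<oplus>\<^bsub>FF\<^esub> z)"
      proof -
        have l: "fraction R (a \<otimes> d \<oplus> c \<otimes> b) (b \<otimes> d) \<oplus>\<^bsub>FF\<^esub> fraction R e f
          = fraction R ((a \<otimes> d \<oplus> c \<otimes> b) \<otimes> f \<oplus> e \<otimes> (b \<otimes> d)) (b \<otimes> d \<otimes> f)"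
          using x y z bc dc nonzero_mult[OF x(2) y(2)] by (intro fraction_add) auto
        have r: "fraction R a b \<oplus>\<^bsub>FF\<^esub> fraction R (c \<otimes> f \<oplus> e \<otimes> d) (d \<otimes> f)
          = fraction R (a \<otimes> (d \<otimes> f) \<oplus> (c \<otimes> f \<oplus> e \<otimes> d) \<otimes> b) (b \<otimes> (d \<otimes> f))"
          using x y z dc fc nonzero_mult[OF y(2) z(2)] by (intro fraction_add) auto
        show ?thesis
          unfolding x(3) y(3) z(3) fraction_add[OF x(1,2) y(1,2)] fraction_add[OF y(1,2) z(1,2)] l r
          using x(1) y(1) z(1) bc dc fc by (simp add: l_distr r_distr m_ac a_ac)
      qed
    qed (use one in \<open>simp add: fraction_field_simps(3) fraction_closed\<close>)
    show "comm_monoid FF"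
    proof (rule comm_monoidI)
      fix x assume "x \<in> carrier FF"
      then obtain a b where x: "a \<in> carrier R" "b \<in> nonzero" "x = fraction R a b" by (rule fraction_cases)
      then have bc: "b \<in> carrier R" by simp
      show "\<one>\<^bsub>FF\<^esub> \<otimes>\<^bsub>FF\<^esub> x = x"
        using x bc one by (simp add: simps)
      fix y assume "y \<in> carrier FF"
      then obtain c d where y: "c \<in> carrier R" "d \<in> nonzero" "y = fraction R c d" by (rule fraction_cases)
      then have dc: "d \<in> carrier R" by simp
      show "x \<otimes>\<^bsub>FF\<^esub> y \<in> carrier FF"
        unfolding x y fraction_mult[OF x(1,2) y(1,2)]
        using x y bc dc nonzero_mult[OF x(2) y(2)] by (intro fraction_closed) auto
      show "x \<otimes>\<^bsub>FF\<^esub> y = y \<otimes>\<^bsub>FF\<^esub> x"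
        unfolding x y fraction_mult[OF x(1,2) y(1,2)] fraction_mult[OF y(1,2) x(1,2)]
        using x y by (simp add: m_comm)
      fix z assume "z \<in> carrier FF"
      then obtain e f where z: "e \<in> carrier R" "f \<in> nonzero" "z = fraction R e f" by (rule fraction_cases)
      then have fc: "f \<in> carrier R" by simp
      show "x \<otimes>\<^bsub>FF\<^esub> y \<otimes>\<^bsub>FF\<^esub> z = x \<otimes>\<^bsub>FF\<^esub> (y \<otimes>\<^bsub>FF\<^esub> z)"
        unfolding x(3) y(3) z(3)
        using x(1,2) y(1,2) z(1,2) nonzero_mult[OF x(2) y(2)] nonzero_mult[OF y(2) z(2)] bc dc fc
        by (simp add: fraction_mult m_assoc)
    qed (use one in \<open>simp add: fraction_field_simps(2) fraction_closed\<close>)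
    fix x y z assume xyz: "x \<in> carrier FF" "y \<in> carrier FF" "z \<in> carrier FF"
    obtain a b where x: "a \<in> carrier R" "b \<in> nonzero" "x = fraction R a b" using xyz(1) by (rule fraction_cases)
    obtain c d where y: "c \<in> carrier R" "d \<in> nonzero" "y = fraction R c d" using xyz(2) by (rule fraction_cases)
    obtain e f where z: "e \<in> carrier R" "f \<in> nonzero" "z = fraction R e f" using xyz(3) by (rule fraction_cases)
    have cc: "b \<in> carrier R" "d \<in> carrier R" "f \<in> carrier R" using x y z by auto
    have bd: "b \<otimes> d \<in> nonzero" and bf: "b \<otimes> f \<in> nonzero" and df: "d \<otimes> f \<in> nonzero"
      using x y z nonzero_mult by blast+
    have l: "fraction R (a \<otimes> d \<oplus> c \<otimes> b) (b \<otimes> d) \<otimes>\<^bsub>FF\<^esub> fraction R e f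
        = fraction R ((a \<otimes> d \<oplus> c \<otimes> b) \<otimes> e) (b \<otimes> d \<otimes> f)"
      using x y z cc bd by (intro fraction_mult) auto
    have r: "fraction R (a \<otimes> e) (b \<otimes> f) \<oplus>\<^bsub>FF\<^esub> fraction R (c \<otimes> e) (d \<otimes> f)
        = fraction R ((a \<otimes> e) \<otimes> (d \<otimes> f) \<oplus> (c \<otimes> e) \<otimes> (b \<otimes> f)) ((b \<otimes> f) \<otimes> (d \<otimes> f))"
      using x y z cc bf df by (intro fraction_add) auto
    show "(x \<oplus>\<^bsub>FF\<^esub> y) \<otimes>\<^bsub>FF\<^esub> z = x \<otimes>\<^bsub>FF\<^esub> z \<oplus>\<^bsub>FF\<^esub> y \<otimes>\<^bsub>FF\<^esub> z"
      unfolding x(3) y(3) z(3) fraction_add[OF x(1,2) y(1,2)] fraction_mult[OF x(1,2) z(1,2)]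
        fraction_mult[OF y(1,2) z(1,2)] l r
    proof (subst fraction_eq_iff)
      show "b \<otimes> d \<otimes> f \<in> nonzero" "(b \<otimes> f) \<otimes> (d \<otimes> f) \<in> nonzero"
        using bd bf df z(2) nonzero_mult by blast+
      show "(a \<otimes> d \<oplus> c \<otimes> b) \<otimes> e \<otimes> ((b \<otimes> f) \<otimes> (d \<otimes> f)) =
          ((a \<otimes> e) \<otimes> (d \<otimes> f) \<oplus> (c \<otimes> e) \<otimes> (b \<otimes> f)) \<otimes> (b \<otimes> d \<otimes> f)"
        using x(1) y(1) z(1) cc by (simp add: l_distr r_distr m_ac)
    qed (use x(1) y(1) z(1) cc in auto)
  qed
  then show ?thesis
  proof (rule cring.cring_fieldI2)
    show "\<zero>\<^bsub>FF\<^esub> \<noteq> \<one>\<^bsub>FF\<^esub>"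
      using one by (simp add: simps)
    fix x assume xF: "x \<in> carrier FF" and ne: "x \<noteq> \<zero>\<^bsub>FF\<^esub>"
    from xF obtain a b where x: "a \<in> carrier R" "b \<in> nonzero" "x = fraction R a b" by (rule fraction_cases)
    then have bc: "b \<in> carrier R" by simp
    from ne have "a \<noteq> \<zero>" using x bc one by (auto simp: simps)
    then have a: "a \<in> nonzero" using x by simp
    show "\<exists>y\<in>carrier FF. x \<otimes>\<^bsub>FF\<^esub> y = \<one>\<^bsub>FF\<^esub>"
    proof (rule bexI)
      show "fraction R b a \<in> carrier FF" using a bc by (intro fraction_closed) auto
      show "x \<otimes>\<^bsub>FF\<^esub> fraction R b a = \<one>\<^bsub>FF\<^esub>"
        unfolding x(3) fraction_mult[OF x(1,2) bc a] fraction_field_simps(2)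
        using x(1) bc nonzero_mult[OF x(2) a] one by (subst fraction_eq_iff) (auto simp: m_comm)
    qed
  qed
qed

end


section \<open>Residue fields\<close>

text \<open>Numerator and denominator are taken in A and not in A/P, so that equality of fractions
  becomes membership of an element of A in P (\<open>rf_eq_iff\<close>).\<close>

definition residue_fraction ::
    "('a, 'm) ring_scheme \<Rightarrow> 'a set \<Rightarrow> 'a \<Rightarrow> 'a \<Rightarrow> ('a set \<times> 'a set) set"
  where "residue_fraction A P a b = fraction (A Quot P) (P +>\<^bsub>A\<^esub> a) (P +>\<^bsub>A\<^esub> b)"

context primeideal begin

abbreviation "RF \<equiv> residue_field R I"
abbreviation "rf \<equiv> residue_fraction R I"

lemma quot_domain: "domain (R Quot I)"
  by (rule quotient_is_domain)

sublocale quot: domain "R Quot I" by (rule quot_domain)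

lemma quot_simps:
  "\<one>\<^bsub>R Quot I\<^esub> = I +> \<one>" "\<zero>\<^bsub>R Quot I\<^esub> = I"
  "a \<in> carrier R \<Longrightarrow> b \<in> carrier R \<Longrightarrow> (I +> a) \<otimes>\<^bsub>R Quot I\<^esub> (I +> b) = I +> (a \<otimes> b)"
  "a \<in> carrier R \<Longrightarrow> b \<in> carrier R \<Longrightarrow> (I +> a) \<oplus>\<^bsub>R Quot I\<^esub> (I +> b) = I +> (a \<oplus> b)"
  by (simp_all add: FactRing_def rcoset_mult_add a_rcos_sum)

lemma quot_closed: "a \<in> carrier R \<Longrightarrow> I +> a \<in> carrier (R Quot I)"
  by (simp add: FactRing_def a_rcosetsI[OF a_subset])

lemma quot_cases:
  assumes "A \<in> carrier (R Quot I)"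
  obtains a where "a \<in> carrier R" "A = I +> a"
  using assms unfolding FactRing_def A_RCOSETS_def' by auto

lemma quot_eq_iff: "a \<in> carrier R \<Longrightarrow> b \<in> carrier R \<Longrightarrow> I +> a = I +> b \<longleftrightarrow> a \<ominus> b \<in> I"
  using quotient_eq_iff_same_a_r_cos[OF is_ideal] by simp

lemma quot_eq_zero_iff: "a \<in> carrier R \<Longrightarrow> I +> a = I \<longleftrightarrow> a \<in> I"
  using a_rcos_const rcos_const_imp_mem by blast

lemma quot_nonzero: "b \<in> carrier R - I \<Longrightarrow> I +> b \<in> quot.nonzero"
  using quot_closed quot_eq_zero_iff by (auto simp: quot_simps)

lemma one_notin: "\<one> \<in> carrier R - I"
  using I_notcarr one_imp_carrier by blast

lemma RF_field: "field RF"
  unfolding residue_field_def by (rule quot.fraction_field_is_field)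

lemma rf_closed: "a \<in> carrier R \<Longrightarrow> b \<in> carrier R - I \<Longrightarrow> rf a b \<in> carrier RF"
  unfolding residue_field_def residue_fraction_def
  by (intro quot.fraction_closed quot_closed quot_nonzero)

lemma rf_cases:
  assumes "z \<in> carrier RF"
  obtains a b where "a \<in> carrier R" "b \<in> carrier R - I" "z = rf a b"
proof -
  obtain A B where AB: "A \<in> carrier (R Quot I)" "B \<in> quot.nonzero" "z = fraction (R Quot I) A B"
    using assms unfolding residue_field_def by (rule quot.fraction_cases)
  obtain a where a: "a \<in> carrier R" "A = I +> a" using AB(1) by (rule quot_cases)
  obtain b where b: "b \<in> carrier R" "B = I +> b" using AB(2) quot_cases by blast
  have "b \<notin> I" using AB(2) b quot_eq_zero_iff by (auto simp: quot_simps)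
  then show ?thesis using that[of a b] a b AB(3) by (simp add: residue_fraction_def)
qed

lemma rf_eq_iff:
  assumes "a \<in> carrier R" "b \<in> carrier R - I" "c \<in> carrier R" "d \<in> carrier R - I"
  shows "rf a b = rf c d \<longleftrightarrow> a \<otimes> d \<ominus> c \<otimes> b \<in> I"
  unfolding residue_fraction_def
  using assms quot.fraction_eq_iff[OF quot_closed[OF assms(1)] quot_nonzero[OF assms(2)]
    quot_closed[OF assms(3)] quot_nonzero[OF assms(4)]] by (simp add: quot_closed quot_nonzero quot_simps(3) quot_eq_iff)

lemma mult_notin: "b \<in> carrier R - I \<Longrightarrow> d \<in> carrier R - I \<Longrightarrow> b \<otimes> d \<in> carrier R - I"
  using I_prime by auto

lemma rf_mult:
  assumes "a \<in> carrier R" "b \<in> carrier R - I" "c \<in> carrier R" "d \<in> carrier R - I"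
  shows "rf a b \<otimes>\<^bsub>RF\<^esub> rf c d = rf (a \<otimes> c) (b \<otimes> d)"
  unfolding residue_fraction_def residue_field_def
  using assms quot.fraction_mult[OF quot_closed[OF assms(1)] quot_nonzero[OF assms(2)]
    quot_closed[OF assms(3)] quot_nonzero[OF assms(4)]] by (simp add: quot_closed quot_nonzero quot_simps(3))

lemma rf_add:
  assumes "a \<in> carrier R" "b \<in> carrier R - I" "c \<in> carrier R" "d \<in> carrier R - I"
  shows "rf a b \<oplus>\<^bsub>RF\<^esub> rf c d = rf (a \<otimes> d \<oplus> c \<otimes> b) (b \<otimes> d)"
  unfolding residue_fraction_def residue_field_def
  using assms quot.fraction_add[OF quot_closed[OF assms(1)] quot_nonzero[OF assms(2)]
    quot_closed[OF assms(3)] quot_nonzero[OF assms(4)]] by (simp add: quot_closed quot_nonzero quot_simps(3,4))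

lemma rf_one: "\<one>\<^bsub>RF\<^esub> = rf \<one> \<one>"
  unfolding residue_fraction_def residue_field_def quot.fraction_field_simps quot_simps ..

lemma rf_zero: "\<zero>\<^bsub>RF\<^esub> = rf \<zero> \<one>"
proof -
  have "I +> \<zero> = I" using quot_eq_zero_iff[of \<zero>] by simp
  then show ?thesis
    unfolding residue_fraction_def residue_field_def quot.fraction_field_simps quot_simps by simp
qed

lemma rf_hom: "(\<lambda>t. rf t \<one>) \<in> ring_hom R RF"
  by (rule ring_hom_memI) (use one_notin in \<open>auto simp: rf_closed rf_mult rf_add rf_one\<close>)

lemma rf_eq_zero_iff: "t \<in> carrier R \<Longrightarrow> rf t \<one> = \<zero>\<^bsub>RF\<^esub> \<longleftrightarrow> t \<in> I"
  using one_notin by (simp add: rf_zero rf_eq_iff a_minus_def)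

lemma rf_mult_denominator:
  assumes "a \<in> carrier R" "b \<in> carrier R - I"
  shows "rf a b \<otimes>\<^bsub>RF\<^esub> rf b \<one> = rf a \<one>"
proof -
  have "a \<otimes> b \<otimes> \<one> \<ominus> a \<otimes> (b \<otimes> \<one>) = \<zero>" using assms by (simp add: a_minus_def r_neg)
  then show ?thesis
    using assms one_notin mult_notin[OF assms(2) one_notin] rf_eq_iff[of "a \<otimes> b" "b \<otimes> \<one>" a \<one>]
    by (simp add: rf_mult a_minus_def r_neg)
qed

end

lemma (in primeideal) restrict_primeideal:
  assumes B: "subring B R"
  shows "primeideal (I \<inter> B) (R\<lparr>carrier := B\<rparr>)"
proof -
  note Bs = subringE[OF B]
  interpret B: cring "R\<lparr>carrier := B\<rparr>"
    using subcring_iff[OF Bs(1)] subcringI'[OF B] by simp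
  have hom: "id \<in> ring_hom (R\<lparr>carrier := B\<rparr>) R"
    using Bs(1) by (auto simp: ring_hom_def)
  then interpret h: ring_hom_cring "R\<lparr>carrier := B\<rparr>" R id
    by (intro ring_hom_cringI ring_hom_ringI2 B.ring_axioms ring_axioms B.is_cring is_cring)
  have "primeideal {r \<in> carrier (R\<lparr>carrier := B\<rparr>). id r \<in> I} (R\<lparr>carrier := B\<rparr>)"
    by (rule h.ring.primeideal_vimage) (auto intro: B.is_cring primeideal_axioms)
  moreover have "{r \<in> carrier (R\<lparr>carrier := B\<rparr>). id r \<in> I} = I \<inter> B" by auto
  ultimately show ?thesis by simp
qed

section \<open>The residual map of a subring\<close>

context primeideal begin

context
  fixes B assumes B: "subring B R"
begin

abbreviation "RB \<equiv> R\<lparr>carrier := B\<rparr>"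

interpretation PB: primeideal "I \<inter> B" RB by (rule restrict_primeideal[OF B])

text \<open>All unions in \<open>residual_map\<close> are constant: the inner ones over the elements
  of a coset modulo \<open>I \<inter> B\<close>, the outer one over the representatives of a
  fraction.\<close>

lemma residual_map_fraction:
  assumes a: "a \<in> B" and b: "b \<in> B - I"
  shows "residual_map R I (residue_fraction RB (I \<inter> B) a b) = rf a b"
proof -
  note Bs = subringE[OF B]
  have UN: "(\<Union>x\<in>(I \<inter> B) +>\<^bsub>RB\<^esub> c. I +> x) = I +> c" if c: "c \<in> B" for c
  proof (rule UN_eq_const)
    show "(I \<inter> B) +>\<^bsub>RB\<^esub> c \<noteq> {}" using PB.a_rcos_self[of c] c by auto
    fix x assume "x \<in> (I \<inter> B) +>\<^bsub>RB\<^esub> c"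
    then obtain p where "p \<in> I" "p \<in> B" "x = p \<oplus> c"
      unfolding a_r_coset_def r_coset_def by auto
    moreover have "c \<in> carrier R" using c Bs(1) by blast
    ultimately have "x \<in> I +> c" unfolding a_r_coset_def' by auto
    then show "I +> x = I +> c" using a_repr_independence[OF _ \<open>c \<in> carrier R\<close>] a_subgroup by simp
  qed
  have main: "fraction (R Quot I) (\<Union>x\<in>A'. I +> x) (\<Union>x\<in>B'. I +> x) = rf a b"
    if mem: "(A', B') \<in> residue_fraction RB (I \<inter> B) a b" for A' B'
  proof -
    have bB: "b \<in> carrier RB - (I \<inter> B)" using b by simp
    have 1: "A' \<in> carrier (RB Quot (I \<inter> B))" "B' \<in> PB.quot.nonzero"
      and 2: "((I \<inter> B) +>\<^bsub>RB\<^esub> a) \<otimes>\<^bsub>RB Quot (I \<inter> B)\<^esub> B' = A' \<otimes>\<^bsub>RB Quot (I \<inter> B)\<^esub> ((I \<inter> B) +>\<^bsub>RB\<^esub> b)"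
      using mem PB.quot.mem_fraction_iff[OF PB.quot_closed PB.quot_nonzero[OF bB], of a A' B'] a
      unfolding residue_fraction_def by auto
    obtain a' where a': "a' \<in> B" "A' = (I \<inter> B) +>\<^bsub>RB\<^esub> a'"
      using PB.quot_cases[OF 1(1)] by auto
    obtain b' where b': "b' \<in> B" "B' = (I \<inter> B) +>\<^bsub>RB\<^esub> b'"
      using PB.quot_cases[of B'] 1(2) by auto
    have "b' \<notin> I"
      using 1(2) b' PB.quot_eq_zero_iff[of b'] by (auto simp: PB.quot_simps)
    have c: "a \<in> carrier R" "b \<in> carrier R - I" "a' \<in> carrier R" "b' \<in> carrier R - I"
      using a b a'(1) b'(1) \<open>b' \<notin> I\<close> Bs(1) by auto
    have "(I \<inter> B) +>\<^bsub>RB\<^esub> (a \<otimes> b') = (I \<inter> B) +>\<^bsub>RB\<^esub> (a' \<otimes> b)"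
      using 2 PB.quot_simps(3)[of a b'] PB.quot_simps(3)[of a' b] a b a' b' by simp
    then have "(\<Union>x\<in>(I \<inter> B) +>\<^bsub>RB\<^esub> (a \<otimes> b'). I +> x) = (\<Union>x\<in>(I \<inter> B) +>\<^bsub>RB\<^esub> (a' \<otimes> b). I +> x)"
      by simp
    then have "I +> (a \<otimes> b') = I +> (a' \<otimes> b)"
      using UN Bs(6) a b a'(1) b'(1) by simp
    then have "I +> (a' \<otimes> b) = I +> (a \<otimes> b')" by simp
    then have "a' \<otimes> b \<ominus> a \<otimes> b' \<in> I" using c quot_eq_iff by simp
    then have "rf a' b' = rf a b" using c by (subst rf_eq_iff) auto
    then show ?thesis
      unfolding a'(2) b'(2) UN[OF a'(1)] UN[OF b'(1)] by (simp add: residue_fraction_def)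
  qed
  have ne: "residue_fraction RB (I \<inter> B) a b \<noteq> {}"
    unfolding residue_fraction_def using a b by (intro PB.quot.fraction_nonempty PB.quot_closed PB.quot_nonzero) auto
  show ?thesis
    unfolding residual_map_def by (rule UN_eq_const[OF ne]) (use main in auto)
qed

lemma residual_map_hom: "residual_map R I \<in> ring_hom (residue_field RB (I \<inter> B)) RF"
proof (rule ring_hom_memI)
  note Bs = subringE[OF B]
  fix x assume "x \<in> carrier (residue_field RB (I \<inter> B))"
  then obtain a b where x: "a \<in> B" "b \<in> B - I" "x = residue_fraction RB (I \<inter> B) a b"
    using PB.rf_cases by (metis Diff_iff IntI partial_object.simps(1) partial_object.surjective partial_object.update_convs(1))
  show "residual_map R I x \<in> carrier RF"
    unfolding x(3) residual_map_fraction[OF x(1,2)] using x Bs(1) by (intro rf_closed) auto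
  fix y assume "y \<in> carrier (residue_field RB (I \<inter> B))"
  then obtain c d where y: "c \<in> B" "d \<in> B - I" "y = residue_fraction RB (I \<inter> B) c d"
    using PB.rf_cases by (metis Diff_iff IntI partial_object.simps(1) partial_object.surjective partial_object.update_convs(1))
  have c: "a \<in> carrier R" "b \<in> carrier R - I" "c \<in> carrier R" "d \<in> carrier R - I"
    using x y Bs(1) by auto
  have bd: "b \<otimes> d \<in> B - I" using x(2) y(2) Bs(6) mult_notin[OF c(2,4)] by auto
  show "residual_map R I (x \<otimes>\<^bsub>residue_field RB (I \<inter> B)\<^esub> y) = residual_map R I x \<otimes>\<^bsub>RF\<^esub> residual_map R I y"
    unfolding x(3) y(3) residual_map_fraction[OF x(1,2)] residual_map_fraction[OF y(1,2)] rf_mult[OF c]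
    using PB.rf_mult[of a b c d] x y Bs(6) bd residual_map_fraction[of "a \<otimes> c" "b \<otimes> d"] by simp
  show "residual_map R I (x \<oplus>\<^bsub>residue_field RB (I \<inter> B)\<^esub> y) = residual_map R I x \<oplus>\<^bsub>RF\<^esub> residual_map R I y"
    unfolding x(3) y(3) residual_map_fraction[OF x(1,2)] residual_map_fraction[OF y(1,2)] rf_add[OF c]
    using PB.rf_add[of a b c d] x y Bs(6,7) bd residual_map_fraction[of "a \<otimes> d \<oplus> c \<otimes> b" "b \<otimes> d"] by simp
next
  show "residual_map R I \<one>\<^bsub>residue_field RB (I \<inter> B)\<^esub> = \<one>\<^bsub>RF\<^esub>"
    using residual_map_fraction[of \<one> \<one>] subringE(3)[OF B] one_notin PB.rf_one rf_one by simp
qed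

lemma residual_field_subfield:
  "subfield (residual_map R I ` carrier (residue_field RB (I \<inter> B))) RF"
proof -
  interpret RF: field RF by (rule RF_field)
  interpret k: field "residue_field RB (I \<inter> B)" by (rule PB.RF_field)
  interpret h: ring_hom_ring "residue_field RB (I \<inter> B)" RF "residual_map R I"
    by (rule ring_hom_ringI2[OF k.ring_axioms RF.ring_axioms residual_map_hom])
  show ?thesis
    by (rule h.img_is_subfield(2)[OF k.carrier_is_subfield]) simp
qed

lemma residual_field_eq:
  "residual_map R I ` carrier (residue_field RB (I \<inter> B)) = {rf a b | a b. a \<in> B \<and> b \<in> B - I}"
proof -
  have "z \<in> carrier (residue_field RB (I \<inter> B)) \<longleftrightarrow>
      (\<exists>a b. a \<in> B \<and> b \<in> B - I \<and> z = residue_fraction RB (I \<inter> B) a b)" for z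
    using PB.rf_cases[of z] PB.rf_closed by auto
  then show ?thesis
    using residual_map_fraction by (auto simp: image_iff) metis+
qed

end

end


section \<open>Composites of separable subextensions\<close>

text \<open>Every element of the residue field is a quotient of images of ring elements, and the
  denominator stays invertible in C, so it can be cancelled.\<close>

lemma (in primeideal) infinitely_near_residue_eq:
  assumes near: "infinitely_near C RF K \<alpha> \<beta>"
    and eq: "\<And>t. t \<in> carrier R \<Longrightarrow> \<alpha> (rf t \<one>) = \<beta> (rf t \<one>)" and z: "z \<in> carrier RF"
  shows "\<alpha> z = \<beta> z"
proof -
  interpret RF: field RF by (rule RF_field)
  note near' = infinitely_nearD[OF near]
  interpret C: cring C by (rule near')
  interpret \<alpha>: ring_hom_cring RF C \<alpha>
    by (intro ring_hom_cringI ring_hom_ringI2 RF.ring_axioms C.ring_axioms near' RF.is_cring)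
  interpret \<beta>: ring_hom_cring RF C \<beta>
    by (intro ring_hom_cringI ring_hom_ringI2 RF.ring_axioms C.ring_axioms near' RF.is_cring)
  obtain a b where ab: "a \<in> carrier R" "b \<in> carrier R - I" "z = rf a b" using z by (rule rf_cases)
  let ?a = "rf a \<one>" and ?b = "rf b \<one>"
  have c: "?a \<in> carrier RF" "?b \<in> carrier RF" using ab one_notin rf_closed by auto
  have "?b \<noteq> \<zero>\<^bsub>RF\<^esub>" using ab rf_eq_zero_iff by auto
  then have inv: "inv\<^bsub>RF\<^esub> ?b \<in> carrier RF" "?b \<otimes>\<^bsub>RF\<^esub> inv\<^bsub>RF\<^esub> ?b = \<one>\<^bsub>RF\<^esub>"
    using c RF.field_Units by auto
  have zb: "z \<otimes>\<^bsub>RF\<^esub> ?b = ?a" unfolding ab(3) by (rule rf_mult_denominator[OF ab(1,2)])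
  have key: "\<alpha> z \<otimes>\<^bsub>C\<^esub> \<alpha> ?b = \<beta> z \<otimes>\<^bsub>C\<^esub> \<alpha> ?b"
    using \<alpha>.hom_mult[OF z c(2)] \<beta>.hom_mult[OF z c(2)] eq[of a] eq[of b] ab(1,2) unfolding zb by simp
  have one: "\<alpha> ?b \<otimes>\<^bsub>C\<^esub> \<alpha> (inv\<^bsub>RF\<^esub> ?b) = \<one>\<^bsub>C\<^esub>"
    using \<alpha>.hom_mult[OF c(2) inv(1)] inv(2) by simp
  have cl: "\<alpha> z \<in> carrier C" "\<beta> z \<in> carrier C" "\<alpha> ?b \<in> carrier C" "\<alpha> (inv\<^bsub>RF\<^esub> ?b) \<in> carrier C"
    using z c inv by auto
  have "\<alpha> z = \<alpha> z \<otimes>\<^bsub>C\<^esub> \<alpha> ?b \<otimes>\<^bsub>C\<^esub> \<alpha> (inv\<^bsub>RF\<^esub> ?b)"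
    using cl one by (simp add: C.m_assoc)
  also have "\<dots> = \<beta> z"
    unfolding key using cl one by (simp add: C.m_assoc)
  finally show ?thesis .
qed

section \<open>Residual extensions at a prime of an intermediate ring\<close>

context FCP_extension begin

context
  fixes T Q
  assumes T: "T \<in> subalgebras S R" and Q: "primeideal Q (S\<lparr>carrier := T\<rparr>)"
begin

interpretation Q: primeideal Q "S\<lparr>carrier := T\<rparr>" by (rule Q)

abbreviation (input) "resfield \<equiv> residue_field (S\<lparr>carrier := T\<rparr>) Q"
abbreviation (input) "basefield \<equiv>
  residual_map (S\<lparr>carrier := T\<rparr>) Q ` carrier (residue_field (S\<lparr>carrier := R\<rparr>) (Q \<inter> R))"
abbreviation (input) "res \<equiv> \<lambda>t. residue_fraction (S\<lparr>carrier := T\<rparr>) Q t \<one>"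

lemma subalgebra_subring:
  assumes "A \<in> subalgebras S R" "A \<subseteq> T"
  shows "subring A (S\<lparr>carrier := T\<rparr>)"
proof -
  have "ring ((S\<lparr>carrier := T\<rparr>)\<lparr>carrier := A\<rparr>)"
    using subring_is_ring[OF subalgebraD(1)[OF assms(1)]] by simp
  then show ?thesis using Q.ring_incl_imp_subring[of A] assms(2) by simp
qed

lemma base_subring: "subring R (S\<lparr>carrier := T\<rparr>)"
  by (rule subalgebra_subring[OF base_subalgebra subalgebraD(2)[OF T]])

lemma basefield_subfield: "subfield basefield resfield"
  using Q.residual_field_subfield[OF base_subring] by simp

lemma basefield_eq:
  "basefield = {residue_fraction (S\<lparr>carrier := T\<rparr>) Q a b | a b. a \<in> R \<and> b \<in> R - Q}"
  using Q.residual_field_eq[OF base_subring] by simp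

lemma res_base: "res ` R \<subseteq> basefield"
  unfolding basefield_eq using Q.one_notin subringE(3)[OF base] by auto

lemma res_hom: "res \<in> ring_hom (S\<lparr>carrier := T\<rparr>) resfield"
  using Q.rf_hom by simp

text \<open>An equation of integral dependence reduces to a relation over the base field that is
  nonzero because its leading coefficient remains one.\<close>

lemma res_algebraic:
  assumes int: "integral_extension S R" and t: "t \<in> T"
  shows "(ring.algebraic resfield over basefield) (res t)"
proof -
  interpret L: field resfield by (rule Q.RF_field)
  interpret h: ring_hom_ring "S\<lparr>carrier := T\<rparr>" resfield res
    by (rule ring_hom_ringI2[OF Q.ring_axioms L.ring_axioms res_hom])
  note T' = subalgebraD[OF T]
  obtain p where p: "set p \<subseteq> R" "eval (\<one> # p) t = \<zero>"
    using int t T'(3) unfolding integral_extension_def by blast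
  have "Q.eval (\<one> # p) t = \<zero>"
    using p(2) eval_consistent[OF T'(1)] by simp
  then have "L.eval (map res (\<one> # p)) (res t) = \<zero>\<^bsub>resfield\<^esub>"
    using h.eval_hom'[of t "\<one> # p"] p(1) T' t subringE(3)[OF T'(1)] h.hom_zero by auto
  moreover have "map res (\<one> # p) \<in> carrier (basefield[X]\<^bsub>resfield\<^esub>)"
    unfolding univ_poly_carrier[symmetric]
  proof (rule L.polynomialI)
    have "set (\<one> # p) \<subseteq> R" using p(1) subringE(3)[OF base] by simp
    then have "res ` set (\<one> # p) \<subseteq> basefield" using res_base by blast
    then show "set (map res (\<one> # p)) \<subseteq> basefield" by (simp only: set_map)
    show "lead_coeff (map res (\<one> # p)) \<noteq> \<zero>\<^bsub>resfield\<^esub>" using h.hom_one by simp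
  qed
  ultimately show ?thesis
    by (intro L.algebraicI[of "map res (\<one> # p)"]) auto
qed

text \<open>By FCP the ring T is of finite type, so its residue field is generated by finitely many
  elements over the base field, and these are algebraic by integrality.\<close>

lemma residue_finite_dimension:
  assumes int: "integral_extension S R"
  shows "ring.finite_dimension resfield basefield (carrier resfield)"
proof -
  interpret L: field resfield by (rule Q.RF_field)
  interpret h: ring_hom_ring "S\<lparr>carrier := T\<rparr>" resfield res
    by (rule ring_hom_ringI2[OF Q.ring_axioms L.ring_axioms res_hom])
  note T' = subalgebraD[OF T] and K = basefield_subfield
  obtain A where A: "finite A" "A \<subseteq> T" "generate_ring (S\<lparr>carrier := T\<rparr>) (R \<union> A) = T"
    using finite_type_subalgebra[OF T] unfolding finite_type_def by auto
  obtain xs where xs: "set xs = A" using finite_list[OF A(1)] by blast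
  let ?ys = "map res xs"
  define M where "M = L.finite_extension basefield ?ys"
  have ys: "set ?ys \<subseteq> carrier resfield" using A(2) xs by auto
  have alg: "(L.algebraic over basefield) y" if "y \<in> set ?ys" for y
    using that res_algebraic[OF int] A(2) xs by auto
  have M: "subfield M resfield" and fin: "L.finite_dimension basefield M"
    unfolding M_def using L.finite_extension_is_subfield[OF K ys alg]
      L.finite_extension_finite_dimension(1)[OF K ys alg] by auto
  have KM: "basefield \<subseteq> M" and ysM: "set ?ys \<subseteq> M"
    unfolding M_def using L.finite_extension_incl[OF subfieldE(3)[OF K] ys]
      L.finite_extension_mem[OF subfieldE(1)[OF K] ys] by auto
  note Ms = subringE[OF subfieldE(1)[OF M]]
  \<comment> \<open>The elements of T with residue in M form a subring containing R and the
    generators, hence all of T; quotients of residues then stay in M because M is a field.\<close>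
  have "subring {t \<in> T. res t \<in> M} (S\<lparr>carrier := T\<rparr>)"
  proof (rule Q.subringI)
    show "\<one>\<^bsub>S\<lparr>carrier := T\<rparr>\<^esub> \<in> {t \<in> T. res t \<in> M}"
      using h.hom_one Ms(3) subringE(3)[OF T'(1)] by simp
    fix a assume a: "a \<in> {t \<in> T. res t \<in> M}"
    then show "\<ominus>\<^bsub>S\<lparr>carrier := T\<rparr>\<^esub> a \<in> {t \<in> T. res t \<in> M}"
      using h.hom_a_inv[of a] Ms(5) Q.a_inv_closed[of a] by simp
    fix b assume b: "b \<in> {t \<in> T. res t \<in> M}"
    show "a \<otimes>\<^bsub>S\<lparr>carrier := T\<rparr>\<^esub> b \<in> {t \<in> T. res t \<in> M}"
      using a b h.hom_mult[of a b] Ms(6) Q.m_closed[of a b] by simp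
    show "a \<oplus>\<^bsub>S\<lparr>carrier := T\<rparr>\<^esub> b \<in> {t \<in> T. res t \<in> M}"
      using a b h.hom_add[of a b] Ms(7) Q.a_closed[of a b] by simp
  qed auto
  moreover have "R \<union> A \<subseteq> {t \<in> T. res t \<in> M}"
    using res_base KM ysM xs A(2) T'(2) by auto
  ultimately have "generate_ring (S\<lparr>carrier := T\<rparr>) (R \<union> A) \<subseteq> {t \<in> T. res t \<in> M}"
    using A(2) T'(2) by (intro Q.generate_ring_min_subring1) auto
  then have resM: "res t \<in> M" if "t \<in> T" for t using that A(3) by auto
  have "carrier resfield \<subseteq> M"
  proof
    fix z assume z: "z \<in> carrier resfield"
    obtain a b where ab: "a \<in> carrier (S\<lparr>carrier := T\<rparr>)" "b \<in> carrier (S\<lparr>carrier := T\<rparr>) - Q"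
        "z = residue_fraction (S\<lparr>carrier := T\<rparr>) Q a b"
      using z by (rule Q.rf_cases)
    have "res b \<noteq> \<zero>\<^bsub>resfield\<^esub>" using ab(2) Q.rf_eq_zero_iff[of b] by simp
    then have b: "res b \<in> M - {\<zero>\<^bsub>resfield\<^esub>}" using resM ab(2) by simp
    have "res b \<otimes>\<^bsub>resfield\<^esub> z = res a"
      using Q.rf_mult_denominator[OF ab(1,2)] z b Ms(1) L.m_comm[of z "res b"] unfolding ab(3) by auto
    then have "res b \<otimes>\<^bsub>resfield\<^esub> z \<in> M" using resM ab(1) by simp
    then show "z \<in> M" by (rule L.subfield_m_inv_simprule[OF M b z])
  qed
  then have "M = carrier resfield" using Ms(1) by blast
  with fin show ?thesis by simp
qed

text \<open>Finiteness of the residual extension lets vanishing differentials imply separability.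
  Since denominators are invertible, agreement on residues of elements of T is enough.\<close>

lemma separable_residue_extension:
  assumes int: "integral_extension S R"
    and eq: "\<And>(C :: (('a set \<times> 'a set) set \<times> ('a set \<times> 'a set) set \<Rightarrow>\<^sub>0 int) set set ring) \<alpha> \<beta> t.
      infinitely_near C resfield basefield \<alpha> \<beta> \<Longrightarrow> t \<in> T \<Longrightarrow> \<alpha> (res t) = \<beta> (res t)"
  shows "separable_extension resfield basefield"
proof -
  interpret L: field resfield by (rule Q.RF_field)
  interpret LK: algebra_over resfield basefield
    by (intro algebra_over.intro algebra_over_axioms.intro L.is_cring subfieldE(3)[OF basefield_subfield])
  have "trivial_group (kaehler_differentials resfield basefield)"
  proof (rule LK.trivial_kaehlerI)
    fix C :: "(('a set \<times> 'a set) set \<times> ('a set \<times> 'a set) set \<Rightarrow>\<^sub>0 int) set set ring" and \<alpha> \<beta> z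
    assume near: "infinitely_near C resfield basefield \<alpha> \<beta>" and z: "z \<in> carrier resfield"
    have "\<alpha> (res t) = \<beta> (res t)" if "t \<in> T" for t
      by (rule eq[OF near that])
    then have "\<alpha> (residue_fraction (S\<lparr>carrier := T\<rparr>) Q t \<one>\<^bsub>S\<lparr>carrier := T\<rparr>\<^esub>) =
        \<beta> (residue_fraction (S\<lparr>carrier := T\<rparr>) Q t \<one>\<^bsub>S\<lparr>carrier := T\<rparr>\<^esub>)"
      if "t \<in> carrier (S\<lparr>carrier := T\<rparr>)" for t using that by simp
    then show "\<alpha> z = \<beta> z"
      by (rule Q.infinitely_near_residue_eq[OF near _ z])
  qed
  then show ?thesis
    by (rule trivial_kaehler_imp_separable[OF L.field_axioms basefield_subfield residue_finite_dimension[OF int]])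
qed

lemma infinitely_near_res:
  assumes "infinitely_near C resfield basefield \<alpha> \<beta>"
  shows "infinitely_near C (S\<lparr>carrier := T\<rparr>) R (\<alpha> \<circ> res) (\<beta> \<circ> res)"
  using infinitely_near_comp[OF assms res_hom res_base] .

text \<open>The residue at Q of an element of A comes from the residue field of A at
  \<open>Q \<inter> A\<close>, which is separable over the base. Pulled back along the residual map,
  \<alpha> and \<beta> coincide there.\<close>

lemma separable_subalgebra_imp_eq:
  assumes A: "A \<in> subalgebras S R" "A \<subseteq> T" and sep: "kappa_separable (S\<lparr>carrier := A\<rparr>) R"
    and near: "infinitely_near C resfield basefield \<alpha> \<beta>" and t: "t \<in> A"
  shows "\<alpha> (res t) = \<beta> (res t)"
proof -
  let ?SA = "S\<lparr>carrier := A\<rparr>" and ?P = "Q \<inter> A"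
  let ?j = "residual_map (S\<lparr>carrier := T\<rparr>) Q"
  note As = subalgebra_subring[OF A]
  have P: "primeideal ?P ?SA" using Q.restrict_primeideal[OF As] by simp
  then interpret P: primeideal ?P ?SA .
  have R_A: "R \<subseteq> A" using subalgebraD(2)[OF A(1)] .
  then have PR: "?P \<inter> R = Q \<inter> R" by blast
  have RsA: "subring R ?SA"
    using P.ring_incl_imp_subring[of R] R_A subring_is_ring[OF base] by simp
  let ?K = "residual_map ?SA ?P ` carrier (residue_field (S\<lparr>carrier := R\<rparr>) (Q \<inter> R))"
  have sepL: "separable_extension (residue_field ?SA ?P) ?K"
  proof -
    have "separable_extension (residue_field ?SA ?P)
        (residual_map ?SA ?P ` carrier (residue_field (?SA\<lparr>carrier := R\<rparr>) (?P \<inter> R)))"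
      using sep P unfolding kappa_separable_def by blast
    then show ?thesis unfolding PR by simp
  qed
  have K: "subfield ?K (residue_field ?SA ?P)"
    using P.residual_field_subfield[OF RsA] PR by simp
  have K_eq: "?K = {residue_fraction ?SA ?P a b | a b. a \<in> R \<and> b \<in> R - ?P}"
    using P.residual_field_eq[OF RsA] PR by simp
  have j: "?j (residue_fraction ?SA ?P a b) = residue_fraction (S\<lparr>carrier := T\<rparr>) Q a b"
    if "a \<in> A" "b \<in> A - Q" for a b
    using Q.residual_map_fraction[OF As that] by simp
  have hom: "?j \<in> ring_hom (residue_field ?SA ?P) resfield"
    using Q.residual_map_hom[OF As] by simp
  have "?j ` ?K \<subseteq> basefield"
  proof
    fix w assume "w \<in> ?j ` ?K"
    then obtain a b where ab: "a \<in> R" "b \<in> R - ?P" "w = ?j (residue_fraction ?SA ?P a b)"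
      unfolding K_eq by blast
    then have "b \<in> R - Q" "a \<in> A" "b \<in> A - Q" using R_A by auto
    then show "w \<in> basefield"
      unfolding basefield_eq ab(3) using j[of a b] ab(1) by auto
  qed
  from infinitely_near_comp[OF near hom this]
  have near': "infinitely_near C (residue_field ?SA ?P) ?K (\<alpha> \<circ> ?j) (\<beta> \<circ> ?j)" .
  have one: "\<one> \<in> A - Q" using Q.one_notin subringE(3)[OF subalgebraD(1)[OF A(1)]] by simp
  have "residue_fraction ?SA ?P t \<one> \<in> carrier (residue_field ?SA ?P)"
    using P.rf_closed[of t \<one>] t one by simp
  from separable_imp_eq[OF P.RF_field K sepL near' this]
  show ?thesis using j[OF t one] by simp
qed

end

section \<open>Comparison with the kappa-separable closure\<close>

lemma integral_subalgebra:
  assumes "integral_extension S R" "T \<in> subalgebras S R"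
  shows "integral_extension (S\<lparr>carrier := T\<rparr>) R"
  using assms(1) subalgebraD[OF assms(2)] eval_consistent[of T]
  unfolding integral_extension_def by (simp add: subset_iff)

text \<open>A pair on the residue field pulls back along the reduction to a pair on T, which
  coincides because T is unramified; base change of differentials is thereby avoided.\<close>

lemma unramified_imp_kappa_separable:
  assumes int: "integral_extension S R" and T: "T \<in> subalgebras S R"
    and unr: "unramified (S\<lparr>carrier := T\<rparr>) R"
  shows "kappa_separable (S\<lparr>carrier := T\<rparr>) R"
  unfolding kappa_separable_def
proof (intro conjI allI impI integral_subalgebra[OF int T])
  fix Q assume Q: "primeideal Q (S\<lparr>carrier := T\<rparr>)"
  let ?T = "S\<lparr>carrier := T\<rparr>"
  have "separable_extension (residue_field ?T Q)
      (residual_map ?T Q ` carrier (residue_field (S\<lparr>carrier := R\<rparr>) (Q \<inter> R)))"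
  proof (rule separable_residue_extension[OF T Q int])
    fix C :: "(('a set \<times> 'a set) set \<times> ('a set \<times> 'a set) set \<Rightarrow>\<^sub>0 int) set set ring" and \<alpha> \<beta> t
    assume near: "infinitely_near C (residue_field ?T Q)
        (residual_map ?T Q ` carrier (residue_field (S\<lparr>carrier := R\<rparr>) (Q \<inter> R))) \<alpha> \<beta>" and t: "t \<in> T"
    from unramified_imp_eq[OF T unr infinitely_near_res[OF T Q near] t]
    show "\<alpha> (residue_fraction ?T Q t \<one>) = \<beta> (residue_fraction ?T Q t \<one>)" by simp
  qed
  then show "separable_extension (residue_field ?T Q)
      (residual_map ?T Q ` carrier (residue_field (?T\<lparr>carrier := R\<rparr>) (Q \<inter> R)))" by simp
qed

text \<open>The residue fields of the composite need no description: two infinitely near maps agree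
  on the residues of A and of B, hence on those of the ring generated by A and B.\<close>

lemma kappa_separable_generate:
  assumes int: "integral_extension S R"
    and A: "A \<in> subalgebras S R" "kappa_separable (S\<lparr>carrier := A\<rparr>) R"
    and B: "B \<in> subalgebras S R" "kappa_separable (S\<lparr>carrier := B\<rparr>) R"
  shows "generate_ring S (A \<union> B) \<in> subalgebras S R"
    and "kappa_separable (S\<lparr>carrier := generate_ring S (A \<union> B)\<rparr>) R"
proof -
  let ?V = "generate_ring S (A \<union> B)"
  let ?T = "S\<lparr>carrier := ?V\<rparr>"
  show V: "?V \<in> subalgebras S R"
    using subalgebraD[OF A(1)] subalgebraD[OF B(1)] by (intro generate_ring_subalgebra) auto
  have sub: "A \<subseteq> ?V" "B \<subseteq> ?V" by (auto intro: generate_ring.incl)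
  show "kappa_separable ?T R"
    unfolding kappa_separable_def
  proof (intro conjI allI impI integral_subalgebra[OF int V])
    fix Q assume Q: "primeideal Q ?T"
    have "separable_extension (residue_field ?T Q)
        (residual_map ?T Q ` carrier (residue_field (S\<lparr>carrier := R\<rparr>) (Q \<inter> R)))"
    proof (rule separable_residue_extension[OF V Q int])
      fix C :: "(('a set \<times> 'a set) set \<times> ('a set \<times> 'a set) set \<Rightarrow>\<^sub>0 int) set set ring" and \<alpha> \<beta> t
      assume near: "infinitely_near C (residue_field ?T Q)
          (residual_map ?T Q ` carrier (residue_field (S\<lparr>carrier := R\<rparr>) (Q \<inter> R))) \<alpha> \<beta>" and t: "t \<in> ?V"
      let ?res = "\<lambda>t. residue_fraction ?T Q t \<one>"
      have eq: "(\<alpha> \<circ> ?res) x = (\<beta> \<circ> ?res) x" if "x \<in> A \<union> B" for x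
        using that separable_subalgebra_imp_eq[OF V Q A(1) sub(1) A(2) near, of x]
          separable_subalgebra_imp_eq[OF V Q B(1) sub(2) B(2) near, of x] by auto
      have "A \<union> B \<subseteq> ?V" using sub by blast
      from equal_on_generators[OF V infinitely_near_res[OF V Q near] this refl eq t]
      show "\<alpha> (?res t) = \<beta> (?res t)" by simp
    qed
    then show "separable_extension (residue_field ?T Q)
        (residual_map ?T Q ` carrier (residue_field (?T\<lparr>carrier := R\<rparr>) (Q \<inter> R)))" by simp
  qed
qed

text \<open>Stability under composites yields the greatest element that \<open>GREATEST\<close>
  presupposes; the family is nonempty because it contains W.\<close>

lemma kappa_separable_subset_closure:
  assumes int: "integral_extension S R"
    and W: "W \<in> subalgebras S R" "kappa_separable (S\<lparr>carrier := W\<rparr>) R"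
  shows "W \<subseteq> kappa_separable_closure S R"
proof -
  let ?P = "\<lambda>V. V \<in> subalgebras S R \<and> kappa_separable (S\<lparr>carrier := V\<rparr>) R"
  let ?F = "Collect ?P"
  have "?F \<subseteq> subalgebras S R" "?F \<noteq> {}" using W by blast+
  moreover have "generate_ring S (A \<union> B) \<in> ?F" if "A \<in> ?F" "B \<in> ?F" for A B
    using that kappa_separable_generate[OF int] by simp
  ultimately have "\<exists>M\<in>?F. \<forall>V\<in>?F. V \<subseteq> M" by (rule exists_greatest)
  then obtain M where M: "?P M" "\<And>V. ?P V \<Longrightarrow> V \<subseteq> M" by blast
  have closure: "kappa_separable_closure S R = M"
    unfolding kappa_separable_closure_def by (rule Greatest_equality[of ?P, OF M])
  show ?thesis
    unfolding closure by (rule M(2)) (intro conjI W)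
qed

end

theorem proposition5p13:
  fixes S :: "('a, 'm) ring_scheme" and R :: "'a set"
  assumes "cring S"
    and "subring R S"
    and "integral_extension S R"
    and "FCP S R"
  shows "\<exists>W.
    W \<in> subalgebras S R \<and> unramified (S\<lparr>carrier := W\<rparr>) R \<and>
    (\<forall>T \<in> subalgebras S R. unramified (S\<lparr>carrier := T\<rparr>) R \<longrightarrow> T \<subseteq> W) \<and>
    u_closed S W \<and>
    u_closure S R \<subseteq> W \<and> W \<subseteq> kappa_separable_closure S R"
proof -
  interpret FCP_extension S R
    by (intro FCP_extension.intro FCP_extension_axioms.intro assms)
  obtain W where W: "W \<in> subalgebras S R" "unramified (S\<lparr>carrier := W\<rparr>) R"
    and max: "\<forall>T \<in> subalgebras S R. unramified (S\<lparr>carrier := T\<rparr>) R \<longrightarrow> T \<subseteq> W"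
    and u: "u_closed S W"
    using greatest_unramified by blast
  have "W \<subseteq> kappa_separable_closure S R"
    by (intro kappa_separable_subset_closure unramified_imp_kappa_separable assms(3) W)
  moreover have "u_closure S R \<subseteq> W"
    by (rule u_closure_subset[OF W(1) u])
  ultimately show ?thesis
    using W max u by blast
qed

end
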